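(* Let $K$ be a field of characteristic zero, let $n\ge 1$, and let $[1,n]=I_1\sqcup\ldots\sqcup I_\ell$ be a partition into consecutive segments, with associated unipotent group $U\subset\mathrm{SL}(n)$. Let $\mathcal F=K(\mathrm{SL}(n))$ and let $\mathcal F^U$ be the field of invariants for the action of $U$ on $\mathrm{SL}(n)$ by conjugation. Then the system of (restrictions to $\mathrm{SL}(n)$ of the) polynomials $\{\mathcal J_{ij}:\ (i,j)\in\mathbb S,\ (i,j)\neq(1,n)\}$ freely generates $\mathcal F^U$ over $K$; that is, these elements lie in $\mathcal F^U$, are algebraically independent over $K$, and generate $\mathcal F^U$ as a field extension of $K$.
   Context: Write $[a,b]$ for the integer segment $\{a,a+1,\ldots,b\}$. The partition $[1,n]=I_1\sqcup\ldots\sqcup I_\ell$ into consecutive segments ($I_1$ first, $I_\ell$ last) defines the parabolic subgroup of block upper triangular matrices, with unipotent radical $U=\{E+A\}$, where $E$ is the identity matrix and $A$ runs over the span of the matrix units $E_{ij}$ with $i\in I_k$, $j\in I_m$, $k<m$. The group $U$ acts on functions by $(\rho(g)f)(x)=f(g^{-1}xg)$. For $i\in[1,n]$ put $i'=n+1-i$, and for $T\subseteq[1,n]$ put $T'=\{i': i\in T\}$. Let $\mathbb S$ be the set of pairs $(i,j)\in[1,n]^2$ such that $i\in I_k$, $j\in I_m'$ with $k\ge m$. Decompose $\mathbb S=\mathbb S_0\sqcup\mathbb S_1$, where $\mathbb S_0$ consists of the pairs with $i+j\le n+1$ (on or above the anti-diagonal) and $\mathbb S_1$ of the pairs with $i+j>n+1$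 (strictly below the anti-diagonal). Let $x_{ij}$ be the standard coordinate functions on $n\times n$ matrices, $\mathbb X=(x_{ij})_{i,j=1}^n$, and let $\mathbb X^*=(x^*_{ij})$ be the adjugate matrix, so $\mathbb X\mathbb X^*=\mathbb X^*\mathbb X=\det(\mathbb X)E$. For $(i,j)\in\mathbb S_0$, $\mathcal J_{ij}$ is the minor of $\mathbb X$ with columns $[1,j]$ and rows $\{i\}\cup[j'+1,n]$. For $(i,j)\in\mathbb S_1$, $\mathcal J_{ij}$ is the determinant of the $j\times j$ matrix whose first $i'$ rows form the submatrix of $\mathbb X$ with columns $[1,j]$ and the last $i'$ rows of $\mathbb X$, and whose remaining $j-i'$ rows form the submatrix of $\mathbb X^*$ with columns $[1,j]$ and the last $j-i'$ rows of $\mathbb X^*$ (rows in each submatrix kept in increasing order). *)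

theory Defs
  imports
    "HOL-Library.Poly_Mapping"
    "HOL-Algebra.QuotRing"
    "HOL-Algebra.Generated_Fields"
    "Jordan_Normal_Form.Determinant"
begin

section \<open>Generalities: evaluation of polynomials, fields of fractions, algebraic independence\<close>

text \<open>
  Polynomials over \<open>'a\<close> with variables indexed by \<open>'v\<close>: finitely supported maps from monomials
  (exponent vectors \<open>'v \<Rightarrow>\<^sub>0 nat\<close>) to coefficients, with convolution as multiplication.
\<close>

type_synonym ('v, 'a) mvpoly = "('v \<Rightarrow>\<^sub>0 nat) \<Rightarrow>\<^sub>0 'a"

definition mconst :: "'a \<Rightarrow> ('v, 'a::zero) mvpoly" where
  "mconst c = Poly_Mapping.single 0 c"

definition mvar :: "'v \<Rightarrow> ('v, 'a::zero_neq_one) mvpoly" where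
  "mvar v = Poly_Mapping.single (Poly_Mapping.single v 1) 1"

definition mvars_in :: "'v set \<Rightarrow> ('v, 'a::zero) mvpoly set" where
  "mvars_in V = {p. \<forall>m \<in> Poly_Mapping.keys p. Poly_Mapping.keys m \<subseteq> V}"

text \<open>Coefficients are sent to the ring \<open>R\<close> by \<open>c\<close> and the variables by \<open>f\<close>.\<close>

definition meval ::
  "('r, 'z) ring_scheme \<Rightarrow> ('a::zero \<Rightarrow> 'r) \<Rightarrow> ('v \<Rightarrow> 'r) \<Rightarrow> ('v, 'a) mvpoly \<Rightarrow> 'r" where
  "meval R c f p =
     (\<Oplus>\<^bsub>R\<^esub>m \<in> Poly_Mapping.keys p. c (Poly_Mapping.lookup p m) \<otimes>\<^bsub>R\<^esub>
        (\<Otimes>\<^bsub>R\<^esub>v \<in> Poly_Mapping.keys m. f v [^]\<^bsub>R\<^esub> Poly_Mapping.lookup m v))"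

text \<open>
  Algebraic independence of the family \<open>(f s)\<^bsub>s \<in> A\<^esub>\<close> in the \<open>K\<close>-algebra \<open>R\<close> with
  structure map \<open>c\<close>. This is a statement about the family, so \<open>f\<close> has to be injective on \<open>A\<close>.
\<close>

definition alg_independent ::
  "('r, 'z) ring_scheme \<Rightarrow> ('a::zero \<Rightarrow> 'r) \<Rightarrow> ('s \<Rightarrow> 'r) \<Rightarrow> 's set \<Rightarrow> bool" where
  "alg_independent R c f A \<longleftrightarrow>
     (\<forall>p \<in> mvars_in A. meval R c f p = \<zero>\<^bsub>R\<^esub> \<longrightarrow> p = 0)"

text \<open>
  The field of fractions of a domain \<open>R\<close>: classes of pairs \<open>(a, b)\<close> with \<open>b \<noteq> 0\<close>, where
  \<open>(a, b)\<close> and \<open>(c, d)\<close> are equivalent iff \<open>a d = c b\<close>.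
\<close>

definition fraction :: "('r, 'z) ring_scheme \<Rightarrow> 'r \<Rightarrow> 'r \<Rightarrow> ('r \<times> 'r) set" where
  "fraction R a b =
     {(c, d). c \<in> carrier R \<and> d \<in> carrier R - {\<zero>\<^bsub>R\<^esub>} \<and> a \<otimes>\<^bsub>R\<^esub> d = c \<otimes>\<^bsub>R\<^esub> b}"

definition fraction_field :: "('r, 'z) ring_scheme \<Rightarrow> ('r \<times> 'r) set ring" where
  "fraction_field R =
     \<lparr>carrier = {fraction R a b | a b. a \<in> carrier R \<and> b \<in> carrier R - {\<zero>\<^bsub>R\<^esub>}},
      monoid.mult = (\<lambda>X Y. \<Union>(a, b) \<in> X. \<Union>(c, d) \<in> Y. fraction R (a \<otimes>\<^bsub>R\<^esub> c) (b \<otimes>\<^bsub>R\<^esub> d)),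
      one = fraction R \<one>\<^bsub>R\<^esub> \<one>\<^bsub>R\<^esub>,
      zero = fraction R \<zero>\<^bsub>R\<^esub> \<one>\<^bsub>R\<^esub>,
      add = (\<lambda>X Y. \<Union>(a, b) \<in> X. \<Union>(c, d) \<in> Y.
               fraction R (a \<otimes>\<^bsub>R\<^esub> d \<oplus>\<^bsub>R\<^esub> c \<otimes>\<^bsub>R\<^esub> b) (b \<otimes>\<^bsub>R\<^esub> d))\<rparr>"


section \<open>The field \<open>K(SL(n))\<close>\<close>

text \<open>
  The ground field \<open>K\<close> is the type \<open>'a\<close>. The variable with index \<open>(i, j)\<close>, \<open>1 \<le> i, j \<le> n\<close>, is
  the coordinate function \<open>x\<^sub>i\<^sub>j\<close>. Matrices in \<open>Jordan_Normal_Form\<close> are indexed from 0, so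
  \<open>x\<^sub>i\<^sub>j\<close> sits at position \<open>(i - 1, j - 1)\<close> of the generic matrix.
\<close>

type_synonym 'a coord_poly = "(nat \<times> nat, 'a) mvpoly"
type_synonym 'a sl_reg = "'a coord_poly set"
type_synonym 'a sl_rat = "('a sl_reg \<times> 'a sl_reg) set"

definition mat_poly_ring :: "nat \<Rightarrow> 'a::field coord_poly ring" where
  "mat_poly_ring n =
     \<lparr>carrier = mvars_in ({1..n} \<times> {1..n}), monoid.mult = (*), one = 1, zero = 0, add = (+)\<rparr>"

definition generic_mat :: "nat \<Rightarrow> 'a::field coord_poly mat" where
  "generic_mat n = mat n n (\<lambda>(a, b). mvar (a + 1, b + 1))"

definition sl_ideal :: "nat \<Rightarrow> 'a::field coord_poly set" where
  "sl_ideal n = PIdl\<^bsub>mat_poly_ring n\<^esub> (det (generic_mat n) - 1)"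

definition sl_coord_ring :: "nat \<Rightarrow> 'a::field sl_reg ring" where
  "sl_coord_ring n = mat_poly_ring n Quot sl_ideal n"

definition sl_field :: "nat \<Rightarrow> 'a::field sl_rat ring" where
  "sl_field n = fraction_field (sl_coord_ring n)"

definition sl_restrict :: "nat \<Rightarrow> 'a::field coord_poly \<Rightarrow> 'a sl_rat" where
  "sl_restrict n p =
     fraction (sl_coord_ring n) (sl_ideal n +>\<^bsub>mat_poly_ring n\<^esub> p) \<one>\<^bsub>sl_coord_ring n\<^esub>"

definition sl_const :: "nat \<Rightarrow> 'a::field \<Rightarrow> 'a sl_rat" where
  "sl_const n c = sl_restrict n (mconst c)"


section \<open>The group \<open>U\<close> and its action by conjugation\<close>

definition segment_partition :: "nat \<Rightarrow> nat \<Rightarrow> (nat \<Rightarrow> nat set) \<Rightarrow> bool" where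
  "segment_partition n l I \<longleftrightarrow>
     (\<forall>k \<in> {1..l}. \<exists>a b. a \<le> b \<and> I k = {a..b}) \<and>
     (\<Union>k \<in> {1..l}. I k) = {1..n} \<and>
     (\<forall>k \<in> {1..l}. \<forall>m \<in> {1..l}. k < m \<longrightarrow> (\<forall>i \<in> I k. \<forall>j \<in> I m. i < j))"

definition U_group :: "nat \<Rightarrow> nat \<Rightarrow> (nat \<Rightarrow> nat set) \<Rightarrow> 'a::field mat set" where
  "U_group n l I =
     {1\<^sub>m n + A | A. A \<in> carrier_mat n n \<and>
        (\<forall>i \<in> {1..n}. \<forall>j \<in> {1..n}. A $$ (i - 1, j - 1) \<noteq> 0 \<longrightarrow>
           (\<exists>k \<in> {1..l}. \<exists>m \<in> {1..l}. k < m \<and> i \<in> I k \<and> j \<in> I m))}"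

definition conj_generic_mat :: "nat \<Rightarrow> 'a::field mat \<Rightarrow> 'a coord_poly mat" where
  "conj_generic_mat n g =
     map_mat mconst (inv\<^bsub>ring_mat TYPE('a) n ()\<^esub> g) * generic_mat n * map_mat mconst g"

text \<open>
  \<open>(\<rho>(g) f)(x) = f(g\<^sup>-\<^sup>1 x g)\<close>: on polynomials this is the substitution
  \<open>x\<^sub>i\<^sub>j \<mapsto> (g\<^sup>-\<^sup>1 \<bbbX> g)\<^sub>i\<^sub>j\<close>. For \<open>g \<in> GL(n)\<close> it is an automorphism preserving
  \<open>sl_ideal n\<close>, so it descends to the coordinate ring and then extends to fractions; in
  both unions below all members coincide.
\<close>

definition conj_poly :: "nat \<Rightarrow> 'a::field mat \<Rightarrow> 'a coord_poly \<Rightarrow> 'a coord_poly" where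
  "conj_poly n g =
     meval (mat_poly_ring n) mconst (\<lambda>(i, j). conj_generic_mat n g $$ (i - 1, j - 1))"

definition conj_reg :: "nat \<Rightarrow> 'a::field mat \<Rightarrow> 'a sl_reg \<Rightarrow> 'a sl_reg" where
  "conj_reg n g C = (\<Union>p \<in> C. sl_ideal n +>\<^bsub>mat_poly_ring n\<^esub> conj_poly n g p)"

definition conj_rat :: "nat \<Rightarrow> 'a::field mat \<Rightarrow> 'a sl_rat \<Rightarrow> 'a sl_rat" where
  "conj_rat n g f = (\<Union>(a, b) \<in> f. fraction (sl_coord_ring n) (conj_reg n g a) (conj_reg n g b))"

definition U_invariants :: "nat \<Rightarrow> nat \<Rightarrow> (nat \<Rightarrow> nat set) \<Rightarrow> 'a::field sl_rat set" where
  "U_invariants n l I =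
     {f \<in> carrier (sl_field n). \<forall>g \<in> U_group n l I. conj_rat n g f = f}"


section \<open>The index set \<open>\<bbbS>\<close> and the polynomials \<open>\<J>\<^sub>i\<^sub>j\<close>\<close>

definition mirror :: "nat \<Rightarrow> nat \<Rightarrow> nat" where
  "mirror n i = n + 1 - i"

definition index_set :: "nat \<Rightarrow> nat \<Rightarrow> (nat \<Rightarrow> nat set) \<Rightarrow> (nat \<times> nat) set" where
  "index_set n l I =
     {(i, j) \<in> {1..n} \<times> {1..n}. \<exists>k \<in> {1..l}. \<exists>m \<in> {1..l}.
        i \<in> I k \<and> j \<in> mirror n ` I m \<and> k \<ge> m}"

text \<open>The lists contain 1-based row and column numbers.\<close>

definition sub_mat :: "'b mat \<Rightarrow> nat list \<Rightarrow> nat list \<Rightarrow> 'b mat" where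
  "sub_mat A rs cs = mat (length rs) (length cs) (\<lambda>(a, b). A $$ (rs ! a - 1, cs ! b - 1))"

text \<open>
  Recall that \<open>[a..<b + 1]\<close> lists the segment \<open>[a, b]\<close>. The last \<open>k\<close> rows of a matrix
  with \<open>n\<close> rows are those in \<open>[n + 1 - k, n]\<close>. In the first case \<open>i \<le> n + 1 - j = j'\<close>, so
  the rows listed are distinct and in increasing order.
\<close>

definition J_poly :: "nat \<Rightarrow> nat \<Rightarrow> nat \<Rightarrow> 'a::field coord_poly" where
  "J_poly n i j =
     (if i + j \<le> n + 1
      then det (sub_mat (generic_mat n) (i # [mirror n j + 1..<n + 1]) [1..<j + 1])
      else det (sub_mat (generic_mat n) [n + 1 - mirror n i..<n + 1] [1..<j + 1] @\<^sub>r
                sub_mat (adj_mat (generic_mat n)) [n + 1 - (j - mirror n i)..<n + 1] [1..<j + 1]))"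

definition J_rat :: "nat \<Rightarrow> nat \<times> nat \<Rightarrow> 'a::field sl_rat" where
  "J_rat n = (\<lambda>(i, j). sl_restrict n (J_poly n i j))"

end

theory Submission
  imports Defs "Jordan_Normal_Form.Char_Poly"
begin

text \<open>
  Since \<open>K\<close> is infinite, a polynomial lies in the ideal of \<open>SL(n)\<close> iff it vanishes at the
  \<open>K\<close>-points, so everything reduces to identities between matrices over \<open>K\<close>. Let \<open>L\<close> be the
  unipotent upper triangular part of the Levi subgroup. By the Bruhat decomposition a generic
  \<open>X \<in> SL(n)\<close> is conjugate under \<open>U\<close> to some \<open>P Y P\<inverse>\<close> with \<open>P \<in> L\<close> and \<open>Y\<close> vanishing below the
  antidiagonal. On such matrices \<open>\<J>\<^sub>i\<^sub>j\<close> is, for \<open>(i, j) \<in> \<bbbS>\<^sub>0\<close>, the entry \<open>(i, j)\<close> of \<open>P Y\<close> up to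
  sign and an antidiagonal minor, and for \<open>(i, j) \<in> \<bbbS>\<^sub>1\<close> an antidiagonal minor of \<open>Y\<close> times a minor of
  \<open>Y\<inverse>\<close> formed by the last rows and consecutive columns. These equations are triangular in the
  entries of \<open>Y\<inverse>\<close> and \<open>P\<close>: they can be solved for arbitrary nonzero values (algebraic
  independence), and the solution is rational in the values (generation).
\<close>

section \<open>Evaluation of polynomials in commutative rings\<close>

text \<open>\<open>U\<close> is smaller than the group of all unipotent upper triangular matrices,
  and this is where \<open>P\<close> comes from: the matrix \<open>T\<close> that makes
  \<open>X * T\<close> vanish below the antidiagonal factors as \<open>g * P\<close> with
  \<open>g\<close> in \<open>U\<close> and \<open>P\<close> in \<open>L\<close>, and conjugation by
  \<open>g\<close> leaves the inverse of \<open>P\<close> behind on the right. The minors strictly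
  below the antidiagonal are fixed by conjugation with any unipotent upper triangular matrix and so
  do not see \<open>P\<close>; with the antidiagonal ones they determine \<open>Y\<close>, and the
  rest then determine \<open>P\<close>. The complement of the index set has as many elements as
  there are free entries in \<open>U\<close>. So n^2 - 1 - dim U minors remain once
  \<open>(1, n)\<close>, whose minor is the determinant, is dropped. The obstacle is that the
  section representative of a point is obtained by choice, point by point. Rationality is therefore
  a property of functions on points: after multiplication by a power of one fixed polynomial in the
  minors, the values are those of a polynomial in the minors. The equations are solved twice, once
  for arbitrary nonzero targets and once with this bookkeeping.\<close>

definition monom_eval :: "('v \<Rightarrow> 'b) \<Rightarrow> ('v \<Rightarrow>\<^sub>0 nat) \<Rightarrow> 'b::comm_ring_1" where
  "monom_eval f m = (\<Prod>v\<in>Poly_Mapping.keys m. f v ^ Poly_Mapping.lookup m v)"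

text \<open>The type class counterpart of \<open>meval\<close>; \<open>meval_mat_poly_ring\<close>
  and \<open>meval_sl_field\<close> connect the two. In a type class, evaluation is a
  \<open>comm_ring_hom\<close>, to which the library lemmas on determinants apply.\<close>

definition mp_eval :: "('a::zero \<Rightarrow> 'b) \<Rightarrow> ('v \<Rightarrow> 'b) \<Rightarrow> ('v, 'a) mvpoly \<Rightarrow> 'b::comm_ring_1" where
  "mp_eval c f p = (\<Sum>m\<in>Poly_Mapping.keys p. c (Poly_Mapping.lookup p m) * monom_eval f m)"

lemma monom_eval_superset:
  assumes "finite V" "Poly_Mapping.keys m \<subseteq> V"
  shows "monom_eval f m = (\<Prod>v\<in>V. f v ^ Poly_Mapping.lookup m v)"
  unfolding monom_eval_def
  by (rule prod.mono_neutral_left) (use assms in \<open>auto simp: in_keys_iff\<close>)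

lemma monom_eval_add: "monom_eval f (m + m') = monom_eval f m * monom_eval f m'"
proof -
  let ?V = "Poly_Mapping.keys m \<union> Poly_Mapping.keys m'"
  have "monom_eval f (m + m') = (\<Prod>v\<in>?V. f v ^ Poly_Mapping.lookup (m + m') v)"
    by (rule monom_eval_superset) (use keys_add[of m m'] in auto)
  also have "\<dots> = (\<Prod>v\<in>?V. f v ^ Poly_Mapping.lookup m v) * (\<Prod>v\<in>?V. f v ^ Poly_Mapping.lookup m' v)"
    by (simp add: lookup_add power_add prod.distrib)
  also have "\<dots> = monom_eval f m * monom_eval f m'"
    by (simp add: monom_eval_superset[of ?V])
  finally show ?thesis .
qed

lemma mp_eval_superset:
  assumes "c 0 = 0" "finite V" "Poly_Mapping.keys p \<subseteq> V"
  shows "mp_eval c f p = (\<Sum>m\<in>V. c (Poly_Mapping.lookup p m) * monom_eval f m)"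
  unfolding mp_eval_def
  by (rule sum.mono_neutral_left) (use assms in \<open>auto simp: in_keys_iff\<close>)

lemma sum_single_keys: "(\<Sum>m\<in>Poly_Mapping.keys p. Poly_Mapping.single m (Poly_Mapping.lookup p m)) = p"
  by (rule poly_mapping_eqI)
    (auto simp: lookup_sum lookup_single when_def in_keys_iff sum.delta')

context comm_ring_hom
begin

lemma mp_eval_single: "mp_eval hom f (Poly_Mapping.single m a) = hom a * monom_eval f m"
  by (subst mp_eval_superset[of _ "{m}"]) auto

lemma mp_eval_zero: "mp_eval hom f 0 = 0"
  by (simp add: mp_eval_def)

lemma mp_eval_add: "mp_eval hom f (p + q) = mp_eval hom f p + mp_eval hom f q"
proof -
  let ?V = "Poly_Mapping.keys p \<union> Poly_Mapping.keys q"
  have "mp_eval hom f (p + q) = (\<Sum>m\<in>?V. hom (Poly_Mapping.lookup (p + q) m) * monom_eval f m)"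
    by (rule mp_eval_superset) (use keys_add[of p q] in auto)
  then show ?thesis
    by (simp add: lookup_add hom_add algebra_simps sum.distrib mp_eval_superset[of hom ?V])
qed

lemma mp_eval_sum: "mp_eval hom f (sum g A) = (\<Sum>x\<in>A. mp_eval hom f (g x))"
  by (induction A rule: infinite_finite_induct) (simp_all add: mp_eval_zero mp_eval_add)

lemma mp_eval_mult: "mp_eval hom f (p * q) = mp_eval hom f p * mp_eval hom f q"
proof -
  have "p * q = (\<Sum>m\<in>Poly_Mapping.keys p. Poly_Mapping.single m (Poly_Mapping.lookup p m)) *
     (\<Sum>m\<in>Poly_Mapping.keys q. Poly_Mapping.single m (Poly_Mapping.lookup q m))"
    by (simp only: sum_single_keys)
  also have "mp_eval hom f \<dots> = mp_eval hom f p * mp_eval hom f q"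
    unfolding sum_product mult_single mp_eval_sum mp_eval_single
    by (simp add: mp_eval_def sum_product monom_eval_add hom_mult mult_ac)
  finally show ?thesis .
qed

lemma mp_eval_const: "mp_eval hom f (mconst a) = hom a"
  by (simp add: mconst_def mp_eval_single monom_eval_def)

lemma mp_eval_var: "mp_eval hom f (mvar v) = f v"
  by (simp add: mvar_def mp_eval_single monom_eval_def)

lemma mp_eval_one: "mp_eval hom f 1 = 1"
  using mp_eval_const[of f 1] by (simp add: mconst_def)

lemma comm_ring_hom_mp_eval: "comm_ring_hom (mp_eval hom f)"
  by unfold_locales (simp_all add: mp_eval_add mp_eval_mult mp_eval_one mp_eval_zero)

end

lemma comm_ring_hom_id: "comm_ring_hom (\<lambda>a :: 'a::comm_ring_1. a)"
  by unfold_locales auto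

lemma comm_ring_hom_mconst: "comm_ring_hom (mconst :: 'a::comm_ring_1 \<Rightarrow> ('v, 'a) mvpoly)"
  by unfold_locales (simp_all add: mconst_def single_add mult_single)

section \<open>Polynomials in a given set of variables\<close>

lemma mvars_in_const: "mconst c \<in> mvars_in V"
  by (auto simp: mvars_in_def mconst_def split: if_splits)

lemma mvars_in_var: "v \<in> V \<Longrightarrow> mvar v \<in> mvars_in V"
  by (auto simp: mvars_in_def mvar_def)

lemma mvars_in_zero: "0 \<in> mvars_in V"
  by (auto simp: mvars_in_def)

lemma mvars_in_one: "1 \<in> mvars_in V"
  by (auto simp: mvars_in_def)

lemma mvars_in_add: "p \<in> mvars_in V \<Longrightarrow> q \<in> mvars_in V \<Longrightarrow> p + q \<in> mvars_in V"
  using keys_add[of p q] by (fastforce simp: mvars_in_def)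

lemma mvars_in_uminus: "p \<in> mvars_in V \<Longrightarrow> - p \<in> mvars_in (V :: 'v set)"
  for p :: "('v, 'a::ab_group_add) mvpoly"
  by (auto simp: mvars_in_def in_keys_iff)

lemma mvars_in_mult:
  assumes "p \<in> mvars_in V" "q \<in> mvars_in V"
  shows "p * q \<in> mvars_in V"
proof -
  have "Poly_Mapping.keys m \<subseteq> V" if "m \<in> Poly_Mapping.keys (p * q)" for m
  proof -
    from that keys_mult[of p q] obtain a b
      where "a \<in> Poly_Mapping.keys p" "b \<in> Poly_Mapping.keys q" "m = a + b" by blast
    then show ?thesis using assms keys_add[of a b] by (fastforce simp: mvars_in_def)
  qed
  then show ?thesis by (auto simp: mvars_in_def)
qed

lemma mvars_in_power: "p \<in> mvars_in V \<Longrightarrow> p ^ e \<in> mvars_in V"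
  for p :: "('v, 'a::comm_semiring_1) mvpoly"
  by (induction e) (simp_all add: mvars_in_one mvars_in_mult)

lemma mvars_in_sum: "(\<And>x. x \<in> A \<Longrightarrow> g x \<in> mvars_in V) \<Longrightarrow> sum g A \<in> mvars_in V"
  by (induction A rule: infinite_finite_induct) (simp_all add: mvars_in_zero mvars_in_add)

lemma mvars_in_prod: "(\<And>x. x \<in> A \<Longrightarrow> g x \<in> mvars_in V) \<Longrightarrow> prod g A \<in> mvars_in V"
  for g :: "'i \<Rightarrow> ('v, 'a::comm_semiring_1) mvpoly"
  by (induction A rule: infinite_finite_induct) (simp_all add: mvars_in_one mvars_in_mult)

text \<open>Every polynomial is a sum of constants times products of variables, so later facts about
  evaluation, substitution and rationality reduce to these four cases. Membership of the parts in
  \<open>mvars_in V\<close> is supplied in the last two cases because many of those facts are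
  conditional on it.\<close>

lemma mvpoly_induct [consumes 1, case_names const var add mult]:
  fixes p :: "('v, 'a::comm_ring_1) mvpoly"
  assumes p: "p \<in> mvars_in V"
    and const: "\<And>c. P (mconst c)"
    and var: "\<And>v. v \<in> V \<Longrightarrow> P (mvar v)"
    and add: "\<And>p q. p \<in> mvars_in V \<Longrightarrow> q \<in> mvars_in V \<Longrightarrow> P p \<Longrightarrow> P q \<Longrightarrow> P (p + q)"
    and mult: "\<And>p q. p \<in> mvars_in V \<Longrightarrow> q \<in> mvars_in V \<Longrightarrow> P p \<Longrightarrow> P q \<Longrightarrow> P (p * q)"
  shows "P p"
proof -
  have P0: "P 0" and P1: "P 1" using const[of 0] const[of 1] by (simp_all add: mconst_def)
  interpret mc: comm_ring_hom "mconst :: 'a \<Rightarrow> ('v, 'a) mvpoly" by (rule comm_ring_hom_mconst)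
  have power: "P (mvar v ^ e)" if "v \<in> V" for v e
    by (induction e) (simp_all add: P1 var that mult mvars_in_var mvars_in_power)
  have mono: "P (monom_eval mvar m)" if "Poly_Mapping.keys m \<subseteq> V" for m
  proof -
    have "P (\<Prod>v\<in>A. mvar v ^ Poly_Mapping.lookup m v)" if "finite A" "A \<subseteq> V" for A
      using that
      by (induction rule: finite_induct)
        (simp_all add: P1 power mult mvars_in_var mvars_in_power mvars_in_prod subset_eq)
    then show ?thesis using that by (simp add: monom_eval_def)
  qed
  have monov: "monom_eval mvar m \<in> (mvars_in V :: ('v, 'a) mvpoly set)" if "Poly_Mapping.keys m \<subseteq> V" for m
    unfolding monom_eval_def using that
    by (intro mvars_in_prod mvars_in_power mvars_in_var) auto
  \<comment> \<open>Evaluating a monomial at the variables themselves gives it back as a polynomial,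
    which turns the sum below into \<open>p\<close>.\<close>
  have mono_single: "monom_eval mvar m = Poly_Mapping.single m (1::'a)" for m :: "'v \<Rightarrow>\<^sub>0 nat"
  proof -
    have pw: "mvar v ^ e = Poly_Mapping.single (Poly_Mapping.single v e) (1::'a)" for v :: 'v and e
      by (induction e) (simp_all add: mvar_def mult_single flip: single_add)
    have "(\<Prod>v\<in>A. mvar v ^ g v) = Poly_Mapping.single (\<Sum>v\<in>A. Poly_Mapping.single v (g v)) (1::'a)"
      if "finite A" for A :: "'v set" and g
      using that by (induction rule: finite_induct) (simp_all add: pw mult_single)
    then show ?thesis by (simp add: monom_eval_def sum_single_keys)
  qed
  have "P (\<Sum>m\<in>A. mconst (Poly_Mapping.lookup p m) * monom_eval mvar m)"
    if "finite A" "A \<subseteq> Poly_Mapping.keys p" for A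
    using that
  proof (induction rule: finite_induct)
    case (insert m A)
    have "Poly_Mapping.keys k \<subseteq> V" if "k \<in> insert m A" for k
      using insert.prems p that by (auto simp: mvars_in_def)
    with insert show ?case
      by (auto intro!: add mult mono const mvars_in_mult mvars_in_sum monov mvars_in_const)
  qed (simp add: P0)
  from this[of "Poly_Mapping.keys p"] show ?thesis
    by (simp add: mono_single mconst_def mult_single sum_single_keys)
qed

lemma mp_eval_in_mvars:
  assumes "p \<in> mvars_in V" "\<And>v. v \<in> V \<Longrightarrow> f v \<in> mvars_in W"
  shows "mp_eval mconst f p \<in> (mvars_in W :: ('w, 'a::comm_ring_1) mvpoly set)"
proof -
  interpret comm_ring_hom "mconst :: 'a \<Rightarrow> ('w, 'a) mvpoly" by (rule comm_ring_hom_mconst)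
  show ?thesis using assms(1)
    by (induction rule: mvpoly_induct)
      (simp_all add: mp_eval_const mp_eval_var mp_eval_add mp_eval_mult assms(2)
        mvars_in_const mvars_in_add mvars_in_mult)
qed

lemma mp_eval_cong:
  assumes "p \<in> mvars_in V" "\<And>v. v \<in> V \<Longrightarrow> f v = g v"
  shows "mp_eval c f p = mp_eval c g p"
proof -
  have "f v = g v" if "m \<in> Poly_Mapping.keys p" "v \<in> Poly_Mapping.keys m" for m v
    using assms that by (auto simp: mvars_in_def)
  then show ?thesis by (simp add: mp_eval_def monom_eval_def)
qed

lemma hom_mp_eval:
  assumes "comm_ring_hom h"
  shows "h (mp_eval c f p) = mp_eval (h \<circ> c) (h \<circ> f) p"
proof -
  interpret comm_ring_hom h by fact
  show ?thesis
    by (simp add: mp_eval_def monom_eval_def hom_sum hom_mult hom_prod hom_power)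
qed

section \<open>Values of polynomials at points\<close>

abbreviation mp_at :: "('v \<Rightarrow> 'a) \<Rightarrow> ('v, 'a) mvpoly \<Rightarrow> 'a::comm_ring_1" where
  "mp_at \<equiv> mp_eval (\<lambda>a. a)"

global_interpretation mp_at: comm_ring_hom "mp_at x" for x
  by (rule comm_ring_hom.comm_ring_hom_mp_eval) (rule comm_ring_hom_id)

lemmas mp_at_simps = comm_ring_hom.mp_eval_const[OF comm_ring_hom_id]
  comm_ring_hom.mp_eval_var[OF comm_ring_hom_id]
  mp_at.hom_add mp_at.hom_mult mp_at.hom_one mp_at.hom_zero mp_at.hom_minus mp_at.hom_uminus
  mp_at.hom_sum mp_at.hom_prod mp_at.hom_power

lemma mp_at_mp_eval: "mp_at x (mp_eval mconst f p) = mp_at (\<lambda>v. mp_at x (f v)) p"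
proof -
  have id: "mp_at x \<circ> mconst = (\<lambda>a. a)"
    by (rule ext) (simp add: mp_at_simps)
  have "mp_at x (mp_eval mconst f p) = mp_eval (mp_at x \<circ> mconst) (mp_at x \<circ> f) p"
    by (rule hom_mp_eval) unfold_locales
  then show ?thesis unfolding id unfolding o_def .
qed

text \<open>Read \<open>p\<close> as a polynomial \<open>P\<close> in the single variable
  \<open>v\<close> with coefficients in the other variables. At a fixed point \<open>x\<close> of
  these, \<open>P\<close> becomes a univariate polynomial that is zero at every element of an
  infinite field, so all its coefficients vanish at \<open>x\<close>; as \<open>x\<close> is
  arbitrary, \<open>IH\<close> applies to each coefficient.\<close>

lemma mvpoly_nonzero_point_insert:
  fixes p :: "('v, 'a::{field_char_0}) mvpoly"
  assumes IH: "\<And>q. q \<in> mvars_in V \<Longrightarrow> (\<And>x. mp_at x q = 0) \<Longrightarrow> q = (0 :: ('v, 'a) mvpoly)"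
    and p: "p \<in> mvars_in (insert v V)" and z: "\<And>x. mp_at x p = 0" and v: "v \<notin> V"
  shows "p = 0"
proof -
  define c :: "'a \<Rightarrow> ('v, 'a) mvpoly poly" where "c a = [:mconst a:]" for a
  define f :: "'v \<Rightarrow> ('v, 'a) mvpoly poly" where "f u = (if u = v then [:0, 1:] else [:mvar u:])" for u
  define P where "P = mp_eval c f p"
  interpret mc: comm_ring_hom "mconst :: 'a \<Rightarrow> ('v, 'a) mvpoly" by (rule comm_ring_hom_mconst)
  interpret c: comm_ring_hom c
    by unfold_locales (simp_all add: c_def mc.hom_add mc.hom_mult one_pCons)
  note c_simps = c.mp_eval_const c.mp_eval_var c.mp_eval_add c.mp_eval_mult
  have "poly (mp_eval c f p) (mvar v) = p"
    using p
  proof (induction rule: mvpoly_induct)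
    case (const a) show ?case by (simp add: c_simps) (simp add: c_def)
  next
    case (var u) show ?case by (simp add: c_simps) (simp add: f_def)
  qed (simp_all add: c_simps)
  then have Pp: "poly P (mvar v) = p" by (simp add: P_def)
  have cf: "coeff (mp_eval c f p) k \<in> mvars_in V" for k
    using p
  proof (induction arbitrary: k rule: mvpoly_induct)
    case (const a) then show ?case
      unfolding c_simps by (cases k) (auto simp: c_def mvars_in_const mvars_in_zero)
  next
    case (var u) then show ?case
      unfolding c_simps
      by (auto simp: f_def mvars_in_var mvars_in_zero mvars_in_one coeff_pCons split: nat.splits)
  next
    case (add p q) then show ?case by (simp add: c_simps mvars_in_add)
  next
    case (mult p q) then show ?case
      by (simp add: c_simps coeff_mult mvars_in_sum mvars_in_mult)
  qed
  have ev: "poly (map_poly (mp_at x) (mp_eval c f p)) t = mp_at (x(v := t)) p" for x t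
  proof -
    interpret h: map_poly_comm_ring_hom "mp_at x" by unfold_locales
    show ?thesis using p
    proof (induction rule: mvpoly_induct)
      case (const a) show ?case unfolding c_simps by (simp add: c_def mp_at_simps(1) mp_at.map_poly_pCons_hom)
    next
      case (var u) show ?case
        unfolding c_simps by (simp add: f_def mp_at_simps(2) mp_at.map_poly_pCons_hom)
    qed (simp_all add: c_simps h.hom_add h.hom_mult mp_at_simps)
  qed
  have "coeff P k = 0" for k
  proof (rule IH)
    show "coeff P k \<in> mvars_in V" using cf by (simp add: P_def)
    show "mp_at x (coeff P k) = 0" for x
    proof -
      have "poly (map_poly (mp_at x) P) t = 0" for t
        using ev z by (simp add: P_def)
      then have "map_poly (mp_at x) P = 0" by (metis poly_all_0_iff_0)
      then have "coeff (map_poly (mp_at x) P) k = 0" by simp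
      then show ?thesis by (simp add: coeff_map_poly)
    qed
  qed
  then have "P = 0" by (simp add: poly_eqI)
  then show ?thesis using Pp by simp
qed

text \<open>Only finitely many variables occur in a polynomial, so induction on a finite set
  containing them works; without variables a polynomial is its constant term, which any point
  computes.\<close>

lemma mvpoly_eq_zeroI:
  fixes p :: "('v, 'a::field_char_0) mvpoly"
  assumes "\<And>x. mp_at x p = 0"
  shows "p = 0"
proof -
  have fin: "finite (\<Union>(Poly_Mapping.keys ` Poly_Mapping.keys p))" by auto
  have "q = 0" if "finite V" "q \<in> mvars_in V" "\<And>x. mp_at x q = 0" for V and q :: "('v, 'a) mvpoly"
    using that
  proof (induction V arbitrary: q rule: finite_induct)
    case empty
    then have "Poly_Mapping.keys q \<subseteq> {0}" by (auto simp: mvars_in_def)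
    then have "q = mconst (Poly_Mapping.lookup q 0)"
      by (intro poly_mapping_eqI) (auto simp: mconst_def lookup_single when_def in_keys_iff)
    moreover from this empty.prems(2)[of undefined] have "Poly_Mapping.lookup q 0 = 0"
      by (metis mp_at_simps(1))
    ultimately show ?case by (simp add: mconst_def)
  next
    case (insert v V)
    show ?case
      by (rule mvpoly_nonzero_point_insert[of V q v]) (use insert in auto)
  qed
  from this[OF fin _ assms] show ?thesis by (auto simp: mvars_in_def)
qed

text \<open>Restricting to the line through two points reduces this to univariate polynomials.\<close>

lemma mp_at_common_nonzero:
  fixes p q :: "('v, 'a::field_char_0) mvpoly"
  assumes "mp_at x p \<noteq> 0" "mp_at y q \<noteq> 0"
  obtains z where "mp_at z p \<noteq> 0" "mp_at z q \<noteq> 0"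
proof -
  define L where "L = mp_eval (\<lambda>a::'a. [:a:]) (\<lambda>v. [:x v, y v - x v:])"
  have L: "poly (L r) t = mp_at (\<lambda>v. x v + t * (y v - x v)) r" for r t
  proof -
    have "poly (L r) t = mp_eval ((\<lambda>w. poly w t) \<circ> (\<lambda>a::'a. [:a:])) ((\<lambda>w. poly w t) \<circ> (\<lambda>v. [:x v, y v - x v:])) r"
      unfolding L_def by (rule hom_mp_eval) (unfold_locales, auto)
    moreover have "((\<lambda>w. poly w t) \<circ> (\<lambda>a::'a. [:a:])) = (\<lambda>a. a)" by auto
    ultimately show ?thesis by (simp add: comp_def algebra_simps)
  qed
  have "poly (L p) 0 \<noteq> 0" "poly (L q) 1 \<noteq> 0" using assms by (simp_all add: L)
  then have "L p * L q \<noteq> 0" by auto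
  then obtain t where "poly (L p * L q) t \<noteq> 0" by (metis poly_all_0_iff_0)
  then show ?thesis by (intro that[of "\<lambda>v. x v + t * (y v - x v)"]) (auto simp: L)
qed

text \<open>The product of the variables is nonzero at the point with all coordinates 1, so a
  nonzero \<open>p\<close> would also be nonzero at some point of the torus. This form is needed
  because \<open>J_surjective\<close> prescribes nonzero values.\<close>

lemma mvpoly_eq_zeroI_torus:
  fixes p :: "('v, 'a::field_char_0) mvpoly"
  assumes p: "p \<in> mvars_in V" and V: "finite V"
    and z: "\<And>x. (\<And>v. v \<in> V \<Longrightarrow> x v \<noteq> 0) \<Longrightarrow> mp_at x p = 0"
  shows "p = 0"
proof (rule ccontr)
  assume "p \<noteq> 0"
  then obtain x where x: "mp_at x p \<noteq> 0" using mvpoly_eq_zeroI by blast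
  have "mp_at (\<lambda>_. 1) (\<Prod>v\<in>V. mvar v :: ('v, 'a) mvpoly) \<noteq> 0" by (simp add: mp_at_simps)
  then obtain w where w: "mp_at w p \<noteq> 0" "mp_at w (\<Prod>v\<in>V. mvar v :: ('v, 'a) mvpoly) \<noteq> 0"
    using mp_at_common_nonzero[OF x] by blast
  then have "w v \<noteq> 0" if "v \<in> V" for v using V that by (auto simp: mp_at_simps)
  with z w show False by blast
qed

section \<open>The field of fractions of a domain\<close>

context domain
begin

lemma fraction_eq_iff:
  assumes "a \<in> carrier R" "b \<in> carrier R - {\<zero>}" "c \<in> carrier R" "d \<in> carrier R - {\<zero>}"
  shows "fraction R a b = fraction R c d \<longleftrightarrow> a \<otimes> d = c \<otimes> b"
proof
  assume "fraction R a b = fraction R c d"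
  moreover have "(a, b) \<in> fraction R a b" using assms by (simp add: fraction_def)
  ultimately have "c \<otimes> b = a \<otimes> d" by (auto simp: fraction_def)
  then show "a \<otimes> d = c \<otimes> b" by simp
next
  \<comment> \<open>Transitivity of cross multiplication: both products are multiplied by
    \<open>b\<close>, which can be cancelled in a domain. The two pairs can be exchanged, so this
    gives both inclusions.\<close>
  have sub: "fraction R a b \<subseteq> fraction R c d"
    if "a \<otimes> d = c \<otimes> b" "a \<in> carrier R" "b \<in> carrier R - {\<zero>}" "c \<in> carrier R" "d \<in> carrier R - {\<zero>}"
    for a b c d
  proof (clarsimp simp: fraction_def)
    fix x y assume xy: "x \<in> carrier R" "y \<in> carrier R" "y \<noteq> \<zero>" "a \<otimes> y = x \<otimes> b"
    have c: "a \<in> carrier R" "b \<in> carrier R" "c \<in> carrier R" "d \<in> carrier R" using that by auto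
    have "b \<otimes> (c \<otimes> y) = (c \<otimes> b) \<otimes> y" using c xy(1,2) by algebra
    also have "\<dots> = (a \<otimes> y) \<otimes> d" unfolding that(1)[symmetric] using c xy(1,2) by algebra
    also have "\<dots> = b \<otimes> (x \<otimes> d)" unfolding xy(4) using c xy(1,2) by algebra
    finally show "c \<otimes> y = x \<otimes> d" using that xy by (subst (asm) m_lcancel) auto
  qed
  assume "a \<otimes> d = c \<otimes> b"
  then show "fraction R a b = fraction R c d"
    by (intro equalityI sub) (use assms in auto)
qed

lemma fraction_rep:
  assumes "a \<in> carrier R" "b \<in> carrier R - {\<zero>}"
  shows "(a, b) \<in> fraction R a b"
  using assms by (simp add: fraction_def)

text \<open>The operations of \<open>fraction_field\<close> and the action on fractions are unions
  over representatives. If all members agree, the nonempty union is any one of them, which reduces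
  well-definedness to cross multiplication.\<close>

lemma UN_fraction:
  assumes "a \<in> carrier R" "b \<in> carrier R - {\<zero>}"
    and "\<And>x y. x \<in> carrier R \<Longrightarrow> y \<in> carrier R - {\<zero>} \<Longrightarrow> a \<otimes> y = x \<otimes> b \<Longrightarrow> G x y = C"
  shows "(\<Union>(x, y)\<in>fraction R a b. G x y) = C"
proof (rule SUP_eq_const)
  show "fraction R a b \<noteq> {}" using fraction_rep[OF assms(1,2)] by blast
  show "(case z of (x, y) \<Rightarrow> G x y) = C" if "z \<in> fraction R a b" for z
  proof (cases z)
    case (Pair x y)
    with that have "G x y = C" by (intro assms(3)) (auto simp: fraction_def)
    with Pair show ?thesis by simp
  qed
qed

lemma fraction_field_mult:
  assumes "a \<in> carrier R" "b \<in> carrier R - {\<zero>}" "c \<in> carrier R" "d \<in> carrier R - {\<zero>}"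
  shows "fraction R a b \<otimes>\<^bsub>fraction_field R\<^esub> fraction R c d = fraction R (a \<otimes> c) (b \<otimes> d)"
  unfolding fraction_field_def monoid.simps
proof (intro UN_fraction assms)
  fix x y u w
  assume xy: "x \<in> carrier R" "y \<in> carrier R - {\<zero>}" "u \<in> carrier R" "w \<in> carrier R - {\<zero>}"
    and e: "a \<otimes> y = x \<otimes> b" "c \<otimes> w = u \<otimes> d"
  have cr: "a \<in> carrier R" "b \<in> carrier R" "c \<in> carrier R" "d \<in> carrier R"
    "x \<in> carrier R" "y \<in> carrier R" "u \<in> carrier R" "w \<in> carrier R"
    using assms xy by auto
  have "(x \<otimes> u) \<otimes> (b \<otimes> d) = (x \<otimes> b) \<otimes> (u \<otimes> d)" using cr by algebra
  also have "\<dots> = (a \<otimes> c) \<otimes> (y \<otimes> w)" unfolding e[symmetric] using cr by algebra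
  finally show "fraction R (x \<otimes> u) (y \<otimes> w) = fraction R (a \<otimes> c) (b \<otimes> d)"
    by (subst fraction_eq_iff) (use assms xy in \<open>auto simp: integral_iff\<close>)
qed

lemma fraction_field_add:
  assumes "a \<in> carrier R" "b \<in> carrier R - {\<zero>}" "c \<in> carrier R" "d \<in> carrier R - {\<zero>}"
  shows "fraction R a b \<oplus>\<^bsub>fraction_field R\<^esub> fraction R c d = fraction R (a \<otimes> d \<oplus> c \<otimes> b) (b \<otimes> d)"
  unfolding fraction_field_def ring.simps
proof (intro UN_fraction assms)
  fix x y u w
  assume xy: "x \<in> carrier R" "y \<in> carrier R - {\<zero>}" "u \<in> carrier R" "w \<in> carrier R - {\<zero>}"
    and e: "a \<otimes> y = x \<otimes> b" "c \<otimes> w = u \<otimes> d"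
  have cr: "a \<in> carrier R" "b \<in> carrier R" "c \<in> carrier R" "d \<in> carrier R"
    "x \<in> carrier R" "y \<in> carrier R" "u \<in> carrier R" "w \<in> carrier R"
    using assms xy by auto
  have "(x \<otimes> w \<oplus> u \<otimes> y) \<otimes> (b \<otimes> d) = (x \<otimes> b) \<otimes> w \<otimes> d \<oplus> (u \<otimes> d) \<otimes> y \<otimes> b" using cr by algebra
  also have "\<dots> = (a \<otimes> d \<oplus> c \<otimes> b) \<otimes> (y \<otimes> w)" unfolding e[symmetric] using cr by algebra
  finally show "fraction R (x \<otimes> w \<oplus> u \<otimes> y) (y \<otimes> w) = fraction R (a \<otimes> d \<oplus> c \<otimes> b) (b \<otimes> d)"
    by (subst fraction_eq_iff) (use assms xy in \<open>auto simp: integral_iff\<close>)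
qed

lemma fraction_in_carrier:
  "a \<in> carrier R \<Longrightarrow> b \<in> carrier R - {\<zero>} \<Longrightarrow> fraction R a b \<in> carrier (fraction_field R)"
  by (auto simp: fraction_field_def)

lemma fraction_cases:
  assumes "x \<in> carrier (fraction_field R)"
  obtains a b where "a \<in> carrier R" "b \<in> carrier R - {\<zero>}" "x = fraction R a b"
  using assms by (auto simp: fraction_field_def)

lemma fraction_field_one: "\<one>\<^bsub>fraction_field R\<^esub> = fraction R \<one> \<one>"
  and fraction_field_zero: "\<zero>\<^bsub>fraction_field R\<^esub> = fraction R \<zero> \<one>"
  by (simp_all add: fraction_field_def)

lemma field_fraction_field: "field (fraction_field R)"
proof -
  let ?F = "fraction_field R"
  note [simp] = fraction_field_mult fraction_field_add fraction_in_carrier fraction_field_one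
    fraction_field_zero
  have nz: "b \<otimes> d \<in> carrier R - {\<zero>}" if "b \<in> carrier R - {\<zero>}" "d \<in> carrier R - {\<zero>}" for b d
    using that by (auto simp: integral_iff)
  have nz1: "\<one> \<in> carrier R - {\<zero>}" by auto
  have cr: "cring ?F"
  proof (rule cringI)
    show "abelian_group ?F"
    proof (rule abelian_groupI)
      fix x y assume "x \<in> carrier ?F" "y \<in> carrier ?F"
      then show "x \<oplus>\<^bsub>?F\<^esub> y \<in> carrier ?F"
        by (elim fraction_cases) (auto simp: integral_iff)
      show "x \<oplus>\<^bsub>?F\<^esub> y = y \<oplus>\<^bsub>?F\<^esub> x"
        using \<open>x \<in> _\<close> \<open>y \<in> _\<close> by (elim fraction_cases) (simp add: m_ac a_ac)
    next
      fix x y z assume "x \<in> carrier ?F" "y \<in> carrier ?F" "z \<in> carrier ?F"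
      then show "x \<oplus>\<^bsub>?F\<^esub> y \<oplus>\<^bsub>?F\<^esub> z = x \<oplus>\<^bsub>?F\<^esub> (y \<oplus>\<^bsub>?F\<^esub> z)"
      proof (elim fraction_cases)
        fix a b c d e f
        assume *: "a \<in> carrier R" "b \<in> carrier R - {\<zero>}" "c \<in> carrier R" "d \<in> carrier R - {\<zero>}"
          "e \<in> carrier R" "f \<in> carrier R - {\<zero>}" "x = fraction R a b" "y = fraction R c d"
          "z = fraction R e f"
        have c: "a \<in> carrier R" "b \<in> carrier R" "c \<in> carrier R" "d \<in> carrier R"
          "e \<in> carrier R" "f \<in> carrier R" using * by auto
        have "x \<oplus>\<^bsub>?F\<^esub> y \<oplus>\<^bsub>?F\<^esub> z = fraction R ((a \<otimes> d \<oplus> c \<otimes> b) \<otimes> f \<oplus> e \<otimes> (b \<otimes> d)) (b \<otimes> d \<otimes> f)"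
          using * by (simp add: integral_iff)
        moreover have "x \<oplus>\<^bsub>?F\<^esub> (y \<oplus>\<^bsub>?F\<^esub> z) = fraction R (a \<otimes> (d \<otimes> f) \<oplus> (c \<otimes> f \<oplus> e \<otimes> d) \<otimes> b) (b \<otimes> (d \<otimes> f))"
          using * by (simp add: integral_iff)
        moreover have "(a \<otimes> d \<oplus> c \<otimes> b) \<otimes> f \<oplus> e \<otimes> (b \<otimes> d) = a \<otimes> (d \<otimes> f) \<oplus> (c \<otimes> f \<oplus> e \<otimes> d) \<otimes> b"
          using c by algebra
        moreover have "b \<otimes> d \<otimes> f = b \<otimes> (d \<otimes> f)" using c by algebra
        ultimately show ?thesis by simp
      qed
    next
      fix x assume x: "x \<in> carrier ?F"
      then show "\<zero>\<^bsub>?F\<^esub> \<oplus>\<^bsub>?F\<^esub> x = x"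
        by (elim fraction_cases) (use nz1 in auto)
      from x obtain a b where ab: "a \<in> carrier R" "b \<in> carrier R - {\<zero>}" "x = fraction R a b"
        by (rule fraction_cases)
      then have "fraction R (\<ominus> a) b \<oplus>\<^bsub>?F\<^esub> x = fraction R \<zero> (b \<otimes> b)"
        by (simp add: l_minus l_neg)
      also have "\<dots> = \<zero>\<^bsub>?F\<^esub>"
        using ab by (simp add: fraction_eq_iff integral_iff)
      finally show "\<exists>y\<in>carrier ?F. y \<oplus>\<^bsub>?F\<^esub> x = \<zero>\<^bsub>?F\<^esub>"
        using ab by (intro bexI[of _ "fraction R (\<ominus> a) b"]) auto
    qed (use nz1 in auto)
    show "Group.comm_monoid ?F"
    proof (rule comm_monoidI)
      fix x y assume "x \<in> carrier ?F" "y \<in> carrier ?F"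
      then show "x \<otimes>\<^bsub>?F\<^esub> y \<in> carrier ?F"
        by (elim fraction_cases) (auto simp: integral_iff)
      show "x \<otimes>\<^bsub>?F\<^esub> y = y \<otimes>\<^bsub>?F\<^esub> x"
        using \<open>x \<in> _\<close> \<open>y \<in> _\<close> by (elim fraction_cases) (simp add: m_ac)
    next
      fix x y z assume "x \<in> carrier ?F" "y \<in> carrier ?F" "z \<in> carrier ?F"
      then show "x \<otimes>\<^bsub>?F\<^esub> y \<otimes>\<^bsub>?F\<^esub> z = x \<otimes>\<^bsub>?F\<^esub> (y \<otimes>\<^bsub>?F\<^esub> z)"
      proof (elim fraction_cases)
        fix a b c d e f
        assume *: "a \<in> carrier R" "b \<in> carrier R - {\<zero>}" "c \<in> carrier R" "d \<in> carrier R - {\<zero>}"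
          "e \<in> carrier R" "f \<in> carrier R - {\<zero>}" "x = fraction R a b" "y = fraction R c d"
          "z = fraction R e f"
        have c: "a \<in> carrier R" "b \<in> carrier R" "c \<in> carrier R" "d \<in> carrier R"
          "e \<in> carrier R" "f \<in> carrier R" using * by auto
        show ?thesis
          using c * by (simp add: integral_iff m_assoc)
      qed
    next
      fix x assume "x \<in> carrier ?F"
      then show "\<one>\<^bsub>?F\<^esub> \<otimes>\<^bsub>?F\<^esub> x = x"
        by (elim fraction_cases) (use nz1 in auto)
    qed (use nz1 in auto)
    fix x y z assume "x \<in> carrier ?F" "y \<in> carrier ?F" "z \<in> carrier ?F"
    then show "(x \<oplus>\<^bsub>?F\<^esub> y) \<otimes>\<^bsub>?F\<^esub> z = x \<otimes>\<^bsub>?F\<^esub> z \<oplus>\<^bsub>?F\<^esub> y \<otimes>\<^bsub>?F\<^esub> z"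
    proof (elim fraction_cases)
      fix a b c d e f
      assume *: "a \<in> carrier R" "b \<in> carrier R - {\<zero>}" "c \<in> carrier R" "d \<in> carrier R - {\<zero>}"
        "e \<in> carrier R" "f \<in> carrier R - {\<zero>}" "x = fraction R a b" "y = fraction R c d"
        "z = fraction R e f"
      have c: "a \<in> carrier R" "b \<in> carrier R" "c \<in> carrier R" "d \<in> carrier R"
        "e \<in> carrier R" "f \<in> carrier R" using * by auto
      have "(x \<oplus>\<^bsub>?F\<^esub> y) \<otimes>\<^bsub>?F\<^esub> z = fraction R ((a \<otimes> d \<oplus> c \<otimes> b) \<otimes> e) (b \<otimes> d \<otimes> f)"
        using * by (simp add: integral_iff)
      moreover have "x \<otimes>\<^bsub>?F\<^esub> z \<oplus>\<^bsub>?F\<^esub> y \<otimes>\<^bsub>?F\<^esub> z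
          = fraction R (a \<otimes> e \<otimes> (d \<otimes> f) \<oplus> c \<otimes> e \<otimes> (b \<otimes> f)) (b \<otimes> f \<otimes> (d \<otimes> f))"
        using * by (simp add: integral_iff)
      moreover have "fraction R ((a \<otimes> d \<oplus> c \<otimes> b) \<otimes> e) (b \<otimes> d \<otimes> f) =
          fraction R (a \<otimes> e \<otimes> (d \<otimes> f) \<oplus> c \<otimes> e \<otimes> (b \<otimes> f)) (b \<otimes> f \<otimes> (d \<otimes> f))"
      proof (subst fraction_eq_iff)
        show "(a \<otimes> d \<oplus> c \<otimes> b) \<otimes> e \<otimes> (b \<otimes> f \<otimes> (d \<otimes> f)) =
            (a \<otimes> e \<otimes> (d \<otimes> f) \<oplus> c \<otimes> e \<otimes> (b \<otimes> f)) \<otimes> (b \<otimes> d \<otimes> f)"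
          using c by algebra
      qed (use * in \<open>auto simp: integral_iff\<close>)
      ultimately show ?thesis by simp
    qed
  qed
  interpret F: cring ?F by fact
  show ?thesis
  proof (rule F.cring_fieldI2)
    show "\<zero>\<^bsub>?F\<^esub> \<noteq> \<one>\<^bsub>?F\<^esub>"
      using nz1 by (simp add: fraction_eq_iff)
    fix x assume x: "x \<in> carrier ?F" and n: "x \<noteq> \<zero>\<^bsub>?F\<^esub>"
    from x obtain a b where ab: "a \<in> carrier R" "b \<in> carrier R - {\<zero>}" "x = fraction R a b"
      by (rule fraction_cases)
    have a: "a \<noteq> \<zero>"
    proof
      assume "a = \<zero>"
      then have "x = fraction R \<zero> \<one>" using ab nz1 by (subst ab(3), subst fraction_eq_iff) auto
      then show False using n by simp
    qed
    with ab have "x \<otimes>\<^bsub>?F\<^esub> fraction R b a = \<one>\<^bsub>?F\<^esub>"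
      by (simp add: fraction_eq_iff integral_iff m_comm)
    then show "\<exists>y\<in>carrier ?F. x \<otimes>\<^bsub>?F\<^esub> y = \<one>\<^bsub>?F\<^esub>"
      using a ab by (intro bexI[of _ "fraction R b a"]) auto
  qed
qed

lemma fraction_field_inv:
  assumes "a \<in> carrier R - {\<zero>}" "b \<in> carrier R - {\<zero>}"
  shows "inv\<^bsub>fraction_field R\<^esub> fraction R a b = fraction R b a"
proof -
  interpret F: field "fraction_field R" by (rule field_fraction_field)
  have "a \<otimes> b \<in> carrier R - {\<zero>}" using assms by (auto simp: integral_iff)
  then have "fraction R a b \<otimes>\<^bsub>fraction_field R\<^esub> fraction R b a = \<one>\<^bsub>fraction_field R\<^esub>"
    using assms by (simp add: fraction_field_mult fraction_field_one fraction_eq_iff m_comm)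
  then show ?thesis
    using assms by (intro F.comm_inv_char[symmetric, THEN sym] fraction_in_carrier) auto
qed

lemma fraction_field_a_inv:
  assumes "a \<in> carrier R" "b \<in> carrier R - {\<zero>}"
  shows "\<ominus>\<^bsub>fraction_field R\<^esub> fraction R a b = fraction R (\<ominus> a) b"
proof -
  interpret F: field "fraction_field R" by (rule field_fraction_field)
  have "b \<otimes> b \<in> carrier R - {\<zero>}" using assms by (auto simp: integral_iff)
  then have "fraction R (\<ominus> a) b \<oplus>\<^bsub>fraction_field R\<^esub> fraction R a b = \<zero>\<^bsub>fraction_field R\<^esub>"
    using assms by (simp add: fraction_field_add fraction_field_zero fraction_eq_iff l_minus l_neg)
  then show ?thesis
    using assms by (intro F.minus_equality fraction_in_carrier) auto
qed

end

section \<open>Regular and rational functions on \<open>SL(n)\<close> through their values\<close>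

abbreviation MP :: "nat \<Rightarrow> 'a::field coord_poly set" where
  "MP n \<equiv> mvars_in ({1..n} \<times> {1..n})"

definition SL_mat :: "nat \<Rightarrow> 'a::field mat set" where
  "SL_mat n = {X \<in> carrier_mat n n. det X = 1}"

definition mat_eval :: "'a::field mat \<Rightarrow> 'a coord_poly \<Rightarrow> 'a" where
  "mat_eval X = mp_at (\<lambda>(i, j). X $$ (i - 1, j - 1))"

global_interpretation mat_eval: comm_ring_hom "mat_eval X" for X :: "'a::field mat"
  unfolding mat_eval_def by unfold_locales

lemma mat_eval_const [simp]: "mat_eval X (mconst c) = c"
  and mat_eval_var: "mat_eval X (mvar (i, j)) = X $$ (i - 1, j - 1)"
  by (simp_all add: mat_eval_def mp_at_simps)

lemmas mat_eval_simps = mat_eval.hom_add mat_eval.hom_mult mat_eval.hom_one mat_eval.hom_zero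
  mat_eval.hom_minus mat_eval.hom_uminus mat_eval.hom_power mat_eval_const mat_eval_var

text \<open>A point assigns values to all pairs of natural numbers, but a polynomial in
  \<open>MP n\<close> only sees the pairs with both entries in [1, n]; these form a matrix with
  indices shifted by one.\<close>

lemma mp_at_eq_mat_eval:
  assumes "p \<in> MP n"
  shows "mp_at z p = mat_eval (mat n n (\<lambda>(a, b). z (a + 1, b + 1))) p"
  unfolding mat_eval_def by (rule mp_eval_cong[OF assms]) auto

lemma map_generic_mat:
  assumes "X \<in> carrier_mat n n"
  shows "map_mat (mat_eval X) (generic_mat n) = X"
  by (rule eq_matI) (use assms in \<open>auto simp: generic_mat_def mat_eval_var\<close>)

lemma generic_mat_carrier [simp]: "generic_mat n \<in> carrier_mat n n"
  by (simp add: generic_mat_def)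

lemma mat_eval_det_generic:
  assumes "X \<in> carrier_mat n n"
  shows "mat_eval X (det (generic_mat n)) = det X"
  by (simp add: map_generic_mat[OF assms] flip: mat_eval.hom_det)

lemma det_in_mvars:
  fixes A :: "('v, 'a::comm_ring_1) mvpoly mat"
  assumes "\<And>i j. i < dim_row A \<Longrightarrow> j < dim_col A \<Longrightarrow> A $$ (i, j) \<in> mvars_in V"
  shows "det A \<in> mvars_in V"
proof (cases "dim_row A = dim_col A")
  case True
  have sgn: "(signof p :: ('v, 'a) mvpoly) \<in> mvars_in V" for p :: "nat \<Rightarrow> nat"
    by (auto simp: sign_def mvars_in_one mvars_in_uminus)
  show ?thesis
    unfolding det_def using True
    by (auto intro!: mvars_in_sum mvars_in_mult mvars_in_prod assms sgn)
next
  case False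
  then show ?thesis by (simp add: det_def mvars_in_zero)
qed

lemma det_generic_in_MP: "det (generic_mat n) \<in> MP n"
  by (rule det_in_mvars) (auto simp: generic_mat_def intro!: mvars_in_var)

section \<open>The coordinate ring of SL(n)\<close>

lemma cring_mat_poly_ring: "cring (mat_poly_ring n :: 'a::field coord_poly ring)"
proof (rule cringI)
  show "abelian_group (mat_poly_ring n :: 'a coord_poly ring)"
    by (rule abelian_groupI)
      (auto simp: mat_poly_ring_def mvars_in_add mvars_in_zero add_ac
        intro: bexI[of _ "- x" for x] mvars_in_uminus)
  show "Group.comm_monoid (mat_poly_ring n :: 'a coord_poly ring)"
    by (rule comm_monoidI) (auto simp: mat_poly_ring_def mvars_in_mult mvars_in_one mult_ac)
qed (auto simp: mat_poly_ring_def algebra_simps)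

lemma mat_poly_ring_simps [simp]:
  "carrier (mat_poly_ring n) = MP n"
  "x \<otimes>\<^bsub>mat_poly_ring n\<^esub> y = x * y"
  "x \<oplus>\<^bsub>mat_poly_ring n\<^esub> y = x + y"
  "\<one>\<^bsub>mat_poly_ring n\<^esub> = 1" "\<zero>\<^bsub>mat_poly_ring n\<^esub> = 0"
  by (simp_all add: mat_poly_ring_def)

lemma mat_poly_ring_a_inv [simp]: "p \<in> MP n \<Longrightarrow> \<ominus>\<^bsub>mat_poly_ring n\<^esub> p = - p"
  for p :: "'a::field coord_poly"
proof -
  interpret cring "mat_poly_ring n :: 'a coord_poly ring" by (rule cring_mat_poly_ring)
  assume "p \<in> MP n"
  then show ?thesis by (intro minus_equality) (auto intro: mvars_in_uminus)
qed

lemma mat_poly_ring_minus [simp]: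
  "p \<in> MP n \<Longrightarrow> q \<in> MP n \<Longrightarrow> p \<ominus>\<^bsub>mat_poly_ring n\<^esub> q = p - q"
  by (simp add: a_minus_def)

lemma mvars_in_diff: "p \<in> mvars_in V \<Longrightarrow> q \<in> mvars_in V \<Longrightarrow> p - q \<in> mvars_in V"
  for p :: "('v, 'a::ab_group_add) mvpoly"
  using mvars_in_add[OF _ mvars_in_uminus, of p V q] by simp

lemma sl_ideal_alt: "sl_ideal n = {r * (det (generic_mat n) - 1) | r. r \<in> MP n}"
  by (simp add: sl_ideal_def cgenideal_def)

lemma ideal_sl_ideal: "ideal (sl_ideal n) (mat_poly_ring n)"
proof -
  interpret cring "mat_poly_ring n" by (rule cring_mat_poly_ring)
  show ?thesis unfolding sl_ideal_def
    by (rule cgenideal_ideal)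
      (simp add: mvars_in_diff det_generic_in_MP mvars_in_one del: One_nat_def)
qed

text \<open>
  Scaling the first row by \<open>1 / det X\<close> retracts \<open>GL(n)\<close> onto \<open>SL(n)\<close>; up to a power of the
  determinant the pullback of a polynomial \<open>p\<close> is a polynomial congruent to \<open>p\<close> modulo
  \<open>det - 1\<close>.
\<close>

lemma sl_homogenize:
  fixes p :: "'a::field coord_poly"
  assumes "p \<in> MP n"
  shows "\<exists>N. \<exists>r\<in>MP n. \<forall>X\<in>carrier_mat n n. det X \<noteq> 0 \<longrightarrow>
    mat_eval X (p + r * (det (generic_mat n) - 1)) = det X ^ N * mat_eval (multrow 0 (1 / det X) X) p"
  (is "\<exists>N. \<exists>r\<in>MP n. ?P p N r")
  using assms
proof (induction rule: mvpoly_induct)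
  case (const c)
  then show ?case
    by (intro exI[of _ 0] bexI[of _ 0]) (auto simp: mat_eval_simps mvars_in_zero)
next
  case (var v)
  obtain i j where v: "v = (i, j)" "i \<in> {1..n}" "j \<in> {1..n}" using var by auto
  show ?case
  \<comment> \<open>Entries of the first row are divided by the determinant, and one factor
    \<open>det X\<close> undoes this; the other entries are left alone.\<close>
  proof (cases "i = 1")
    case True
    then show ?thesis using v
      by (intro exI[of _ 1] bexI[of _ 0])
        (auto simp: mat_eval_simps mvars_in_zero)
  next
    case False
    then show ?thesis using v
      by (intro exI[of _ 0] bexI[of _ 0]) (auto simp: mat_eval_simps mvars_in_zero)
  qed
next
  let ?D = "det (generic_mat n) :: 'a coord_poly"
  note closed = mvars_in_add mvars_in_mult mvars_in_power mvars_in_diff mvars_in_one det_generic_in_MP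
    mvars_in_sum
  \<comment> \<open>The two summands may come with different exponents. Powers of the determinant
    make them equal and change nothing modulo \<open>?D - 1\<close>, by the geometric sum.\<close>
  have pow: "\<exists>s\<in>MP n. ?D ^ N = 1 + s * (?D - 1)" for N
  proof (rule bexI)
    show "?D ^ N = 1 + (\<Sum>i<N. ?D ^ i) * (?D - 1)"
      using power_diff_1_eq[of ?D N] by (simp add: algebra_simps)
  qed (auto intro!: closed simp del: One_nat_def)
  {
    case (add p q)
    then obtain N M r s where p: "r \<in> MP n" "?P p N r" and q: "s \<in> MP n" "?P q M s" by blast
    obtain a b where a: "a \<in> MP n" "?D ^ N = 1 + a * (?D - 1)"
      and b: "b \<in> MP n" "?D ^ M = 1 + b * (?D - 1)" using pow by metis
    let ?P' = "p + r * (?D - 1)" and ?Q' = "q + s * (?D - 1)"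
    let ?t = "b * ?P' + r + a * ?Q' + s"
    have "p + q + ?t * (?D - 1) = ?D ^ M * ?P' + ?D ^ N * ?Q'"
      unfolding a b by (simp add: algebra_simps)
    then have eq: "mat_eval X (p + q + ?t * (?D - 1))
        = mat_eval X (?D ^ M * ?P') + mat_eval X (?D ^ N * ?Q')" for X
      by (simp only: mat_eval.hom_add)
    have "?P (p + q) (N + M) ?t"
    proof (intro ballI impI)
      fix X :: "'a mat" assume X: "X \<in> carrier_mat n n" "det X \<noteq> 0"
      then show "mat_eval X (p + q + ?t * (?D - 1))
          = det X ^ (N + M) * mat_eval (multrow 0 (1 / det X) X) (p + q)"
        using p(2) q(2) unfolding eq
        by (simp only: mat_eval.hom_mult mat_eval.hom_power mat_eval_det_generic)
          (simp add: mat_eval.hom_add power_add algebra_simps)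
    qed
    moreover have "?t \<in> MP n" using add p q a b by (intro closed)
    ultimately show ?case by blast
  next
    case (mult p q)
    then obtain N M r s where p: "r \<in> MP n" "?P p N r" and q: "s \<in> MP n" "?P q M s" by blast
    let ?P' = "p + r * (?D - 1)" and ?Q' = "q + s * (?D - 1)"
    let ?t = "?P' * s + r * q"
    have "p * q + ?t * (?D - 1) = ?P' * ?Q'"
      by (simp add: algebra_simps)
    then have "?P (p * q) (N + M) ?t"
      using p(2) q(2) by (simp add: mat_eval.hom_mult power_add)
    moreover have "?t \<in> MP n" using mult p q by (intro closed)
    ultimately show ?case by blast
  }
qed

lemma multrow_in_SL_mat:
  assumes "X \<in> carrier_mat n n" "det X \<noteq> 0" "n \<ge> 1"
  shows "multrow 0 (1 / det X) X \<in> SL_mat n"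
  using assms det_multrow[of 0 n X "1 / det X"] by (auto simp: SL_mat_def)

lemma one_in_SL_mat: "1\<^sub>m n \<in> SL_mat n"
  by (simp add: SL_mat_def)

lemma mat_eval_sl_ideal:
  assumes "p \<in> sl_ideal n" "X \<in> SL_mat n"
  shows "mat_eval X p = 0"
  using assms by (auto simp: sl_ideal_alt SL_mat_def mat_eval_simps mat_eval_det_generic)

text \<open>A Nullstellensatz over \<open>K\<close> itself. If \<open>p\<close> vanishes on SL(n),
  its homogenization \<open>?Q\<close> vanishes at every invertible matrix; a nonzero
  \<open>?Q\<close> would have a common nonzero point with the determinant, so \<open>?Q\<close> is
  0 and \<open>p\<close> is a multiple of \<open>?D - 1\<close>.\<close>

lemma sl_ideal_iff:
  fixes p :: "'a::field_char_0 coord_poly"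
  assumes p: "p \<in> MP n" and n: "n \<ge> 1"
  shows "p \<in> sl_ideal n \<longleftrightarrow> (\<forall>X\<in>SL_mat n. mat_eval X p = 0)"
proof
  assume z: "\<forall>X\<in>SL_mat n. mat_eval X p = 0"
  let ?D = "det (generic_mat n) :: 'a coord_poly"
  obtain N r where r: "r \<in> MP n" and
    eq: "\<And>X. X \<in> carrier_mat n n \<Longrightarrow> det X \<noteq> 0 \<Longrightarrow>
      mat_eval X (p + r * (?D - 1)) = det X ^ N * mat_eval (multrow 0 (1 / det X) X) p"
    using sl_homogenize[OF p] by blast
  let ?Q = "p + r * (?D - 1)"
  have Q: "?Q \<in> MP n"
    by (intro mvars_in_add mvars_in_mult mvars_in_diff p r det_generic_in_MP mvars_in_one)
  have "?Q = 0"
  proof (rule ccontr)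
    assume "?Q \<noteq> 0"
    then obtain x where x: "mp_at x ?Q \<noteq> 0" using mvpoly_eq_zeroI by blast
    have "mat_eval (1\<^sub>m n) ?D \<noteq> 0" by (simp add: mat_eval_det_generic)
    then obtain w where w: "mp_at w ?Q \<noteq> 0" "mp_at w ?D \<noteq> 0"
      unfolding mat_eval_def using mp_at_common_nonzero[OF x] by blast
    let ?X = "mat n n (\<lambda>(a, b). w (a + 1, b + 1))"
    have "mat_eval ?X ?Q \<noteq> 0" "mat_eval ?X ?D \<noteq> 0"
      using w mp_at_eq_mat_eval[OF Q, of w] mp_at_eq_mat_eval[OF det_generic_in_MP, of w] by simp_all
    then have "det ?X \<noteq> 0" "mat_eval (multrow 0 (1 / det ?X) ?X) p \<noteq> 0"
      using eq[of ?X] by (simp_all add: mat_eval_det_generic)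
    then show False using z multrow_in_SL_mat[of ?X n] n by simp
  qed
  then have "p = (- r) * (?D - 1)" by (simp add: eq_neg_iff_add_eq_0)
  then show "p \<in> sl_ideal n" using mvars_in_uminus[OF r] unfolding sl_ideal_alt by blast
qed (use mat_eval_sl_ideal in blast)

text \<open>The irreducibility of SL(n) in terms of points. Homogenization moves both polynomials to
  the space of all matrices, where they have a common nonzero point, and scaling its first row
  brings this point back to SL(n).\<close>

lemma SL_mat_common_nonzero:
  fixes p q :: "'a::field_char_0 coord_poly"
  assumes p: "p \<in> MP n" and q: "q \<in> MP n" and n: "n \<ge> 1"
    and X: "X \<in> SL_mat n" "mat_eval X p \<noteq> 0" and Y: "Y \<in> SL_mat n" "mat_eval Y q \<noteq> 0"
  obtains Z where "Z \<in> SL_mat n" "mat_eval Z p \<noteq> 0" "mat_eval Z q \<noteq> 0"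
proof -
  let ?D = "det (generic_mat n) :: 'a coord_poly"
  have ex: "\<exists>Q\<in>MP n. mat_eval X Q \<noteq> 0 \<and>
      (\<forall>Z\<in>carrier_mat n n. det Z \<noteq> 0 \<longrightarrow> mat_eval Z Q \<noteq> 0 \<longrightarrow>
        mat_eval (multrow 0 (1 / det Z) Z) p \<noteq> 0)"
    if p: "p \<in> MP n" and X: "X \<in> SL_mat n" "mat_eval X p \<noteq> 0" for p and X :: "'a mat"
  proof -
    obtain N r where r: "r \<in> MP n" and
      eq: "\<And>X. X \<in> carrier_mat n n \<Longrightarrow> det X \<noteq> 0 \<Longrightarrow>
        mat_eval X (p + r * (?D - 1)) = det X ^ N * mat_eval (multrow 0 (1 / det X) X) p"
      using sl_homogenize[OF p] by blast
    let ?Q = "p + r * (?D - 1)"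
    have "?Q \<in> MP n"
      by (intro mvars_in_add mvars_in_mult mvars_in_diff p r det_generic_in_MP mvars_in_one)
    moreover have "mat_eval X ?Q \<noteq> 0"
      using X by (auto simp: SL_mat_def mat_eval_simps mat_eval_det_generic)
    ultimately show ?thesis using eq by (intro bexI[of _ ?Q]) auto
  qed
  obtain P where P: "P \<in> MP n" "mat_eval X P \<noteq> 0"
    "\<And>Z. Z \<in> carrier_mat n n \<Longrightarrow> det Z \<noteq> 0 \<Longrightarrow> mat_eval Z P \<noteq> 0 \<Longrightarrow>
      mat_eval (multrow 0 (1 / det Z) Z) p \<noteq> 0"
    using ex[OF p X] by blast
  obtain Q where Q: "Q \<in> MP n" "mat_eval Y Q \<noteq> 0"
    "\<And>Z. Z \<in> carrier_mat n n \<Longrightarrow> det Z \<noteq> 0 \<Longrightarrow> mat_eval Z Q \<noteq> 0 \<Longrightarrow>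
      mat_eval (multrow 0 (1 / det Z) Z) q \<noteq> 0"
    using ex[OF q Y] by blast
  \<comment> \<open>The factor \<open>?D\<close> makes the common point invertible, so that it can
    be scaled.\<close>
  have "mat_eval Y (Q * ?D) \<noteq> 0"
    using Q Y by (auto simp: mat_eval_simps mat_eval_det_generic SL_mat_def)
  then obtain w where w: "mp_at w P \<noteq> 0" "mp_at w (Q * ?D) \<noteq> 0"
    using P(2) mp_at_common_nonzero unfolding mat_eval_def by blast
  let ?Z = "mat n n (\<lambda>(a, b). w (a + 1, b + 1))"
  have "mat_eval ?Z P \<noteq> 0" "mat_eval ?Z (Q * ?D) \<noteq> 0"
    using w P(1) Q(1)
    by (simp_all add: mp_at_eq_mat_eval[of _ n w] mvars_in_mult det_generic_in_MP del: One_nat_def)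
  then have "mat_eval ?Z P \<noteq> 0" "mat_eval ?Z Q \<noteq> 0" "det ?Z \<noteq> 0"
    by (auto simp: mat_eval_simps mat_eval_det_generic)
  then show ?thesis
    using P(3) Q(3) n by (intro that[of "multrow 0 (1 / det ?Z) ?Z"] multrow_in_SL_mat) auto
qed

lemma primeideal_sl_ideal:
  assumes "n \<ge> 1"
  shows "primeideal (sl_ideal n) (mat_poly_ring n :: 'a::field_char_0 coord_poly ring)"
proof (intro primeideal.intro primeideal_axioms.intro ideal_sl_ideal cring_mat_poly_ring)
  have "(1 :: 'a coord_poly) \<notin> sl_ideal n"
    using one_in_SL_mat assms by (subst sl_ideal_iff) (auto simp: mvars_in_one)
  then show "carrier (mat_poly_ring n) \<noteq> (sl_ideal n :: 'a coord_poly set)"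
    using mvars_in_one by auto
  fix a b :: "'a coord_poly"
  assume ab: "a \<in> carrier (mat_poly_ring n)" "b \<in> carrier (mat_poly_ring n)"
    "a \<otimes>\<^bsub>mat_poly_ring n\<^esub> b \<in> sl_ideal n"
  show "a \<in> sl_ideal n \<or> b \<in> sl_ideal n"
  proof (rule ccontr)
    assume "\<not> ?thesis"
    then obtain X Y where "X \<in> SL_mat n" "mat_eval X a \<noteq> 0" "Y \<in> SL_mat n" "mat_eval Y b \<noteq> 0"
      using ab assms by (auto simp: sl_ideal_iff)
    then obtain Z where "Z \<in> SL_mat n" "mat_eval Z a \<noteq> 0" "mat_eval Z b \<noteq> 0"
      using SL_mat_common_nonzero[of a n b] ab assms by auto
    then show False using mat_eval_sl_ideal[OF ab(3)] by (auto simp: mat_eval_simps)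
  qed
qed

lemma domain_sl_coord_ring:
  "n \<ge> 1 \<Longrightarrow> domain (sl_coord_ring n :: 'a::field_char_0 sl_reg ring)"
  unfolding sl_coord_ring_def by (rule primeideal.quotient_is_domain[OF primeideal_sl_ideal])

abbreviation sl_class :: "nat \<Rightarrow> 'a::field coord_poly \<Rightarrow> 'a sl_reg" where
  "sl_class n p \<equiv> sl_ideal n +>\<^bsub>mat_poly_ring n\<^esub> p"

definition sl_frac :: "nat \<Rightarrow> 'a::field coord_poly \<Rightarrow> 'a coord_poly \<Rightarrow> 'a sl_rat" where
  "sl_frac n p q = fraction (sl_coord_ring n) (sl_class n p) (sl_class n q)"

text \<open>By \<open>sl_class_nonzero_iff\<close> the class of such a \<open>q\<close> is nonzero,
  so \<open>q\<close> may serve as a denominator.\<close>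

definition SL_nonzero :: "nat \<Rightarrow> 'a::field coord_poly \<Rightarrow> bool" where
  "SL_nonzero n q \<longleftrightarrow> (\<exists>X\<in>SL_mat n. mat_eval X q \<noteq> 0)"

lemma finsum_mat_poly_ring:
  "(\<And>x. x \<in> A \<Longrightarrow> g x \<in> MP n) \<Longrightarrow> finsum (mat_poly_ring n) g A = (sum g A :: 'a::field coord_poly)"
proof (induction A rule: infinite_finite_induct)
  case (infinite A)
  then show ?case by (simp add: finsum_def finprod_def)
next
  interpret cring "mat_poly_ring n :: 'a coord_poly ring" by (rule cring_mat_poly_ring)
  {
    case empty
    show ?case by simp
  next
    case (insert x A)
    then show ?case by (subst finsum_insert) auto
  }
qed

lemma finprod_mat_poly_ring:
  "(\<And>x. x \<in> A \<Longrightarrow> g x \<in> MP n) \<Longrightarrow> finprod (mat_poly_ring n) g A = (prod g A :: 'a::field coord_poly)"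
proof (induction A rule: infinite_finite_induct)
  case (infinite A)
  then show ?case by (simp add: finprod_def)
next
  interpret cring "mat_poly_ring n :: 'a coord_poly ring" by (rule cring_mat_poly_ring)
  {
    case empty
    show ?case by simp
  next
    case (insert x A)
    then show ?case by (subst finprod_insert) auto
  }
qed

lemma nat_pow_mat_poly_ring: "x [^]\<^bsub>mat_poly_ring n\<^esub> (k::nat) = (x :: 'a::field coord_poly) ^ k"
proof -
  interpret cring "mat_poly_ring n :: 'a coord_poly ring" by (rule cring_mat_poly_ring)
  show ?thesis by (induction k) (simp_all add: mult.commute)
qed

lemma meval_mat_poly_ring:
  assumes "p \<in> mvars_in V" "\<And>v. v \<in> V \<Longrightarrow> f v \<in> MP n"
  shows "meval (mat_poly_ring n) mconst f p = mp_eval mconst f (p :: ('v, 'a::field) mvpoly)"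
proof -
  have f: "f v \<in> MP n" if "m \<in> Poly_Mapping.keys p" "v \<in> Poly_Mapping.keys m" for m v
  proof -
    have "v \<in> V" using assms(1) that by (auto simp: mvars_in_def)
    then show ?thesis by (rule assms(2))
  qed
  have "monom_eval f m \<in> MP n" if "m \<in> Poly_Mapping.keys p" for m
    unfolding monom_eval_def by (rule mvars_in_prod, rule mvars_in_power, rule f[OF that])
  moreover have "(\<Otimes>\<^bsub>mat_poly_ring n\<^esub>v\<in>Poly_Mapping.keys m. f v [^]\<^bsub>mat_poly_ring n\<^esub> Poly_Mapping.lookup m v)
      = monom_eval f m" if "m \<in> Poly_Mapping.keys p" for m
    unfolding nat_pow_mat_poly_ring monom_eval_def
    by (rule finprod_mat_poly_ring) (rule mvars_in_power, rule f[OF that])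
  ultimately show ?thesis
    unfolding meval_def mp_eval_def
    by (subst finsum_mat_poly_ring)
      (auto simp del: One_nat_def intro!: mvars_in_mult mvars_in_const sum.cong)
qed

section \<open>Conjugation of points and of polynomials\<close>

lemma mult_mat_in_mvars:
  fixes A B :: "('v, 'a::comm_ring_1) mvpoly mat"
  assumes "A \<in> carrier_mat n n" "B \<in> carrier_mat n n"
    and "\<And>i j. i < n \<Longrightarrow> j < n \<Longrightarrow> A $$ (i, j) \<in> mvars_in V"
    and "\<And>i j. i < n \<Longrightarrow> j < n \<Longrightarrow> B $$ (i, j) \<in> mvars_in V"
    and "i < n" "j < n"
  shows "(A * B) $$ (i, j) \<in> mvars_in V"
  using assms by (auto simp: scalar_prod_def intro!: mvars_in_sum mvars_in_mult)

abbreviation minv :: "nat \<Rightarrow> 'a::field mat \<Rightarrow> 'a mat" where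
  "minv n g \<equiv> inv\<^bsub>ring_mat TYPE('a) n ()\<^esub> g"

lemma minv_eq:
  fixes g h :: "'a::field mat"
  assumes "g \<in> carrier_mat n n" "h \<in> carrier_mat n n" "g * h = 1\<^sub>m n"
  shows "minv n g = h"
proof -
  interpret ring "ring_mat TYPE('a) n ()" by (rule ring_mat)
  have "h * g = 1\<^sub>m n" using assms by (rule mat_mult_left_right_inverse)
  then show ?thesis
    using assms by (intro inv_char) (auto simp: ring_mat_simps)
qed

text \<open>The inverse \<open>h\<close> is a parameter so that conjugation reads
  \<open>h * X * g\<close>; \<open>minv_eq\<close> identifies \<open>h\<close> with the inverse in
  the ring of matrices that \<open>conj_generic_mat\<close> uses.\<close>

locale invertible_mat_pair =
  fixes n :: nat and g h :: "'a::field_char_0 mat"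
  assumes n: "n \<ge> 1" and g: "g \<in> carrier_mat n n" and h: "h \<in> carrier_mat n n"
    and gh: "g * h = 1\<^sub>m n"
begin

lemma hg: "h * g = 1\<^sub>m n"
  using g h gh by (rule mat_mult_left_right_inverse)

lemma conj_in_SL_mat: "X \<in> SL_mat n \<Longrightarrow> h * X * g \<in> SL_mat n"
proof -
  assume X: "X \<in> SL_mat n"
  then have "det (h * X * g) = det h * det g"
    using g h by (simp add: det_mult[of _ n] SL_mat_def)
  also have "\<dots> = 1"
    using det_mult[OF h g] hg by simp
  finally show ?thesis using X g h by (auto simp: SL_mat_def)
qed

lemma conj_conj:
  assumes X: "X \<in> carrier_mat n n"
  shows "h * (g * X * h) * g = X"
proof -
  have "h * (g * X * h) * g = h * (g * X * h * g)"
    using g h X by (intro assoc_mult_mat) auto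
  also have "g * X * h * g = g * X * (h * g)"
    using g h X by (intro assoc_mult_mat[of _ n n _ n _ n]) auto
  also have "\<dots> = g * X" using g X hg by simp
  also have "h * (g * X) = h * g * X"
    using g h X by (intro assoc_mult_mat[symmetric]) auto
  finally show ?thesis using X hg by simp
qed

lemma map_conj_generic_mat:
  assumes "X \<in> carrier_mat n n"
  shows "map_mat (mat_eval X) (conj_generic_mat n g) = h * X * g"
proof -
  have c: "map_mat (mat_eval X) (map_mat mconst A) = A" for A :: "'a mat"
    by (rule eq_matI) auto
  show ?thesis
    unfolding conj_generic_mat_def minv_eq[OF g h gh]
    using g h assms
    by (simp add: mat_eval.mat_hom_mult[of _ n n _ n] c map_generic_mat)
qed

lemma conj_generic_in_MP:
  "i < n \<Longrightarrow> j < n \<Longrightarrow> conj_generic_mat n g $$ (i, j) \<in> MP n"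
proof -
  assume ij: "i < n" "j < n"
  have "map_mat mconst h * generic_mat n \<in> carrier_mat n n" using h by simp
  moreover have "(map_mat mconst h * generic_mat n) $$ (a, b) \<in> MP n" if "a < n" "b < n" for a b
    using h that
    by (intro mult_mat_in_mvars[of _ n]) (auto simp: mvars_in_const generic_mat_def mvars_in_var)
  ultimately show ?thesis
    unfolding conj_generic_mat_def minv_eq[OF g h gh] using g ij
    by - (rule mult_mat_in_mvars[of _ n],
      auto simp: mvars_in_const simp del: index_mult_mat One_nat_def)
qed

lemma conj_poly_eq:
  "p \<in> MP n \<Longrightarrow> conj_poly n g p = mp_eval mconst (\<lambda>(i, j). conj_generic_mat n g $$ (i - 1, j - 1)) p"
  unfolding conj_poly_def
  by (rule meval_mat_poly_ring) (auto intro!: conj_generic_in_MP[unfolded One_nat_def])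

lemma conj_poly_in_MP: "p \<in> MP n \<Longrightarrow> conj_poly n g p \<in> MP n"
  by (subst conj_poly_eq, simp, rule mp_eval_in_mvars)
    (auto intro!: conj_generic_in_MP[unfolded One_nat_def])

text \<open>Evaluation at \<open>X\<close> is a ring homomorphism that sends the conjugated generic
  matrix to \<open>h * X * g\<close>. Through this formula the action on functions is handled as a
  map of points.\<close>

lemma mat_eval_conj_poly:
  assumes p: "p \<in> MP n" and X: "X \<in> carrier_mat n n"
  shows "mat_eval X (conj_poly n g p) = mat_eval (h * X * g) p"
proof -
  have "mat_eval X (conj_generic_mat n g $$ (i, j)) = (h * X * g) $$ (i, j)" if "i < n" "j < n" for i j
    unfolding map_conj_generic_mat[OF X, symmetric] using that g
    by (subst index_map_mat) (auto simp: conj_generic_mat_def minv_eq[OF g h gh] h[THEN carrier_matD(1)])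
  then show ?thesis
    unfolding conj_poly_eq[OF p] mat_eval_def mp_at_mp_eval
    by (intro mp_eval_cong[OF p]) auto
qed

end

section \<open>Fractions of polynomials on SL(n)\<close>

context
  fixes n :: nat and ty :: "'a::field_char_0 itself"
  assumes n: "n \<ge> 1"
begin

interpretation C: domain "sl_coord_ring n :: 'a sl_reg ring"
  by (rule domain_sl_coord_ring[OF n])
interpretation M: cring "mat_poly_ring n :: 'a coord_poly ring"
  by (rule cring_mat_poly_ring)
interpretation I: ideal "sl_ideal n" "mat_poly_ring n :: 'a coord_poly ring"
  by (rule ideal_sl_ideal)
interpretation h: ring_hom_cring "mat_poly_ring n :: 'a coord_poly ring" "sl_coord_ring n" "sl_class n"
  unfolding sl_coord_ring_def by (rule I.rcos_ring_hom_cring) (rule cring_mat_poly_ring)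
interpretation F: field "sl_field n :: 'a sl_rat ring"
  unfolding sl_field_def by (rule C.field_fraction_field)

lemma field_sl_field: "field (sl_field n :: 'a sl_rat ring)"
  by (rule F.field_axioms)

lemma sl_class_eq_iff:
  fixes p q :: "'a coord_poly"
  assumes "p \<in> MP n" "q \<in> MP n"
  shows "sl_class n p = sl_class n q \<longleftrightarrow> (\<forall>X\<in>SL_mat n. mat_eval X p = mat_eval X q)"
proof -
  have "sl_class n p = sl_class n q \<longleftrightarrow> p - q \<in> sl_ideal n"
    using M.quotient_eq_iff_same_a_r_cos[OF ideal_sl_ideal, of p q] assms by simp
  then show ?thesis
    using sl_ideal_iff[OF mvars_in_diff[OF assms] n] by (simp add: mat_eval_simps)
qed

lemma sl_class_nonzero_iff:
  fixes q :: "'a coord_poly"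
  assumes "q \<in> MP n"
  shows "sl_class n q \<noteq> \<zero>\<^bsub>sl_coord_ring n\<^esub> \<longleftrightarrow> SL_nonzero n q"
proof -
  have "sl_class n q = \<zero>\<^bsub>sl_coord_ring n\<^esub> \<longleftrightarrow> (\<forall>X\<in>SL_mat n. mat_eval X q = mat_eval X 0)"
    using sl_class_eq_iff[OF assms mvars_in_zero] h.hom_zero by simp
  then show ?thesis by (simp add: SL_nonzero_def mat_eval_simps)
qed

lemma sl_class_cases:
  assumes "C \<in> carrier (sl_coord_ring n :: 'a sl_reg ring)"
  obtains p where "p \<in> MP n" "C = sl_class n p"
  using assms by (auto simp: sl_coord_ring_def FactRing_def A_RCOSETS_def')

lemma sl_class_carrier: "p \<in> MP n \<Longrightarrow> sl_class n p \<in> carrier (sl_coord_ring n :: 'a sl_reg ring)"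
  using h.hom_closed by simp

lemma sl_class_carrier_nonzero: "q \<in> MP n \<Longrightarrow> SL_nonzero n q \<Longrightarrow>
    sl_class n q \<in> carrier (sl_coord_ring n :: 'a sl_reg ring) - {\<zero>\<^bsub>sl_coord_ring n\<^esub>}"
  using sl_class_carrier sl_class_nonzero_iff by auto

lemma sl_class_mult: "p \<in> MP n \<Longrightarrow> q \<in> MP n \<Longrightarrow>
    sl_class n p \<otimes>\<^bsub>sl_coord_ring n\<^esub> sl_class n q = (sl_class n (p * q) :: 'a sl_reg)"
  using h.hom_mult[of p q] by simp

lemma sl_class_add: "p \<in> MP n \<Longrightarrow> q \<in> MP n \<Longrightarrow>
    sl_class n p \<oplus>\<^bsub>sl_coord_ring n\<^esub> sl_class n q = (sl_class n (p + q) :: 'a sl_reg)"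
  using h.hom_add[of p q] by simp

lemma sl_frac_cases:
  assumes "f \<in> carrier (sl_field n :: 'a sl_rat ring)"
  obtains p q where "p \<in> MP n" "q \<in> MP n" "SL_nonzero n q" "f = sl_frac n p q"
proof -
  obtain A B where AB: "A \<in> carrier (sl_coord_ring n)"
    "B \<in> carrier (sl_coord_ring n) - {\<zero>\<^bsub>sl_coord_ring n\<^esub>}" "f = fraction (sl_coord_ring n) A B"
    using assms unfolding sl_field_def by (rule C.fraction_cases)
  then obtain p q where "p \<in> MP n" "A = sl_class n p" "q \<in> MP n" "B = sl_class n q"
    by (metis sl_class_cases DiffD1)
  then show ?thesis using AB sl_class_nonzero_iff[of q] by (intro that[of p q]) (auto simp: sl_frac_def)
qed

text \<open>Cross multiplication and \<open>sl_class_eq_iff\<close> turn an equality of rational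
  functions into an identity of values at the points of SL(n), the form in which such equalities are
  checked later.\<close>

lemma sl_frac_eq_iff:
  fixes p q p' q' :: "'a coord_poly"
  assumes "p \<in> MP n" "q \<in> MP n" "p' \<in> MP n" "q' \<in> MP n" "SL_nonzero n q" "SL_nonzero n q'"
  shows "sl_frac n p q = sl_frac n p' q' \<longleftrightarrow>
    (\<forall>X\<in>SL_mat n. mat_eval X p * mat_eval X q' = mat_eval X p' * mat_eval X q)"
proof -
  have "sl_frac n p q = sl_frac n p' q' \<longleftrightarrow> sl_class n (p * q') = sl_class n (p' * q)"
    unfolding sl_frac_def
    by (subst C.fraction_eq_iff)
      (use assms sl_class_carrier sl_class_carrier_nonzero in \<open>simp_all add: sl_class_mult del: One_nat_def\<close>)
  then show ?thesis using assms by (simp add: sl_class_eq_iff mvars_in_mult mat_eval_simps del: One_nat_def)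
qed

lemma sl_frac_carrier: "p \<in> MP n \<Longrightarrow> q \<in> MP n \<Longrightarrow> SL_nonzero n q \<Longrightarrow>
    sl_frac n p q \<in> carrier (sl_field n :: 'a sl_rat ring)"
  unfolding sl_frac_def sl_field_def
  by (intro C.fraction_in_carrier sl_class_carrier sl_class_carrier_nonzero)

lemma sl_frac_mult:
  assumes "p \<in> MP n" "q \<in> MP n" "p' \<in> MP n" "q' \<in> MP n" "SL_nonzero n q" "SL_nonzero n q'"
  shows "sl_frac n p q \<otimes>\<^bsub>sl_field n\<^esub> sl_frac n p' q' = (sl_frac n (p * p') (q * q') :: 'a sl_rat)"
  unfolding sl_frac_def sl_field_def
  by (subst C.fraction_field_mult)
    (use assms sl_class_carrier sl_class_carrier_nonzero in \<open>simp_all add: sl_class_mult del: One_nat_def\<close>)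

lemma sl_frac_add:
  assumes "p \<in> MP n" "q \<in> MP n" "p' \<in> MP n" "q' \<in> MP n" "SL_nonzero n q" "SL_nonzero n q'"
  shows "sl_frac n p q \<oplus>\<^bsub>sl_field n\<^esub> sl_frac n p' q' = (sl_frac n (p * q' + p' * q) (q * q') :: 'a sl_rat)"
  unfolding sl_frac_def sl_field_def
  by (subst C.fraction_field_add)
    (use assms sl_class_carrier sl_class_carrier_nonzero in
      \<open>simp_all add: sl_class_mult sl_class_add mvars_in_mult del: One_nat_def\<close>)

lemma sl_frac_uminus:
  assumes "p \<in> MP n" "q \<in> MP n" "SL_nonzero n q"
  shows "\<ominus>\<^bsub>sl_field n\<^esub> sl_frac n p q = (sl_frac n (- p) q :: 'a sl_rat)"
  unfolding sl_frac_def sl_field_def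
  by (subst C.fraction_field_a_inv)
    (use assms sl_class_carrier sl_class_carrier_nonzero h.hom_a_inv[of p] in \<open>simp_all del: One_nat_def\<close>)

lemma sl_frac_inv:
  assumes "p \<in> MP n" "q \<in> MP n" "SL_nonzero n p" "SL_nonzero n q"
  shows "inv\<^bsub>sl_field n\<^esub> sl_frac n p q = (sl_frac n q p :: 'a sl_rat)"
  unfolding sl_frac_def sl_field_def
  by (rule C.fraction_field_inv)
    (use assms sl_class_carrier_nonzero in auto)

lemma sl_restrict_eq: "sl_restrict n p = (sl_frac n p 1 :: 'a sl_rat)"
  using h.hom_one by (simp add: sl_restrict_def sl_frac_def)

lemma SL_nonzero_one: "SL_nonzero n (1 :: 'a coord_poly)"
  using one_in_SL_mat by (auto simp: SL_nonzero_def mat_eval_simps)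

lemma SL_nonzero_mult:
  fixes p q :: "'a coord_poly"
  assumes "p \<in> MP n" "q \<in> MP n" "SL_nonzero n p" "SL_nonzero n q"
  shows "SL_nonzero n (p * q)"
proof -
  from assms(3,4) obtain X Y where "X \<in> SL_mat n" "mat_eval X p \<noteq> 0" "Y \<in> SL_mat n" "mat_eval Y q \<noteq> 0"
    unfolding SL_nonzero_def by blast
  from SL_mat_common_nonzero[OF assms(1,2) n this] obtain Z
    where "Z \<in> SL_mat n" "mat_eval Z p \<noteq> 0" "mat_eval Z q \<noteq> 0" .
  then show ?thesis by (auto simp: SL_nonzero_def mat_eval_simps)
qed

lemma sl_frac_zero: "\<zero>\<^bsub>sl_field n\<^esub> = (sl_frac n 0 1 :: 'a sl_rat)"
  and sl_frac_one: "\<one>\<^bsub>sl_field n\<^esub> = (sl_frac n 1 1 :: 'a sl_rat)"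
  using h.hom_one h.hom_zero
  by (simp_all add: sl_frac_def sl_field_def C.fraction_field_zero C.fraction_field_one)

lemma sl_frac_eq_zero_iff:
  fixes p q :: "'a coord_poly"
  assumes "p \<in> MP n" "q \<in> MP n" "SL_nonzero n q"
  shows "sl_frac n p q = \<zero>\<^bsub>sl_field n\<^esub> \<longleftrightarrow> \<not> SL_nonzero n p"
  unfolding sl_frac_zero
  by (subst sl_frac_eq_iff)
    (use assms SL_nonzero_one in \<open>auto simp: mvars_in_zero mvars_in_one mat_eval_simps SL_nonzero_def\<close>)

lemma ring_hom_sl_restrict: "ring_hom_cring (mat_poly_ring n) (sl_field n) (sl_restrict n :: _ \<Rightarrow> 'a sl_rat)"
proof (intro ring_hom_cringI cring_mat_poly_ring F.cring_axioms ring_hom_memI)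
  note [simp] = SL_nonzero_one mvars_in_one
  fix p q :: "'a coord_poly" assume p: "p \<in> carrier (mat_poly_ring n)" and q: "q \<in> carrier (mat_poly_ring n)"
  show "sl_restrict n p \<in> carrier (sl_field n)"
    using p by (simp add: sl_restrict_eq sl_frac_carrier del: One_nat_def)
  show "sl_restrict n (p \<otimes>\<^bsub>mat_poly_ring n\<^esub> q) = sl_restrict n p \<otimes>\<^bsub>sl_field n\<^esub> sl_restrict n q"
    using p q by (simp add: sl_restrict_eq sl_frac_mult del: One_nat_def)
  show "sl_restrict n (p \<oplus>\<^bsub>mat_poly_ring n\<^esub> q) = sl_restrict n p \<oplus>\<^bsub>sl_field n\<^esub> sl_restrict n q"
    using p q by (simp add: sl_restrict_eq sl_frac_add del: One_nat_def)
qed (simp add: sl_restrict_eq sl_frac_one)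

text \<open>Restriction to SL(n) is a ring homomorphism, so a polynomial expression in restrictions
  is the restriction of one polynomial, whose vanishing can be tested at points.\<close>

lemma meval_sl_field:
  assumes p: "p \<in> mvars_in V" and f: "\<And>v. v \<in> V \<Longrightarrow> f v \<in> MP n"
  shows "meval (sl_field n) (sl_const n) (\<lambda>v. sl_restrict n (f v)) p =
    (sl_restrict n (mp_eval mconst f p) :: 'a sl_rat)"
proof -
  interpret r: ring_hom_cring "mat_poly_ring n" "sl_field n" "sl_restrict n :: _ \<Rightarrow> 'a sl_rat"
    by (rule ring_hom_sl_restrict)
  have f': "f v \<in> carrier (mat_poly_ring n)" if "m \<in> Poly_Mapping.keys p" "v \<in> Poly_Mapping.keys m" for m v
  proof -
    have "v \<in> V" using p that by (auto simp: mvars_in_def)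
    then show ?thesis using f by simp
  qed
  have pow: "sl_restrict n (x [^]\<^bsub>mat_poly_ring n\<^esub> k) = sl_restrict n x [^]\<^bsub>sl_field n\<^esub> k"
    if "x \<in> carrier (mat_poly_ring n)" for x :: "'a coord_poly" and k :: nat
  proof (induction k)
    case 0
    show ?case using r.hom_one by (simp add: nat_pow_def del: mat_poly_ring_simps)
  next
    case (Suc k)
    then show ?case
      using r.hom_mult[OF M.nat_pow_closed[OF that] that] by (simp only: M.nat_pow_Suc F.nat_pow_Suc)
  qed
  have prod: "sl_restrict n (\<Otimes>\<^bsub>mat_poly_ring n\<^esub>v\<in>Poly_Mapping.keys m. f v [^]\<^bsub>mat_poly_ring n\<^esub> Poly_Mapping.lookup m v)
      = (\<Otimes>\<^bsub>sl_field n\<^esub>v\<in>Poly_Mapping.keys m. sl_restrict n (f v) [^]\<^bsub>sl_field n\<^esub> Poly_Mapping.lookup m v)"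
    if m: "m \<in> Poly_Mapping.keys p" for m
  proof (subst r.hom_finprod)
    show "(\<lambda>v. f v [^]\<^bsub>mat_poly_ring n\<^esub> Poly_Mapping.lookup m v) \<in> Poly_Mapping.keys m \<rightarrow> carrier (mat_poly_ring n)"
      using f'[OF m] by (auto intro!: M.nat_pow_closed simp del: mat_poly_ring_simps)
    show "finprod (sl_field n) (sl_restrict n \<circ> (\<lambda>v. f v [^]\<^bsub>mat_poly_ring n\<^esub> Poly_Mapping.lookup m v)) (Poly_Mapping.keys m)
      = (\<Otimes>\<^bsub>sl_field n\<^esub>v\<in>Poly_Mapping.keys m. sl_restrict n (f v) [^]\<^bsub>sl_field n\<^esub> Poly_Mapping.lookup m v)"
      using f'[OF m] by (intro F.finprod_cong') (auto simp: pow intro!: F.nat_pow_closed)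
  qed
  have pc: "(\<Otimes>\<^bsub>mat_poly_ring n\<^esub>v\<in>Poly_Mapping.keys m. f v [^]\<^bsub>mat_poly_ring n\<^esub> Poly_Mapping.lookup m v)
      \<in> carrier (mat_poly_ring n)" if m: "m \<in> Poly_Mapping.keys p" for m
    using f'[OF m] by (auto intro!: M.finprod_closed M.nat_pow_closed simp del: mat_poly_ring_simps)
  have cc: "mconst c \<in> carrier (mat_poly_ring n :: 'a coord_poly ring)" for c
    by (simp add: mvars_in_const)
  have "sl_restrict n (meval (mat_poly_ring n) mconst f p)
      = meval (sl_field n) (sl_const n) (\<lambda>v. sl_restrict n (f v)) p"
    unfolding meval_def
  proof (subst r.hom_finsum)
    show "finsum (sl_field n) (sl_restrict n \<circ> (\<lambda>m. mconst (Poly_Mapping.lookup p m) \<otimes>\<^bsub>mat_poly_ring n\<^esub>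
          (\<Otimes>\<^bsub>mat_poly_ring n\<^esub>v\<in>Poly_Mapping.keys m. f v [^]\<^bsub>mat_poly_ring n\<^esub> Poly_Mapping.lookup m v))) (Poly_Mapping.keys p)
      = (\<Oplus>\<^bsub>sl_field n\<^esub>m\<in>Poly_Mapping.keys p. sl_const n (Poly_Mapping.lookup p m) \<otimes>\<^bsub>sl_field n\<^esub>
          (\<Otimes>\<^bsub>sl_field n\<^esub>v\<in>Poly_Mapping.keys m. sl_restrict n (f v) [^]\<^bsub>sl_field n\<^esub> Poly_Mapping.lookup m v))"
      using cc pc
      by (intro F.finsum_cong')
        (auto simp: r.hom_mult prod[symmetric] sl_const_def simp del: mat_poly_ring_simps)
  qed (use cc pc in \<open>auto simp del: mat_poly_ring_simps\<close>)
  then show ?thesis using meval_mat_poly_ring[OF p f] by simp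
qed

text \<open>Two members of a class have the same values on SL(n), and conjugation maps SL(n) to
  itself; so their images have the same values, and all members of the union coincide.\<close>

lemma conj_reg_sl_class:
  assumes "invertible_mat_pair n g (h :: 'a mat)" and p: "p \<in> MP n"
  shows "conj_reg n g (sl_class n p) = sl_class n (conj_poly n g p)"
proof -
  interpret P: invertible_mat_pair n g h by fact
  show ?thesis unfolding conj_reg_def
  proof (rule SUP_eq_const)
    show "sl_class n p \<noteq> {}" using I.a_rcos_self[of p] p by auto
    fix q assume "q \<in> sl_class n p"
    then obtain i where i: "i \<in> sl_ideal n" "q = i + p" by (auto simp: a_r_coset_def')
    have qM: "q \<in> MP n" using I.a_Hcarr[OF i(1)] i(2) p by (simp add: mvars_in_add)
    have "mat_eval X q = mat_eval X p" if "X \<in> SL_mat n" for X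
      using mat_eval_sl_ideal[OF i(1) that] i(2) by (simp add: mat_eval_simps)
    then show "sl_class n (conj_poly n g q) = sl_class n (conj_poly n g p)"
      using P.conj_in_SL_mat
      by (subst sl_class_eq_iff)
        (auto simp: P.conj_poly_in_MP[OF p] P.conj_poly_in_MP[OF qM] P.mat_eval_conj_poly[OF p]
          P.mat_eval_conj_poly[OF qM] SL_mat_def simp del: One_nat_def)
  qed
qed

lemma conj_rat_sl_frac:
  assumes "invertible_mat_pair n g (h :: 'a mat)"
    and p: "p \<in> MP n" and q: "q \<in> MP n" and nz: "SL_nonzero n q"
  shows "conj_rat n g (sl_frac n p q) = sl_frac n (conj_poly n g p) (conj_poly n g q)"
    and "SL_nonzero n (conj_poly n g q)"
proof -
  interpret P: invertible_mat_pair n g h by fact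
  have carr: "X \<in> carrier_mat n n" if "X \<in> SL_mat n" for X :: "'a mat"
    using that by (simp add: SL_mat_def)
  have hg: "h * (g * X * h) * g = X" if "X \<in> SL_mat n" for X
    by (rule P.conj_conj) (use that in \<open>simp add: SL_mat_def\<close>)
  interpret P': invertible_mat_pair n h g by unfold_locales (use P.n P.g P.h P.hg in auto)
  \<comment> \<open>A point \<open>X\<close> with a nonzero value is replaced by
    \<open>g * X * h\<close>, whose conjugate is \<open>X\<close>.\<close>
  have nz': "SL_nonzero n (conj_poly n g r)" if "r \<in> MP n" "SL_nonzero n r" for r
  proof -
    obtain X where X: "X \<in> SL_mat n" "mat_eval X r \<noteq> 0" using \<open>SL_nonzero n r\<close> by (auto simp: SL_nonzero_def)
    then show ?thesis
      using P.mat_eval_conj_poly[OF \<open>r \<in> MP n\<close> carr, of "g * X * h"] hg P'.conj_in_SL_mat[OF X(1)]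
      by (auto simp: SL_nonzero_def intro!: bexI[of _ "g * X * h"])
  qed
  show "SL_nonzero n (conj_poly n g q)" by (rule nz'[OF q nz])
  show "conj_rat n g (sl_frac n p q) = sl_frac n (conj_poly n g p) (conj_poly n g q)"
    unfolding conj_rat_def sl_frac_def
  proof (rule C.UN_fraction)
    fix x y assume x: "x \<in> carrier (sl_coord_ring n)"
      and y: "y \<in> carrier (sl_coord_ring n) - {\<zero>\<^bsub>sl_coord_ring n\<^esub>}"
      and eq: "sl_class n p \<otimes>\<^bsub>sl_coord_ring n\<^esub> y = x \<otimes>\<^bsub>sl_coord_ring n\<^esub> sl_class n q"
    obtain p' where p': "p' \<in> MP n" "x = sl_class n p'" using x by (rule sl_class_cases)
    obtain q' where q': "q' \<in> MP n" "y = sl_class n q'" using y[THEN DiffD1] by (rule sl_class_cases)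
    have nzq': "SL_nonzero n q'" using y q' sl_class_nonzero_iff by auto
    have "sl_class n (p * q') = sl_class n (p' * q)"
      using eq p q p' q' by (simp add: sl_class_mult)
    then have e: "mat_eval X p * mat_eval X q' = mat_eval X p' * mat_eval X q" if "X \<in> SL_mat n" for X
      using sl_class_eq_iff[of "p * q'" "p' * q"] p q p' q' that
      by (simp add: mvars_in_mult mat_eval_simps)
    have "sl_frac n (conj_poly n g p') (conj_poly n g q') = sl_frac n (conj_poly n g p) (conj_poly n g q)"
      by (subst sl_frac_eq_iff)
        (use p q p'(1) q'(1) nz nzq' e P.conj_in_SL_mat in
          \<open>auto simp: P.conj_poly_in_MP nz' P.mat_eval_conj_poly carr simp del: One_nat_def\<close>)
    then show "fraction (sl_coord_ring n) (conj_reg n g x) (conj_reg n g y) =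
        fraction (sl_coord_ring n) (sl_class n (conj_poly n g p)) (sl_class n (conj_poly n g q))"
      using p' q' by (simp add: sl_frac_def conj_reg_sl_class[OF assms(1)] del: One_nat_def)
  qed (use p q nz sl_class_carrier sl_class_carrier_nonzero in auto)
qed

end

section \<open>Triangular matrices and invariance of the minors\<close>

text \<open>With \<open>R\<close> as a parameter, this and \<open>unipotent\<close> serve the upper
  triangular matrices (\<open>R\<close> is \<le>), the group \<open>U\<close> (\<open>R\<close> is
  \<open>below\<close>) and the unipotent part of the Levi subgroup (\<open>R\<close> is
  \<open>inside\<close>).\<close>

definition supported :: "(nat \<Rightarrow> nat \<Rightarrow> bool) \<Rightarrow> nat \<Rightarrow> 'a::zero mat \<Rightarrow> bool" where
  "supported R n A \<longleftrightarrow> A \<in> carrier_mat n n \<and> (\<forall>i<n. \<forall>j<n. A $$ (i, j) \<noteq> 0 \<longrightarrow> R i j)"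

definition unipotent :: "(nat \<Rightarrow> nat \<Rightarrow> bool) \<Rightarrow> nat \<Rightarrow> 'a::zero_neq_one mat \<Rightarrow> bool" where
  "unipotent R n A \<longleftrightarrow> supported R n A \<and> (\<forall>i<n. A $$ (i, i) = 1)"

text \<open>A partial order on the indices that is compatible with their natural order. The matrices
  supported on it form its incidence algebra, which is why inverses stay supported in
  \<open>supported_inverse\<close>.\<close>

definition triangular_order :: "(nat \<Rightarrow> nat \<Rightarrow> bool) \<Rightarrow> nat \<Rightarrow> bool" where
  "triangular_order R n \<longleftrightarrow> (\<forall>i<n. R i i) \<and> (\<forall>i<n. \<forall>j<n. R i j \<longrightarrow> i \<le> j) \<and>
     (\<forall>i<n. \<forall>t<n. \<forall>j<n. R i t \<longrightarrow> R t j \<longrightarrow> R i j)"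

lemma index_mult_sum:
  assumes "A \<in> carrier_mat n n" "B \<in> carrier_mat n n" "i < n" "j < n"
  shows "(A * B) $$ (i, j) = (\<Sum>t<n. A $$ (i, t) * B $$ (t, j))"
  using assms by (simp add: scalar_prod_def atLeast0LessThan)

lemma supported_mult:
  fixes A B :: "'a::comm_ring_1 mat"
  assumes "supported R n A" "supported R n B"
    and "\<And>i t j. i < n \<Longrightarrow> t < n \<Longrightarrow> j < n \<Longrightarrow> R i t \<Longrightarrow> R t j \<Longrightarrow> R i j"
  shows "supported R n (A * B)"
proof -
  have c: "A \<in> carrier_mat n n" "B \<in> carrier_mat n n" using assms(1,2) by (auto simp: supported_def)
  have "R i j" if ij: "i < n" "j < n" and nz: "(A * B) $$ (i, j) \<noteq> 0" for i j
  proof -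
    from nz have "(\<Sum>t<n. A $$ (i, t) * B $$ (t, j)) \<noteq> 0" unfolding index_mult_sum[OF c ij] .
    then obtain t where t: "t \<in> {..<n}" "A $$ (i, t) * B $$ (t, j) \<noteq> 0"
      by (rule sum.not_neutral_contains_not_neutral)
    then have "A $$ (i, t) \<noteq> 0" "B $$ (t, j) \<noteq> 0" by auto
    then have "R i t" "R t j" using assms(1,2) ij t(1) by (simp_all add: supported_def)
    then show ?thesis using assms(3)[of i t j] ij t(1) by simp
  qed
  then show ?thesis using c by (auto simp: supported_def)
qed

lemma unipotent_mono:
  "unipotent R n A \<Longrightarrow> (\<And>i j. i < n \<Longrightarrow> j < n \<Longrightarrow> R i j \<Longrightarrow> R' i j) \<Longrightarrow> unipotent R' n A"
  by (auto simp: supported_def unipotent_def)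

lemma unipotent_carrier: "unipotent R n A \<Longrightarrow> A \<in> carrier_mat n n"
  by (simp add: unipotent_def supported_def)

lemma unipotent_diag: "unipotent R n A \<Longrightarrow> i < n \<Longrightarrow> A $$ (i, i) = 1"
  by (simp add: unipotent_def)

lemma unipotent_lower_zero:
  assumes "unipotent (\<le>) n A" "i < n" "j < i"
  shows "A $$ (i, j) = 0"
proof (rule ccontr)
  assume "A $$ (i, j) \<noteq> 0"
  then have "i \<le> j" using assms by (simp add: unipotent_def supported_def)
  then show False using assms by simp
qed

lemma unipotent_mult:
  fixes A B :: "'a::comm_ring_1 mat"
  assumes "unipotent (\<le>) n A" "unipotent (\<le>) n B"
  shows "unipotent (\<le>) n (A * B)"
proof -
  have c: "A \<in> carrier_mat n n" "B \<in> carrier_mat n n" using assms by (auto simp: supported_def unipotent_def)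
  have "(A * B) $$ (i, i) = 1" if i: "i < n" for i
  proof -
    have "(A * B) $$ (i, i) = (\<Sum>t<n. if t = i then 1 else 0)"
      unfolding index_mult_sum[OF c i i]
    proof (rule sum.cong, simp)
      fix t assume t: "t \<in> {..<n}"
      have "A $$ (i, t) = 0 \<or> B $$ (t, i) = 0" if "t \<noteq> i"
      proof (rule ccontr)
        assume "\<not> ?thesis"
        then have "i \<le> t" "t \<le> i"
          using assms i t by (simp_all add: unipotent_def supported_def)
        then show False using that by simp
      qed
      then show "A $$ (i, t) * B $$ (t, i) = (if t = i then 1 else 0)"
        using assms i by (auto simp: unipotent_def)
    qed
    then show ?thesis using i by simp
  qed
  then show ?thesis
    using assms supported_mult[of "(\<le>)" n A B] by (simp add: unipotent_def)
qed

text \<open>Induction on the rows from the last one upwards. If \<open>B $$ (i, j)\<close> is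
  nonzero off the diagonal, the term \<open>A $$ (i, i) * B $$ (i, j)\<close> in row
  \<open>i\<close> of \<open>A * B = 1\<close> must be cancelled by another one; this yields
  \<open>t > i\<close> with \<open>R i t\<close> and \<open>B $$ (t, j)\<close> nonzero, and
  transitivity finishes. On the diagonal, triangularity leaves a single term.\<close>

lemma supported_inverse:
  fixes A B :: "'a::field mat"
  assumes A: "supported R n A" and B: "B \<in> carrier_mat n n" and AB: "A * B = 1\<^sub>m n"
    and nz: "\<And>i. i < n \<Longrightarrow> A $$ (i, i) \<noteq> 0"
    and ord: "triangular_order R n"
  shows "supported R n B" "\<And>i. i < n \<Longrightarrow> A $$ (i, i) * B $$ (i, i) = 1"
proof -
  have refl: "\<And>i. i < n \<Longrightarrow> R i i"
    and trans: "\<And>i t j. i < n \<Longrightarrow> t < n \<Longrightarrow> j < n \<Longrightarrow> R i t \<Longrightarrow> R t j \<Longrightarrow> R i j"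
    and le: "\<And>i j. i < n \<Longrightarrow> j < n \<Longrightarrow> R i j \<Longrightarrow> i \<le> j"
    using ord unfolding triangular_order_def by blast+
  have Ac: "A \<in> carrier_mat n n" using A by (simp add: supported_def)
  have entry: "(\<Sum>t<n. A $$ (i, t) * B $$ (t, j)) = (if i = j then 1 else 0)" if "i < n" "j < n" for i j
    using that AB index_mult_sum[OF Ac B that] by simp
  have R: "R i j" if "i < n" "j < n" "B $$ (i, j) \<noteq> 0" for i j
    using that
  proof (induction "n - i" arbitrary: i rule: less_induct)
    case less
    show ?case
    proof (cases "i = j")
      case False
      have "\<exists>t<n. t \<noteq> i \<and> A $$ (i, t) \<noteq> 0 \<and> B $$ (t, j) \<noteq> 0"
      proof (rule ccontr)
        assume "\<not> ?thesis"
        then have "(\<Sum>t<n. A $$ (i, t) * B $$ (t, j)) = (\<Sum>t<n. if t = i then A $$ (i, i) * B $$ (i, j) else 0)"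
          by (intro sum.cong) auto
        then show False using entry[of i j] less.prems nz[of i] False by simp
      qed
      then obtain t where t: "t < n" "t \<noteq> i" "R i t" "B $$ (t, j) \<noteq> 0"
        using A less.prems by (auto simp: supported_def)
      then have "i < t" using le[of i t] less.prems by simp
      then have "R t j" using less t by auto
      then show ?thesis using trans t less.prems by blast
    qed (use refl less in auto)
  qed
  then show "supported R n B" using B by (simp add: supported_def)
  fix i assume i: "i < n"
  have "A $$ (i, t) * B $$ (t, i) = (if t = i then A $$ (i, i) * B $$ (i, i) else 0)" if "t < n" for t
  proof (cases "t = i")
    case False
    have "A $$ (i, t) = 0 \<or> B $$ (t, i) = 0"
    proof (rule ccontr)
      assume "\<not> ?thesis"
      then have "R i t" "R t i" using A R[OF that i] that i by (simp_all add: supported_def)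
      then show False using le[OF i that] le[OF that i] False by simp
    qed
    then show ?thesis using False by auto
  qed simp
  then have "(\<Sum>t<n. A $$ (i, t) * B $$ (t, i)) = (\<Sum>t<n. if t = i then A $$ (i, i) * B $$ (i, i) else 0)"
    by (intro sum.cong) auto
  then show "A $$ (i, i) * B $$ (i, i) = 1" using entry[OF i i] i by simp
qed

lemma unipotent_inverse:
  fixes A B :: "'a::field mat"
  assumes A: "unipotent R n A" and B: "B \<in> carrier_mat n n" and AB: "A * B = 1\<^sub>m n"
    and ord: "triangular_order R n"
  shows "unipotent R n B"
proof -
  have nz: "A $$ (i, i) = 1" if "i < n" for i using A that by (simp add: unipotent_def)
  have A': "supported R n A" using A by (simp add: unipotent_def)
  have nz': "A $$ (i, i) \<noteq> 0" if "i < n" for i using nz[OF that] by simp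
  have "B $$ (i, i) = 1" if "i < n" for i
    using supported_inverse(2)[OF A' B AB nz' ord that] nz[OF that] by simp
  moreover have "supported R n B" by (rule supported_inverse(1)[OF A' B AB nz' ord])
  ultimately show ?thesis by (simp add: unipotent_def)
qed

lemma det_unitriangular:
  fixes A :: "'a::comm_ring_1 mat"
  assumes "A \<in> carrier_mat m m" "\<And>i j. i < m \<Longrightarrow> j < i \<Longrightarrow> A $$ (i, j) = 0" "\<And>i. i < m \<Longrightarrow> A $$ (i, i) = 1"
  shows "det A = 1"
proof -
  have "det A = prod_list (diag_mat A)"
    by (rule det_upper_triangular[of _ m]) (use assms in auto)
  also have "diag_mat A = map (\<lambda>i. 1) [0..<m]"
    using assms by (auto simp: diag_mat_def)
  finally show ?thesis by (simp add: map_replicate_const)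
qed

lemma det_unipotent:
  fixes A :: "'a::comm_ring_1 mat"
  assumes "unipotent (\<le>) n A"
  shows "det A = 1"
  by (rule det_unitriangular[of _ n])
    (use assms unipotent_lower_zero[OF assms] unipotent_carrier[OF assms] unipotent_diag[OF assms] in auto)

lemma right_inverse_exists:
  fixes A :: "'a::field mat"
  assumes "A \<in> carrier_mat n n" "det A \<noteq> 0"
  obtains B where "B \<in> carrier_mat n n" "A * B = 1\<^sub>m n"
proof -
  have "A \<in> Units (ring_mat TYPE('a) n ())"
    using assms by (rule det_non_zero_imp_unit)
  then show ?thesis using that by (auto simp: Units_def ring_mat_simps)
qed

lemma adj_mat_eq_inverse:
  fixes A :: "'a::field mat"
  assumes "A \<in> carrier_mat n n" "B \<in> carrier_mat n n" "A * B = 1\<^sub>m n" "det A = 1"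
  shows "adj_mat A = B"
proof -
  have "adj_mat A = adj_mat A * (A * B)" using assms adj_mat(1)[OF assms(1)] by simp
  also have "\<dots> = (adj_mat A * A) * B"
    using assms adj_mat(1)[OF assms(1)] by (intro assoc_mult_mat[symmetric])
  also have "adj_mat A * A = 1\<^sub>m n" using adj_mat(3)[OF assms(1)] assms(4) by auto
  finally show ?thesis using assms by simp
qed

subsection \<open>The minors\<close>

text \<open>The formula of \<open>J_poly\<close> for a matrix over any ring, so that it applies to
  the generic matrix and to its values alike.\<close>

definition J_val :: "nat \<Rightarrow> nat \<Rightarrow> nat \<Rightarrow> 'b::comm_ring_1 mat \<Rightarrow> 'b" where
  "J_val n i j X =
     (if i + j \<le> n + 1
      then det (sub_mat X (i # [mirror n j + 1..<n + 1]) [1..<j + 1])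
      else det (sub_mat X [n + 1 - mirror n i..<n + 1] [1..<j + 1] @\<^sub>r
                sub_mat (adj_mat X) [n + 1 - (j - mirror n i)..<n + 1] [1..<j + 1]))"

definition J_upper :: "nat \<Rightarrow> nat \<Rightarrow> nat \<Rightarrow> 'b::comm_ring_1 mat \<Rightarrow> 'b" where
  "J_upper n i j X = det (mat j j (\<lambda>(a, b). X $$ (if a = 0 then i - 1 else n - j + a, b)))"

text \<open>\<open>p\<close> stands for \<open>mirror n i\<close> and \<open>k\<close> for
  \<open>j - mirror n i\<close>: the numbers of rows taken from the matrix and from its
  adjugate.\<close>

definition J_lower :: "nat \<Rightarrow> nat \<Rightarrow> nat \<Rightarrow> 'b::comm_ring_1 mat \<Rightarrow> 'b" where
  "J_lower n p k X = det (mat (p + k) (p + k)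
     (\<lambda>(a, b). if a < p then X $$ (n - p + a, b) else adj_mat X $$ (n - k + (a - p), b)))"

text \<open>The minor in the lower left corner. For \<open>a\<close> in [1, n] it belongs to the
  antidiagonal position \<open>(n + 1 - a, a)\<close>; the empty minor with \<open>a = 0\<close>
  starts the recursions.\<close>

definition corner_minor :: "nat \<Rightarrow> nat \<Rightarrow> 'b::comm_ring_1 mat \<Rightarrow> 'b" where
  "corner_minor n a X = det (mat a a (\<lambda>(r, c). X $$ (n - a + r, c)))"

text \<open>A minor in the last rows and consecutive columns. The entries come from a function
  because they are unknowns in \<open>shifted_minors_prescribed\<close>.\<close>

definition shifted_minor :: "nat \<Rightarrow> nat \<Rightarrow> nat \<Rightarrow> (nat \<Rightarrow> nat \<Rightarrow> 'b) \<Rightarrow> 'b::comm_ring_1" where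
  "shifted_minor n p k q = det (mat k k (\<lambda>(a, b). q (n - k + a) (p + b)))"

lemma J_poly_eq_J_val: "J_poly n i j = J_val n i j (generic_mat n)"
  by (simp add: J_poly_def J_val_def)

lemma J_val_eq_upper:
  assumes "1 \<le> i" "1 \<le> j" "i + j \<le> n + 1"
  shows "J_val n i j X = J_upper n i j X"
proof -
  have "sub_mat X (i # [mirror n j + 1..<n + 1]) [1..<j + 1]
      = mat j j (\<lambda>(a, b). X $$ (if a = 0 then i - 1 else n - j + a, b))"
    by (rule eq_matI)
      (use assms in \<open>auto simp: sub_mat_def mirror_def nth_Cons Suc_diff_le split: nat.splits simp del: upt_Suc\<close>)
  then show ?thesis using assms by (simp add: J_val_def J_upper_def)
qed

lemma J_val_eq_lower:
  assumes "1 \<le> p" "1 \<le> k" "p + k \<le> n"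
  shows "J_val n (n + 1 - p) (p + k) X = J_lower n p k X"
proof -
  have m: "mirror n (n + 1 - p) = p" using assms by (simp add: mirror_def)
  have "sub_mat X [n + 1 - p..<n + 1] [1..<p + k + 1] @\<^sub>r
      sub_mat (adj_mat X) [n + 1 - (p + k - p)..<n + 1] [1..<p + k + 1]
    = mat (p + k) (p + k)
     (\<lambda>(a, b). if a < p then X $$ (n - p + a, b) else adj_mat X $$ (n - k + (a - p), b))"
    by (rule eq_matI)
      (use assms in \<open>auto simp: sub_mat_def append_rows_def Suc_diff_le simp del: upt_Suc\<close>)
  then show ?thesis using assms m by (simp add: J_val_def J_lower_def del: upt_Suc)
qed

lemma corner_minor_eq_J_upper:
  assumes "1 \<le> a" "a \<le> n"
  shows "corner_minor n a X = J_upper n (n + 1 - a) a X"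
  unfolding corner_minor_def J_upper_def
  by (rule arg_cong[where f = det], rule eq_matI) (use assms in auto)

lemma corner_minor_full: "X \<in> carrier_mat n n \<Longrightarrow> corner_minor n n X = det X"
  unfolding corner_minor_def by (rule arg_cong[where f = det], rule eq_matI) auto

lemma corner_minor_0: "corner_minor n 0 X = 1"
  by (simp add: corner_minor_def)

text \<open>As \<open>v\<close> is upper triangular, the first \<open>j\<close> columns of the
  product only involve the first \<open>j\<close> columns of \<open>F\<close>; so the leading block
  of \<open>v\<close>, of determinant 1, splits off on the right. \<open>F\<close> is an arbitrary
  function so that its rows may come from two matrices, as in \<open>J_lower\<close>.\<close>

lemma det_mult_right_unipotent:
  fixes v :: "'a::comm_ring_1 mat"
  assumes v: "unipotent (\<le>) n v" and j: "j \<le> n"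
  shows "det (mat j j (\<lambda>(a, b). \<Sum>t<n. F a t * v $$ (t, b))) = det (mat j j (\<lambda>(a, b). F a b))"
proof -
  let ?F = "mat j j (\<lambda>(a, b). F a b)" and ?V = "mat j j (\<lambda>(a, b). v $$ (a, b))"
  have v0: "v $$ (t, b) = 0" if "t < n" "b < j" "b < t" for t b
    using unipotent_lower_zero[OF v that(1,3)] .
  have "mat j j (\<lambda>(a, b). \<Sum>t<n. F a t * v $$ (t, b)) = ?F * ?V"
  proof (rule eq_matI)
    fix a b assume "a < dim_row (?F * ?V)" "b < dim_col (?F * ?V)"
    then have ab: "a < j" "b < j" by auto
    have "(\<Sum>t<n. F a t * v $$ (t, b)) = (\<Sum>t<j. F a t * v $$ (t, b))"
      by (rule sum.mono_neutral_right) (use j ab v0 in auto)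
    then show "mat j j (\<lambda>(a, b). \<Sum>t<n. F a t * v $$ (t, b)) $$ (a, b) = (?F * ?V) $$ (a, b)"
      using ab by (simp add: index_mult_sum[of _ j] del: index_mult_mat(1))
  qed auto
  then have "det (mat j j (\<lambda>(a, b). \<Sum>t<n. F a t * v $$ (t, b))) = det ?F * det ?V"
    using det_mult[of ?F j ?V] by simp
  also have "det ?V = 1"
    by (rule det_unitriangular[of _ j]) (use v0 v j in \<open>auto simp: unipotent_def\<close>)
  finally show ?thesis by simp
qed

lemma det_mult_left_unitriangular:
  fixes M :: "nat \<Rightarrow> nat \<Rightarrow> 'a::comm_ring_1"
  assumes "\<And>i j. i < m \<Longrightarrow> j < i \<Longrightarrow> U i j = 0" "\<And>i. i < m \<Longrightarrow> U i i = 1"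
    and "\<And>a b. a < m \<Longrightarrow> b < m \<Longrightarrow> M' a b = (\<Sum>c<m. U a c * M c b)"
  shows "det (mat m m (\<lambda>(a, b). M' a b)) = det (mat m m (\<lambda>(a, b). M a b))"
proof -
  have "mat m m (\<lambda>(a, b). M' a b) = mat m m (\<lambda>(a, b). U a b) * mat m m (\<lambda>(a, b). M a b)"
    by (rule eq_matI) (use assms(3) in \<open>auto simp: index_mult_sum[of _ m] simp del: index_mult_mat(1)\<close>)
  then have "det (mat m m (\<lambda>(a, b). M' a b)) = det (mat m m (\<lambda>(a, b). U a b)) * det (mat m m (\<lambda>(a, b). M a b))"
    by (simp add: det_mult[of _ m])
  also have "det (mat m m (\<lambda>(a, b). U a b)) = 1"
    by (rule det_unitriangular[of _ m]) (use assms in auto)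
  finally show ?thesis by simp
qed

lemma sum_tail:
  fixes f :: "nat \<Rightarrow> 'a::comm_monoid_add"
  assumes "p \<le> n" "\<And>s. s < n - p \<Longrightarrow> f s = 0"
  shows "(\<Sum>s<n. f s) = (\<Sum>c<p. f (n - p + c))"
proof -
  have "(\<Sum>s<n. f s) = sum f {n - p..<n}"
    by (rule sum.mono_neutral_right) (use assms in auto)
  also have "\<dots> = (\<Sum>c<p. f (n - p + c))"
    by (rule sum.reindex_bij_witness[of _ "\<lambda>c. n - p + c" "\<lambda>s. s - (n - p)"]) (use assms in auto)
  finally show ?thesis .
qed

lemma J_upper_mult_right:
  assumes X: "X \<in> carrier_mat n n" and v: "unipotent (\<le>) n v" and ij: "1 \<le> i" "i \<le> n" "j \<le> n"
  shows "J_upper n i j (X * v) = J_upper n i j X"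
proof -
  have vc: "v \<in> carrier_mat n n" using v by (simp add: unipotent_def supported_def)
  have "mat j j (\<lambda>(a, b). (X * v) $$ (if a = 0 then i - 1 else n - j + a, b))
     = mat j j (\<lambda>(a, b). \<Sum>t<n. X $$ (if a = 0 then i - 1 else n - j + a, t) * v $$ (t, b))"
    by (rule eq_matI) (use ij X vc in \<open>auto simp: index_mult_sum[OF X vc] simp del: index_mult_mat(1)\<close>)
  then show ?thesis
    unfolding J_upper_def by (simp add: det_mult_right_unipotent[OF v ij(3)])
qed

text \<open>The selected rows are \<open>i - 1\<close> and those after \<open>n - j\<close>. By
  \<open>row\<close> and triangularity, each selected row of \<open>g * X\<close> is a combination
  of selected rows of \<open>X\<close> only, with unitriangular coefficients.\<close>

lemma J_upper_mult_left:
  fixes g :: "'a::comm_ring_1 mat"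
  assumes X: "X \<in> carrier_mat n n" and g: "unipotent (\<le>) n g"
    and ij: "1 \<le> i" "1 \<le> j" "i + j \<le> n + 1"
    and row: "\<And>s. s < n \<Longrightarrow> s \<noteq> i - 1 \<Longrightarrow> s \<le> n - j \<Longrightarrow> g $$ (i - 1, s) = 0"
  shows "J_upper n i j (g * X) = J_upper n i j X"
proof -
  have gc: "g \<in> carrier_mat n n" using g by (simp add: unipotent_def supported_def)
  have jn: "j \<le> n" using ij by simp
  define r where "r a = (if a = 0 then i - 1 else n - j + a)" for a :: nat
  have r: "r a < n" if "a < j" for a using that ij by (auto simp: r_def)
  have g0: "g $$ (s, t) = 0" if "s < n" "t < s" for s t
    using unipotent_lower_zero[OF g that] .
  have img: "g $$ (r a, s) = 0" if "a < j" "s < n" "s \<notin> r ` {..<j}" for a s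
  proof -
    have "s \<le> n - j \<and> s \<noteq> i - 1"
    proof (rule ccontr)
      assume *: "\<not> ?thesis"
      have "s \<in> r ` {..<j}"
      proof (cases "s = i - 1")
        case True then show ?thesis using ij by (intro image_eqI[of _ _ 0]) (auto simp: r_def)
      next
        case False then show ?thesis using * that jn
          by (intro image_eqI[of _ _ "s - (n - j)"]) (auto simp: r_def)
      qed
      with that show False by simp
    qed
    then show ?thesis using that row[of s] g0[of "r a" s] r[of a] by (cases "a = 0") (auto simp: r_def)
  qed
  have inj: "inj_on r {..<j}"
    using ij by (auto simp: inj_on_def r_def)
  have "det (mat j j (\<lambda>(a, b). (g * X) $$ (r a, b))) = det (mat j j (\<lambda>(a, b). X $$ (r a, b)))"
  proof (rule det_mult_left_unitriangular[where U = "\<lambda>a c. g $$ (r a, r c)"])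
    show "g $$ (r a, r c) = 0" if "a < j" "c < a" for a c
    proof (rule g0)
      show "r c < r a" using that ij by (auto simp: r_def)
    qed (use r that in auto)
    show "g $$ (r a, r a) = 1" if "a < j" for a
      using g r[OF that] by (simp add: unipotent_def)
    fix a b assume ab: "a < j" "b < j"
    have "(g * X) $$ (r a, b) = (\<Sum>s<n. g $$ (r a, s) * X $$ (s, b))"
      using ab jn r by (intro index_mult_sum[OF gc X]) auto
    also have "\<dots> = (\<Sum>s\<in>r ` {..<j}. g $$ (r a, s) * X $$ (s, b))"
      by (rule sum.mono_neutral_right) (use ab r img in auto)
    also have "\<dots> = (\<Sum>c<j. g $$ (r a, r c) * X $$ (r c, b))"
      by (simp add: sum.reindex[OF inj])
    finally show "(g * X) $$ (r a, b) = (\<Sum>c<j. g $$ (r a, r c) * X $$ (r c, b))" .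
  qed
  then show ?thesis by (simp add: J_upper_def r_def)
qed

lemma corner_minor_mult_right:
  assumes "X \<in> carrier_mat n n" "unipotent (\<le>) n v" "a \<le> n"
  shows "corner_minor n a (X * v) = corner_minor n a X"
  using assms J_upper_mult_right[of X n v "n + 1 - a" a]
  by (cases "a = 0") (simp_all add: corner_minor_eq_J_upper corner_minor_0)

lemma corner_minor_mult_left:
  assumes X: "X \<in> carrier_mat n n" and g: "unipotent (\<le>) n g" and a: "a \<le> n"
  shows "corner_minor n a (g * X) = corner_minor n a X"
proof (cases "a = 0")
  case False
  have "J_upper n (n + 1 - a) a (g * X) = J_upper n (n + 1 - a) a X"
    by (rule J_upper_mult_left[OF X g]) (use a False unipotent_lower_zero[OF g] in auto)
  then show ?thesis using a False by (simp add: corner_minor_eq_J_upper)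
qed (simp add: corner_minor_0)

text \<open>For determinant 1 the adjugate is the inverse, so \<open>X\<close> and
  \<open>adj_mat X\<close> are conjugated alike. The common right factor acts on all columns at
  once. The left factor acts separately on the last rows of the two matrices, since an upper
  triangular matrix combines a row only with later ones.\<close>

lemma J_lower_conj:
  fixes g h :: "'a::field mat"
  assumes X: "X \<in> carrier_mat n n" "det X = 1" and g: "unipotent (\<le>) n g" and h: "unipotent (\<le>) n h"
    and gh: "g * h = 1\<^sub>m n" and pk: "p + k \<le> n"
  shows "J_lower n p k (h * X * g) = J_lower n p k X"
proof -
  have gc: "g \<in> carrier_mat n n" and hc: "h \<in> carrier_mat n n"
    using g h by (simp_all add: unipotent_def supported_def)
  have Xa: "adj_mat X \<in> carrier_mat n n" using adj_mat(1)[OF X(1)] .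
  have hg: "h * g = 1\<^sub>m n" by (rule mat_mult_left_right_inverse[OF gc hc gh])
  have adj: "adj_mat (h * X * g) = h * adj_mat X * g"
  proof (rule adj_mat_eq_inverse)
    have "h * X * g * (h * adj_mat X * g) = h * X * (g * (h * (adj_mat X * g)))"
      using X(1) gc hc Xa by (simp add: assoc_mult_mat[of _ n n _ n _ n])
    also have "g * (h * (adj_mat X * g)) = (g * h) * (adj_mat X * g)"
      using gc hc Xa by (intro assoc_mult_mat[symmetric]) auto
    also have "\<dots> = adj_mat X * g" using gh gc Xa by simp
    also have "h * X * (adj_mat X * g) = h * (X * (adj_mat X * g))"
      using X(1) gc hc Xa by (intro assoc_mult_mat) auto
    also have "X * (adj_mat X * g) = (X * adj_mat X) * g"
      using X(1) gc Xa by (intro assoc_mult_mat[symmetric]) auto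
    also have "X * adj_mat X = 1\<^sub>m n" using adj_mat(2)[OF X(1)] X(2) by auto
    finally show "h * X * g * (h * adj_mat X * g) = 1\<^sub>m n" using gc hc hg by simp
    show "det (h * X * g) = 1"
      using X gc hc det_unipotent[OF g] det_unipotent[OF h] by (simp add: det_mult[of _ n])
  qed (use X(1) gc hc Xa in auto)
  let ?j = "p + k"
  define F where "F Y Y' a t = (if a < p then Y $$ (n - p + a, t) else Y' $$ (n - k + (a - p), t))"
    for Y Y' :: "'a mat" and a t :: nat
  have J: "J_lower n p k Y = det (mat ?j ?j (\<lambda>(a, b). F Y (adj_mat Y) a b))" for Y
    by (simp add: J_lower_def F_def)
  \<comment> \<open>Block diagonal, made of the lower right corners of \<open>h\<close> of sizes
    \<open>p\<close> and \<open>k\<close>.\<close>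
  define V where "V a c = (if a < p \<and> c < p then h $$ (n - p + a, n - p + c)
    else if p \<le> a \<and> p \<le> c then h $$ (n - k + (a - p), n - k + (c - p)) else 0)" for a c
  let ?A = "h * X" and ?B = "h * adj_mat X"
  have AB: "?A \<in> carrier_mat n n" "?B \<in> carrier_mat n n" using hc X Xa by auto
  have "J_lower n p k (h * X * g) = det (mat ?j ?j (\<lambda>(a, b). \<Sum>t<n. F ?A ?B a t * g $$ (t, b)))"
    unfolding J adj
    by (rule arg_cong[where f = det], rule eq_matI)
      (use pk in \<open>auto simp: F_def index_mult_sum[OF AB(1) gc] index_mult_sum[OF AB(2) gc]
        simp del: index_mult_mat(1)\<close>)
  also have "\<dots> = det (mat ?j ?j (\<lambda>(a, b). F ?A ?B a b))"
    by (rule det_mult_right_unipotent[OF g pk])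
  also have "\<dots> = det (mat ?j ?j (\<lambda>(a, b). F X (adj_mat X) a b))"
  proof (rule det_mult_left_unitriangular[where U = V])
    have h0: "h $$ (s, t) = 0" if "s < n" "t < s" for s t
      using unipotent_lower_zero[OF h that] .
    fix a assume a: "a < ?j"
    show "V a a = 1"
      using a pk unipotent_diag[OF h] by (auto simp: V_def)
    show "V a c = 0" if "c < a" for c
      using a that pk by (auto simp: V_def intro!: h0)
    fix b assume b: "b < ?j"
    have split: "(\<Sum>c<?j. f c) = (\<Sum>c<p. f c) + (\<Sum>c<k. f (p + c))" for f :: "nat \<Rightarrow> 'a"
      by (induction k) (simp_all add: algebra_simps)
    show "F ?A ?B a b = (\<Sum>c<?j. V a c * F X (adj_mat X) c b)"
    proof (cases "a < p")
      case True
      have "F ?A ?B a b = (\<Sum>s<n. h $$ (n - p + a, s) * X $$ (s, b))"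
        using True pk b index_mult_sum[OF hc X(1), of "n - p + a" b] by (simp add: F_def)
      also have "\<dots> = (\<Sum>c<p. h $$ (n - p + a, n - p + c) * X $$ (n - p + c, b))"
        by (rule sum_tail) (use pk True h0 in auto)
      finally show ?thesis using True by (simp add: split F_def V_def)
    next
      case False
      have "F ?A ?B a b = (\<Sum>s<n. h $$ (n - k + (a - p), s) * adj_mat X $$ (s, b))"
        using False pk a b index_mult_sum[OF hc Xa, of "n - k + (a - p)" b] by (simp add: F_def)
      also have "\<dots> = (\<Sum>c<k. h $$ (n - k + (a - p), n - k + c) * adj_mat X $$ (n - k + c, b))"
        by (rule sum_tail) (use pk a False h0 in auto)
      finally show ?thesis using False by (simp add: split F_def V_def)
    qed
  qed
  finally show ?thesis unfolding J .
qed

section \<open>The section of the action\<close>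

text \<open>Indices start at 0: the antidiagonal is \<open>a + b = n - 1\<close>, and what vanishes
  lies strictly below it.\<close>

definition antitriangular :: "nat \<Rightarrow> 'a::zero mat \<Rightarrow> bool" where
  "antitriangular n W \<longleftrightarrow> W \<in> carrier_mat n n \<and> (\<forall>a<n. \<forall>b<n. n \<le> a + b \<longrightarrow> W $$ (a, b) = 0)"

lemma antitriangular_carrier: "antitriangular n W \<Longrightarrow> W \<in> carrier_mat n n"
  by (simp add: antitriangular_def)

lemma antitriangular_zero: "antitriangular n W \<Longrightarrow> a < n \<Longrightarrow> b < n \<Longrightarrow> n \<le> a + b \<Longrightarrow> W $$ (a, b) = 0"
  by (simp add: antitriangular_def)

lemma antitriangular_mult_left:
  fixes g W :: "'a::comm_ring_1 mat"
  assumes g: "unipotent (\<le>) n g" and W: "antitriangular n W"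
  shows "antitriangular n (g * W)"
  unfolding antitriangular_def
proof (intro conjI allI impI)
  note c = unipotent_carrier[OF g] antitriangular_carrier[OF W]
  show "g * W \<in> carrier_mat n n" using c by simp
  fix a b assume ab: "a < n" "b < n" "n \<le> a + b"
  have "g $$ (a, t) * W $$ (t, b) = 0" if "t < n" for t
  proof (cases "t < a")
    case True then show ?thesis using unipotent_lower_zero[OF g ab(1)] by simp
  next
    case False then show ?thesis using antitriangular_zero[OF W that ab(2)] ab by simp
  qed
  then show "(g * W) $$ (a, b) = 0" by (simp add: index_mult_sum[OF c ab(1,2)] del: index_mult_mat(1))
qed

text \<open>In the last column of the minor, all rows but the first lie strictly below the
  antidiagonal of \<open>W\<close>. Expanding along this column leaves one entry and the corner
  minor of size \<open>j - 1\<close>.\<close>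

lemma J_upper_antitriangular:
  fixes W :: "'a::comm_ring_1 mat"
  assumes W: "antitriangular n W" and ij: "1 \<le> i" "1 \<le> j" "i + j \<le> n + 1"
  shows "J_upper n i j W = (-1) ^ (j - 1) * W $$ (i - 1, j - 1) * corner_minor n (j - 1) W"
proof -
  let ?M = "mat j j (\<lambda>(a, b). W $$ (if a = 0 then i - 1 else n - j + a, b))"
  have "det ?M = (\<Sum>a<j. ?M $$ (a, j - 1) * cofactor ?M a (j - 1))"
    by (rule laplace_expansion_column) (use ij in auto)
  also have "\<dots> = (\<Sum>a<j. if a = 0 then W $$ (i - 1, j - 1) * cofactor ?M 0 (j - 1) else 0)"
  proof (rule sum.cong, simp)
    fix a assume "a \<in> {..<j}"
    then show "?M $$ (a, j - 1) * cofactor ?M a (j - 1) =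
        (if a = 0 then W $$ (i - 1, j - 1) * cofactor ?M 0 (j - 1) else 0)"
      using ij antitriangular_zero[OF W, of "n - j + a" "j - 1"] by auto
  qed
  also have "\<dots> = W $$ (i - 1, j - 1) * cofactor ?M 0 (j - 1)"
    using ij by simp
  also have "mat_delete ?M 0 (j - 1) = mat (j - 1) (j - 1) (\<lambda>(r, c). W $$ (n - (j - 1) + r, c))"
    by (rule eq_matI) (use ij in \<open>auto simp: mat_delete_def intro!: arg_cong2[where f = "\<lambda>x y. W $$ (x, y)"]\<close>)
  then have "cofactor ?M 0 (j - 1) = (-1) ^ (j - 1) * corner_minor n (j - 1) W"
    by (simp add: cofactor_def corner_minor_def)
  finally show ?thesis by (simp add: J_upper_def mult_ac)
qed

lemma corner_minor_antitriangular:
  fixes W :: "'a::comm_ring_1 mat"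
  assumes "antitriangular n W" "1 \<le> a" "a \<le> n"
  shows "corner_minor n a W = (-1) ^ (a - 1) * W $$ (n - a, a - 1) * corner_minor n (a - 1) W"
  using J_upper_antitriangular[OF assms(1), of "n + 1 - a" a] assms(2,3)
  by (simp add: corner_minor_eq_J_upper)

text \<open>The last \<open>p\<close> rows of \<open>Y\<close> vanish from column \<open>p\<close>
  on (counted from 0), so the matrix is block triangular with these two minors on its
  diagonal.\<close>

lemma J_lower_antitriangular:
  fixes Y :: "'a::idom mat"
  assumes Y: "antitriangular n Y" and pk: "p + k \<le> n"
  shows "J_lower n p k Y = corner_minor n p Y * shifted_minor n p k (\<lambda>r c. adj_mat Y $$ (r, c))"
proof -
  let ?A = "mat p p (\<lambda>(r, c). Y $$ (n - p + r, c))"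
  let ?C = "mat k p (\<lambda>(r, c). adj_mat Y $$ (n - k + r, c))"
  let ?D = "mat k k (\<lambda>(r, c). adj_mat Y $$ (n - k + r, p + c))"
  have "mat (p + k) (p + k) (\<lambda>(a, b). if a < p then Y $$ (n - p + a, b) else adj_mat Y $$ (n - k + (a - p), b))
      = four_block_mat ?A (0\<^sub>m p k) ?C ?D"
    by (rule eq_matI) (use pk in \<open>auto simp: not_less add.commute[of k p] intro!: antitriangular_zero[OF Y]\<close>)
  then show ?thesis
    unfolding J_lower_def corner_minor_def shifted_minor_def
    by (simp add: det_four_block_mat_upper_right_zero[of _ p _ k])
qed

text \<open>
  Reversing the columns of \<open>Y\<close> and the rows of its inverse \<open>Q\<close> turns them into mutually inverse
  upper triangular matrices.
\<close>

lemma inverse_antitriangular: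
  fixes Y Q :: "'a::field mat"
  assumes Y: "antitriangular n Y" and Q: "Q \<in> carrier_mat n n" and YQ: "Y * Q = 1\<^sub>m n"
    and nz: "\<And>a. a \<le> n \<Longrightarrow> corner_minor n a Y \<noteq> 0"
  shows "\<And>a b. a < n \<Longrightarrow> b < n \<Longrightarrow> a + b + 1 < n \<Longrightarrow> Q $$ (a, b) = 0"
    and "\<And>i. i < n \<Longrightarrow> Y $$ (i, n - 1 - i) * Q $$ (n - 1 - i, i) = 1"
proof -
  define B where "B = mat n n (\<lambda>(i, t). Y $$ (i, n - 1 - t))"
  define B' where "B' = mat n n (\<lambda>(t, j). Q $$ (n - 1 - t, j))"
  note Yc = antitriangular_carrier[OF Y]
  have c: "B \<in> carrier_mat n n" "B' \<in> carrier_mat n n" by (simp_all add: B_def B'_def)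
  have "B * B' = 1\<^sub>m n"
  proof (rule eq_matI)
    fix i j assume "i < dim_row (1\<^sub>m n :: 'a mat)" "j < dim_col (1\<^sub>m n :: 'a mat)"
    then have ij: "i < n" "j < n" by auto
    have "(B * B') $$ (i, j) = (\<Sum>t<n. Y $$ (i, n - 1 - t) * Q $$ (n - 1 - t, j))"
      by (subst index_mult_sum[OF c ij]) (use ij in \<open>simp add: B_def B'_def\<close>)
    also have "\<dots> = (\<Sum>s<n. Y $$ (i, s) * Q $$ (s, j))"
      by (rule sum.reindex_bij_witness[of _ "\<lambda>s. n - 1 - s" "\<lambda>t. n - 1 - t"]) auto
    also have "\<dots> = (Y * Q) $$ (i, j)" by (simp only: index_mult_sum[OF Yc Q ij])
    finally show "(B * B') $$ (i, j) = 1\<^sub>m n $$ (i, j)" using YQ by simp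
  qed (simp_all add: B_def B'_def)
  moreover have "supported (\<le>) n B"
    unfolding supported_def
  proof (intro conjI allI impI c)
    fix i j assume ij: "i < n" "j < n" and "B $$ (i, j) \<noteq> 0"
    then have "\<not> n \<le> i + (n - 1 - j)" using antitriangular_zero[OF Y, of i "n - 1 - j"] by (auto simp: B_def)
    then show "i \<le> j" using ij by auto
  qed
  moreover have "B $$ (i, i) \<noteq> 0" if "i < n" for i
    using corner_minor_antitriangular[OF Y, of "n - i"] nz[of "n - i"] that by (auto simp: B_def)
  moreover have "triangular_order (\<le>) n" by (auto simp: triangular_order_def)
  ultimately have B': "supported (\<le>) n B'" and d: "\<And>i. i < n \<Longrightarrow> B $$ (i, i) * B' $$ (i, i) = 1"
    using supported_inverse[of "(\<le>)" n B B'] c by blast+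
  show "Q $$ (a, b) = 0" if "a < n" "b < n" "a + b + 1 < n" for a b
  proof (rule ccontr)
    assume "Q $$ (a, b) \<noteq> 0"
    then have "B' $$ (n - 1 - a, b) \<noteq> 0" using that by (simp add: B'_def)
    then have "n - 1 - a \<le> b" using B' that by (simp add: supported_def)
    then show False using that by simp
  qed
  show "Y $$ (i, n - 1 - i) * Q $$ (n - 1 - i, i) = 1" if "i < n" for i
    using d[OF that] that by (simp add: B_def B'_def)
qed

section \<open>A triangular system for the entries of an inverse matrix\<close>

text \<open>Expansion along the first row isolates the entry in the upper right corner: its cofactor
  is the shifted minor of size \<open>k - 1\<close> up to sign, and the other summand does not
  contain it. So the minor determines this entry once the smaller minor is nonzero and the other
  entries are known.\<close>

lemma shifted_minor_corner:
  fixes q :: "nat \<Rightarrow> nat \<Rightarrow> 'a::comm_ring_1"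
  assumes "1 \<le> k" "k \<le> n"
  shows "shifted_minor n p k q = (-1) ^ (k - 1) * q (n - k) (p + k - 1) * shifted_minor n p (k - 1) q +
    det (mat k k (\<lambda>(a, b). if a = 0 \<and> b = k - 1 then 0 else q (n - k + a) (p + b)))"
proof -
  let ?M = "mat k k (\<lambda>(a, b). q (n - k + a) (p + b))"
  let ?N = "mat k k (\<lambda>(a, b). if a = 0 \<and> b = k - 1 then 0 else q (n - k + a) (p + b))"
  have cof: "cofactor ?M 0 b = cofactor ?N 0 b" if "b < k" for b
    unfolding cofactor_def
    by (intro arg_cong2[where f = "(*)"] refl arg_cong[where f = det] eq_matI)
      (auto simp: mat_delete_def)
  have "det ?M = (\<Sum>b<k. ?M $$ (0, b) * cofactor ?M 0 b)"
    by (rule laplace_expansion_row) (use assms in auto)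
  also have "\<dots> = (\<Sum>b<k. ?N $$ (0, b) * cofactor ?N 0 b +
      (if b = k - 1 then q (n - k) (p + k - 1) * cofactor ?M 0 (k - 1) else 0))"
    by (rule sum.cong) (use assms cof in auto)
  also have "\<dots> = det ?N + q (n - k) (p + k - 1) * cofactor ?M 0 (k - 1)"
    using assms laplace_expansion_row[of ?N k 0] by (simp add: sum.distrib)
  also have "mat_delete ?M 0 (k - 1) = mat (k - 1) (k - 1) (\<lambda>(a, b). q (n - (k - 1) + a) (p + b))"
    by (rule eq_matI) (use assms in \<open>auto simp: mat_delete_def intro!: arg_cong2[where f = q]\<close>)
  then have "cofactor ?M 0 (k - 1) = (-1) ^ (k - 1) * shifted_minor n p (k - 1) q"
    by (simp add: cofactor_def shifted_minor_def)
  finally show ?thesis by (simp add: shifted_minor_def mult_ac add_ac)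
qed

lemma shifted_minor_cong:
  assumes "\<And>a b. a < k \<Longrightarrow> b < k \<Longrightarrow> q (n - k + a) (p + b) = q' (n - k + a) (p + b)"
  shows "shifted_minor n p k q = shifted_minor n p k q'"
  unfolding shifted_minor_def
  by (rule arg_cong[where f = det], rule eq_matI) (use assms in auto)

text \<open>Equation \<open>i\<close> is solved by its own unknown \<open>x i\<close>, which does
  not affect the equations of smaller rank. In \<open>solve\<close> the earlier equations may be
  assumed, since solvability can depend on them. Induction on \<open>N\<close> treats one rank at a
  time; injectivity of \<open>rank\<close> leaves at most one equation per step.\<close>

lemma triangular_system_solvable:
  fixes rank :: "'i \<Rightarrow> nat" and \<Phi> :: "'i \<Rightarrow> ('i \<Rightarrow> 'a) \<Rightarrow> 'b"
  assumes inj: "inj_on rank A"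
    and solve: "\<And>i x. i \<in> A \<Longrightarrow> (\<And>s. s \<in> A \<Longrightarrow> rank s < rank i \<Longrightarrow> \<Phi> s x = \<tau> s) \<Longrightarrow>
      \<exists>y. \<Phi> i (x(i := y)) = \<tau> i"
    and indep: "\<And>i s x y. i \<in> A \<Longrightarrow> s \<in> A \<Longrightarrow> rank s < rank i \<Longrightarrow> \<Phi> s (x(i := y)) = \<Phi> s x"
  shows "\<exists>x. \<forall>i\<in>A. rank i < N \<longrightarrow> \<Phi> i x = \<tau> i"
proof (induction N)
  case (Suc N)
  then obtain x where x: "\<And>i. i \<in> A \<Longrightarrow> rank i < N \<Longrightarrow> \<Phi> i x = \<tau> i" by blast
  show ?case
  proof (cases "\<exists>i\<in>A. rank i = N")
    case True
    then obtain i where i: "i \<in> A" "rank i = N" by blast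
    then obtain y where y: "\<Phi> i (x(i := y)) = \<tau> i" using solve[of i x] x by auto
    have "\<Phi> s (x(i := y)) = \<tau> s" if s: "s \<in> A" "rank s < Suc N" for s
    proof (cases "s = i")
      case False
      then have "rank s < N" using inj i s by (metis inj_onD less_antisym)
      then show ?thesis using indep[OF i(1) s(1)] x s(1) i(2) by simp
    qed (use y in simp)
    then show ?thesis by blast
  next
    case False
    then show ?thesis using x less_antisym by blast
  qed
qed simp

text \<open>The unknown with index \<open>(k, p)\<close> is the entry in row \<open>n - k\<close>
  and column \<open>p + k - 1\<close>, the upper right corner of the shifted minor with the same
  index. By \<open>shifted_minor_corner\<close> the system is triangular in the lexicographic order
  of \<open>(k, p)\<close>; the coefficient of the unknown is, up to sign, the minor for
  \<open>(k - 1, p)\<close>, which is nonzero by prescription.\<close>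

lemma shifted_minors_prescribed:
  fixes \<alpha> :: "nat \<Rightarrow> 'a::field" and \<mu> :: "nat \<Rightarrow> nat \<Rightarrow> 'a"
  assumes nz: "\<And>p k. 1 \<le> p \<Longrightarrow> 1 \<le> k \<Longrightarrow> p + k \<le> n \<Longrightarrow> \<mu> p k \<noteq> 0"
  obtains q where "\<And>r c. r + c + 1 < n \<Longrightarrow> q r c = 0" "\<And>r c. r + c + 1 = n \<Longrightarrow> q r c = \<alpha> r"
    "\<And>p k. 1 \<le> p \<Longrightarrow> 1 \<le> k \<Longrightarrow> p + k \<le> n \<Longrightarrow> shifted_minor n p k q = \<mu> p k"
proof -
  define A where "A = {(k, p). 1 \<le> p \<and> 1 \<le> k \<and> p + k \<le> n}"
  \<comment> \<open>On \<open>A\<close> one has \<open>p < n\<close>, so this encodes the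
    lexicographic order.\<close>
  define rank where "rank = (\<lambda>(k, p). k * n + p)"
  \<comment> \<open>Below the antidiagonal, \<open>(n - r, r + c + 1 - n)\<close> inverts the
    passage from \<open>(k, p)\<close> to \<open>(n - k, p + k - 1)\<close>; the other entries are
    fixed in advance.\<close>
  define q where "q x r c = (if r + c + 1 < n then 0 else if r + c + 1 = n then \<alpha> r
    else x (n - r, r + c + 1 - n))" for x :: "nat \<times> nat \<Rightarrow> 'a" and r c :: nat
  define \<Phi> where "\<Phi> = (\<lambda>(k, p) x. shifted_minor n p k (q x))"
  have rank_less: "rank (k, p) < rank (k', p') \<longleftrightarrow> k < k' \<or> k = k' \<and> p < p'"
    if "(k, p) \<in> A" "(k', p') \<in> A" for k p k' p'
  proof -
    have lt: "k * n + p < k' * n + p'" if "p < n" "k < k'" for k p k' p'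
    proof -
      have "k * n + p < Suc k * n" using that by simp
      also have "\<dots> \<le> k' * n" using that by (intro mult_le_mono1) simp
      finally show ?thesis by simp
    qed
    show ?thesis using that lt[of p k k' p'] lt[of p' k' k p]
      by (cases k k' rule: linorder_cases) (auto simp: A_def rank_def)
  qed
  have "\<exists>x. \<forall>i\<in>A. rank i < Suc (n * n + n) \<longrightarrow> \<Phi> i x = (\<lambda>(k, p). \<mu> p k) i"
  proof (rule triangular_system_solvable)
    show "inj_on rank A"
    proof (rule inj_onI)
      fix s t assume "s \<in> A" "t \<in> A" "rank s = rank t"
      then show "s = t" using rank_less[of "fst s" "snd s" "fst t" "snd t"]
          rank_less[of "fst t" "snd t" "fst s" "snd s"] by (auto simp: prod_eq_iff)
    qed
  next
    fix i s :: "nat \<times> nat" and x y assume hyp: "i \<in> A" "s \<in> A" "rank s < rank i"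
    obtain k p k' p' where e: "i = (k, p)" "s = (k', p')" by (cases i, cases s)
    have less: "k' < k \<or> k' = k \<and> p' < p" using hyp rank_less e by blast
    show "\<Phi> s (x(i := y)) = \<Phi> s x"
      unfolding \<Phi>_def e prod.case
    proof (rule shifted_minor_cong)
      \<comment> \<open>The changed entry lies above the rows of the minor if \<open>k' < k\<close>,
        and to the right of its columns if \<open>k' = k\<close> and \<open>p' < p\<close>.\<close>
      fix a b assume "a < k'" "b < k'"
      then show "q (x((k, p) := y)) (n - k' + a) (p' + b) = q x (n - k' + a) (p' + b)"
        using less hyp by (auto simp: q_def e A_def)
    qed
  next
    fix i :: "nat \<times> nat" and x
    assume i: "i \<in> A" and IH: "\<And>s. s \<in> A \<Longrightarrow> rank s < rank i \<Longrightarrow> \<Phi> s x = (\<lambda>(k, p). \<mu> p k) s"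
    obtain k p where e: "i = (k, p)" by (cases i)
    have kp: "1 \<le> p" "1 \<le> k" "p + k \<le> n" using i by (auto simp: e A_def)
    define R where "R = det (mat k k (\<lambda>(a, b). if a = 0 \<and> b = k - 1 then 0 else q x (n - k + a) (p + b)))"
    define m where "m = shifted_minor n p (k - 1) (q x)"
    have m: "m \<noteq> 0"
    proof (cases "k = 1")
      case False
      then have "(k - 1, p) \<in> A" using kp by (auto simp: A_def)
      then have "\<Phi> (k - 1, p) x = \<mu> p (k - 1)"
        using IH[of "(k - 1, p)"] rank_less[of "k - 1" p k p] i kp by (simp add: e)
      then show ?thesis using nz[of p "k - 1"] kp False by (simp add: \<Phi>_def m_def)
    qed (simp add: m_def shifted_minor_def)
    have "\<Phi> i (x(i := y)) = (-1) ^ (k - 1) * y * m + R" for y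
    proof -
      let ?q = "q (x((k, p) := y))"
      have same: "?q (n - k + a) (p + b) = q x (n - k + a) (p + b)" if "a < k" "b < k" "\<not> (a = 0 \<and> b = k - 1)" for a b
        using that kp by (auto simp: q_def)
      have "shifted_minor n p (k - 1) ?q = m"
        unfolding m_def
      proof (rule shifted_minor_cong)
        fix a b assume "a < k - 1" "b < k - 1"
        then show "?q (n - (k - 1) + a) (p + b) = q x (n - (k - 1) + a) (p + b)"
          using same[of "Suc a" b] kp by (simp add: Suc_diff_le)
      qed
      moreover have "?q (n - k) (p + k - 1) = y" using kp by (auto simp: q_def)
      moreover have "mat k k (\<lambda>(a, b). if a = 0 \<and> b = k - 1 then 0 else ?q (n - k + a) (p + b))
          = mat k k (\<lambda>(a, b). if a = 0 \<and> b = k - 1 then 0 else q x (n - k + a) (p + b))"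
        by (rule eq_matI) (use same in auto)
      ultimately show ?thesis
        using shifted_minor_corner[of k n p ?q] kp by (simp add: \<Phi>_def e R_def)
    qed
    \<comment> \<open>The sign is its own inverse, so it may stand in the numerator.\<close>
    then have "\<Phi> i (x(i := (-1) ^ (k - 1) * (\<mu> p k - R) / m)) = \<mu> p k"
      using m by (simp add: field_simps flip: power_mult_distrib)
    then show "\<exists>y. \<Phi> i (x(i := y)) = (\<lambda>(k, p). \<mu> p k) i" by (auto simp: e)
  qed
  then obtain x where x: "\<And>i. i \<in> A \<Longrightarrow> rank i < Suc (n * n + n) \<Longrightarrow> \<Phi> i x = (\<lambda>(k, p). \<mu> p k) i" by blast
  show ?thesis
  proof (rule that[of "q x"])
    fix p k assume pk: "1 \<le> p" "1 \<le> k" "p + k \<le> n"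
    have "k * n \<le> n * n" using pk by (intro mult_le_mono1) simp
    then have "rank (k, p) < Suc (n * n + n)" unfolding rank_def prod.case using pk by linarith
    then show "shifted_minor n p k (q x) = \<mu> p k"
      using x[of "(k, p)"] pk by (simp add: A_def \<Phi>_def)
  qed (auto simp: q_def)
qed

subsection \<open>Existence of the section and surjectivity of the minors\<close>

text \<open>The open Bruhat cell. Column \<open>c\<close> of \<open>X * T\<close> has to vanish in
  its last \<open>c\<close> rows; these are \<open>c\<close> equations for the \<open>c\<close>
  entries of \<open>T\<close> above the diagonal in column \<open>c\<close>, and their matrix is the
  lower left corner of size \<open>c\<close>, invertible by \<open>nz\<close>.\<close>

lemma antitriangularizing_unipotent:
  fixes X :: "'a::field mat"
  assumes X: "X \<in> carrier_mat n n" and nz: "\<And>a. a \<le> n \<Longrightarrow> corner_minor n a X \<noteq> 0"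
  obtains T where "unipotent (\<le>) n T" "antitriangular n (X * T)"
proof -
  have "\<exists>t. \<forall>q<c. (\<Sum>a<c. X $$ (n - c + q, a) * t a) = - X $$ (n - c + q, c)" if c: "c < n" for c
  proof -
    let ?A = "mat c c (\<lambda>(r, a). X $$ (n - c + r, a))"
    have A: "?A \<in> carrier_mat c c" by simp
    have "det ?A \<noteq> 0" using nz[of c] c by (simp add: corner_minor_def)
    then obtain B where B: "B \<in> carrier_mat c c" "?A * B = 1\<^sub>m c" by (rule right_inverse_exists[OF A])
    define y where "y = vec c (\<lambda>q. - X $$ (n - c + q, c))"
    have "?A *\<^sub>v (B *\<^sub>v y) = ?A * B *\<^sub>v y"
      using A B by (intro assoc_mult_mat_vec[symmetric]) (auto simp: y_def)
    then have sol: "?A *\<^sub>v (B *\<^sub>v y) = y" using B by (simp add: y_def)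
    have "(\<Sum>a<c. X $$ (n - c + q, a) * (B *\<^sub>v y) $ a) = - X $$ (n - c + q, c)" if "q < c" for q
    proof -
      have "(?A *\<^sub>v (B *\<^sub>v y)) $ q = (\<Sum>a<c. X $$ (n - c + q, a) * (B *\<^sub>v y) $ a)"
        using that B(1) by (simp add: scalar_prod_def atLeast0LessThan)
      then show ?thesis unfolding sol using that by (simp add: y_def)
    qed
    then show ?thesis by blast
  qed
  note ex = this
  define t where "t c = (SOME t. \<forall>q<c. (\<Sum>a<c. X $$ (n - c + q, a) * t a) = - X $$ (n - c + q, c))" for c
  have t: "(\<Sum>a<c. X $$ (n - c + q, a) * t c a) = - X $$ (n - c + q, c)" if "c < n" "q < c" for c q
    using someI_ex[OF ex[OF that(1)]] that(2) unfolding t_def by blast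
  define T where "T = mat n n (\<lambda>(a, c). if a = c then 1 else if a < c then t c a else 0)"
  have Tc: "T \<in> carrier_mat n n" by (simp add: T_def)
  show ?thesis
  proof (rule that[of T])
    show "unipotent (\<le>) n T" by (auto simp: unipotent_def supported_def T_def)
    show "antitriangular n (X * T)"
      unfolding antitriangular_def
    proof (intro conjI allI impI)
      fix r c assume rc: "r < n" "c < n" "n \<le> r + c"
      have "(X * T) $$ (r, c) = (\<Sum>a<n. X $$ (r, a) * T $$ (a, c))"
        by (rule index_mult_sum[OF X Tc rc(1,2)])
      also have "\<dots> = (\<Sum>a<Suc c. X $$ (r, a) * T $$ (a, c))"
        by (rule sum.mono_neutral_right) (use rc in \<open>auto simp: T_def\<close>)
      also have "\<dots> = (\<Sum>a<c. X $$ (r, a) * t c a) + X $$ (r, c)"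
        using rc by (simp add: T_def)
      also have "(\<Sum>a<c. X $$ (r, a) * t c a) = - X $$ (r, c)"
        using t[of c "r - (n - c)"] rc by simp
      finally show "(X * T) $$ (r, c) = 0" by simp
    qed (use X Tc in simp)
  qed
qed

section \<open>Block structure and the index set\<close>

text \<open>The partition is encoded by a monotone map on indices starting at 0:
  \<open>blk i\<close> is the number of the segment containing \<open>i + 1\<close>.\<close>

locale index_blocks =
  fixes n :: nat and blk :: "nat \<Rightarrow> nat"
  assumes n: "1 \<le> n" and mono: "i \<le> j \<Longrightarrow> j < n \<Longrightarrow> blk i \<le> blk j"
begin

definition below :: "nat \<Rightarrow> nat \<Rightarrow> bool" where
  "below i j \<longleftrightarrow> i = j \<or> blk i < blk j"

definition inside :: "nat \<Rightarrow> nat \<Rightarrow> bool" where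
  "inside i j \<longleftrightarrow> i \<le> j \<and> blk i = blk j"

text \<open>\<open>n - j\<close> is \<open>mirror n j - 1\<close>, the mirror image of
  \<open>j\<close> counted from 0.\<close>

definition S :: "(nat \<times> nat) set" where
  "S = {(i, j). 1 \<le> i \<and> i \<le> n \<and> 1 \<le> j \<and> j \<le> n \<and> blk (n - j) \<le> blk (i - 1)}"

lemma below_le: "i < n \<Longrightarrow> j < n \<Longrightarrow> below i j \<Longrightarrow> i \<le> j"
  using mono[of j i] by (auto simp: below_def) (metis nat_le_linear not_less)

lemma triangular_order_below: "triangular_order below n"
  using below_le by (fastforce simp: triangular_order_def below_def)

lemma triangular_order_inside: "triangular_order inside n"
  by (auto simp: triangular_order_def inside_def)

lemma unipotent_below: "unipotent below n g \<Longrightarrow> unipotent (\<le>) n g"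
  by (erule unipotent_mono) (rule below_le)

lemma unipotent_inside: "unipotent inside n g \<Longrightarrow> unipotent (\<le>) n g"
  by (erule unipotent_mono) (simp add: inside_def)

lemma lower_in_S:
  assumes "1 \<le> p" "p + k \<le> n"
  shows "1 \<le> k \<Longrightarrow> (n + 1 - p, p + k) \<in> S" "(n + 1 - p, p) \<in> S"
  using assms mono[of "n - (p + k)" "n - p"] by (auto simp: S_def)

text \<open>On or above the antidiagonal one has \<open>i - 1 \<le> n - j\<close>, so monotonicity
  of \<open>blk\<close> gives the inequality opposite to the one in \<open>S\<close>, and the two
  blocks coincide. Strictly below it, \<open>p\<close> and \<open>k\<close> are the parameters of
  \<open>J_lower\<close>.\<close>

lemma S_cases:
  assumes "(i, j) \<in> S"
  obtains (upper) "1 \<le> i" "1 \<le> j" "i + j \<le> n + 1" "blk (i - 1) = blk (n - j)"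
  | (lower) p k where "1 \<le> p" "1 \<le> k" "p + k \<le> n" "i = n + 1 - p" "j = p + k"
proof (cases "i + j \<le> n + 1")
  case True
  then show ?thesis using assms mono[of "i - 1" "n - j"] by (intro upper) (auto simp: S_def)
next
  case False
  then show ?thesis using assms by (intro lower[of "n + 1 - i" "i + j - (n + 1)"]) (auto simp: S_def)
qed

text \<open>In the upper case, row \<open>i - 1\<close> of \<open>h\<close> has off-diagonal entries
  only in columns of later blocks, while the columns up to \<open>n - j\<close> belong to the block
  of \<open>i - 1\<close> or to earlier ones; this is the row condition of
  \<open>J_upper_mult_left\<close>. The lower case holds for all unipotent upper triangular
  matrices.\<close>

lemma J_val_conj_invariant:
  fixes g h X :: "'a::field mat"
  assumes X: "X \<in> carrier_mat n n" "det X = 1" and g: "unipotent below n g" and h: "unipotent below n h"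
    and gh: "g * h = 1\<^sub>m n" and ij: "(i, j) \<in> S"
  shows "J_val n i j (h * X * g) = J_val n i j X"
  using ij
proof (cases rule: S_cases)
  case upper
  have hX: "h * X \<in> carrier_mat n n" using X unipotent_carrier[OF h] by simp
  have "J_upper n i j (h * X * g) = J_upper n i j (h * X)"
    by (rule J_upper_mult_right[OF hX unipotent_below[OF g]]) (use upper in auto)
  also have "\<dots> = J_upper n i j X"
  proof (rule J_upper_mult_left[OF X(1) unipotent_below[OF h] upper(1-3)])
    fix s assume s: "s < n" "s \<noteq> i - 1" "s \<le> n - j"
    show "h $$ (i - 1, s) = 0"
    proof (rule ccontr)
      assume "h $$ (i - 1, s) \<noteq> 0"
      then have "below (i - 1) s" using h s upper by (simp add: unipotent_def supported_def)
      then have "blk (i - 1) < blk s" using s by (simp add: below_def)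
      also have "\<dots> \<le> blk (n - j)" using s upper by (intro mono) auto
      finally show False using upper by simp
    qed
  qed
  finally show ?thesis using upper by (simp add: J_val_eq_upper)
next
  case (lower p k)
  show ?thesis
    unfolding lower(4,5) J_val_eq_lower[OF lower(1-3)]
    by (rule J_lower_conj[OF X unipotent_below[OF g] unipotent_below[OF h] gh lower(3)])
qed

text \<open>The conjugates \<open>P Y P\<inverse>\<close> with \<open>P\<close> in the unipotent part of the Levi subgroup form the section.\<close>

lemma J_on_section:
  fixes P Y v :: "'a::field mat"
  assumes P: "unipotent inside n P" and v: "v \<in> carrier_mat n n" and Pv: "P * v = 1\<^sub>m n"
    and Y: "antitriangular n Y" "det Y = 1"
  shows "\<And>a. a \<le> n \<Longrightarrow> corner_minor n a (P * Y * v) = corner_minor n a Y"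
    and "\<And>i j. 1 \<le> i \<Longrightarrow> 1 \<le> j \<Longrightarrow> i + j \<le> n + 1 \<Longrightarrow>
      J_upper n i j (P * Y * v) = (-1) ^ (j - 1) * (P * Y) $$ (i - 1, j - 1) * corner_minor n (j - 1) Y"
    and "\<And>p k. p + k \<le> n \<Longrightarrow>
      J_lower n p k (P * Y * v) = corner_minor n p Y * shifted_minor n p k (\<lambda>r c. adj_mat Y $$ (r, c))"
proof -
  note P' = unipotent_inside[OF P]
  have v': "unipotent (\<le>) n v"
    by (rule unipotent_inside, rule unipotent_inverse[OF P v Pv triangular_order_inside])
  have Yc: "Y \<in> carrier_mat n n" using Y by (simp add: antitriangular_carrier)
  have PY: "antitriangular n (P * Y)" by (rule antitriangular_mult_left[OF P' Y(1)])
  note PYc = antitriangular_carrier[OF PY]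
  show "corner_minor n a (P * Y * v) = corner_minor n a Y" if "a \<le> n" for a
    using corner_minor_mult_right[OF PYc v' that] corner_minor_mult_left[OF Yc P' that] by simp
  show "J_upper n i j (P * Y * v) = (-1) ^ (j - 1) * (P * Y) $$ (i - 1, j - 1) * corner_minor n (j - 1) Y"
    if "1 \<le> i" "1 \<le> j" "i + j \<le> n + 1" for i j
    using J_upper_mult_right[OF PYc v', of i j] J_upper_antitriangular[OF PY that]
      corner_minor_mult_left[OF Yc P', of "j - 1"] that by simp
  \<comment> \<open>\<open>J_lower\<close> is invariant under conjugation by the whole unipotent
    upper triangular group, in particular by \<open>P\<close>, which therefore drops out
    here.\<close>
  have vP: "v * P = 1\<^sub>m n" by (rule mat_mult_left_right_inverse[OF unipotent_carrier[OF P] v Pv])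
  show "J_lower n p k (P * Y * v) = corner_minor n p Y * shifted_minor n p k (\<lambda>r c. adj_mat Y $$ (r, c))"
    if "p + k \<le> n" for p k
    using J_lower_conj[OF Yc Y(2) v' P' vP that] J_lower_antitriangular[OF Y(1) that] by simp
qed

text \<open>\<open>P\<close> is the block diagonal part of \<open>T\<close>, so
  \<open>g = T * P\<inverse>\<close> has identity matrices as diagonal blocks and lies in
  \<open>U\<close>. Then \<open>h * X * g\<close> is \<open>W * P\<inverse>\<close> with
  \<open>W = h * X * T\<close>, which remains antitriangular, and \<open>Y\<close> is
  \<open>P\<inverse> * W\<close>.\<close>

lemma section_exists:
  fixes X :: "'a::field mat"
  assumes X: "X \<in> carrier_mat n n" "det X = 1" and nz: "\<And>a. a \<le> n \<Longrightarrow> corner_minor n a X \<noteq> 0"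
  obtains g h P Y v where "unipotent below n g" "unipotent below n h" "g * h = 1\<^sub>m n"
    "unipotent inside n P" "v \<in> carrier_mat n n" "P * v = 1\<^sub>m n"
    "antitriangular n Y" "det Y = 1" "h * X * g = P * Y * v"
proof -
  obtain T where T: "unipotent (\<le>) n T" "antitriangular n (X * T)"
    using antitriangularizing_unipotent[OF X(1) nz] by blast
  note Tc = unipotent_carrier[OF T(1)]
  define P where "P = mat n n (\<lambda>(i, j). if blk i = blk j then T $$ (i, j) else 0)"
  have P: "unipotent inside n P"
    using T(1) unipotent_diag[OF T(1)]
    by (auto simp: unipotent_def supported_def P_def inside_def split: if_splits)
  note Pc = unipotent_carrier[OF P]
  obtain v where v: "v \<in> carrier_mat n n" "P * v = 1\<^sub>m n"
    using right_inverse_exists[OF Pc] det_unipotent[OF unipotent_inside[OF P]] by auto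
  have vi: "unipotent inside n v" by (rule unipotent_inverse[OF P v triangular_order_inside])
  define g where "g = T * v"
  have g_le: "unipotent (\<le>) n g" unfolding g_def by (rule unipotent_mult[OF T(1) unipotent_inside[OF vi]])
  note gc = unipotent_carrier[OF g_le]
  have g: "unipotent below n g"
    unfolding unipotent_def supported_def
  proof (intro conjI allI impI gc)
    fix i j assume ij: "i < n" "j < n" and gij: "g $$ (i, j) \<noteq> 0"
    have le: "i \<le> j" using gij unipotent_lower_zero[OF g_le ij(1)] by (meson not_less)
    show "below i j"
    proof (cases "blk i = blk j")
      case True
      have "g $$ (i, j) = (\<Sum>t<n. T $$ (i, t) * v $$ (t, j))"
        unfolding g_def by (rule index_mult_sum[OF Tc v(1) ij])
      \<comment> \<open>Column \<open>j\<close> of \<open>v\<close> is supported in the block of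
        \<open>j\<close>, which is also that of \<open>i\<close>; there \<open>T\<close> and
        \<open>P\<close> agree.\<close>
      also have "\<dots> = (\<Sum>t<n. P $$ (i, t) * v $$ (t, j))"
      proof (rule sum.cong, simp)
        fix t assume t: "t \<in> {..<n}"
        show "T $$ (i, t) * v $$ (t, j) = P $$ (i, t) * v $$ (t, j)"
        proof (cases "v $$ (t, j) = 0")
          case False
          then have "inside t j" using vi t ij by (simp add: unipotent_def supported_def)
          then show ?thesis using True t ij by (simp add: P_def inside_def)
        qed simp
      qed
      also have "\<dots> = (P * v) $$ (i, j)" by (simp only: index_mult_sum[OF Pc v(1) ij])
      finally show ?thesis using gij v(2) ij by (auto simp: below_def split: if_splits)
    next
      case False
      then show ?thesis using mono[OF le ij(2)] by (simp add: below_def)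
    qed
  qed (rule unipotent_diag[OF g_le])
  obtain h where h: "h \<in> carrier_mat n n" "g * h = 1\<^sub>m n"
    using right_inverse_exists[OF gc] det_unipotent[OF g_le] by auto
  have hb: "unipotent below n h" by (rule unipotent_inverse[OF g h triangular_order_below])
  define W where "W = h * (X * T)"
  have W: "antitriangular n W"
    unfolding W_def by (rule antitriangular_mult_left[OF unipotent_below[OF hb] T(2)])
  note Wc = antitriangular_carrier[OF W]
  define Y where "Y = v * W"
  have Y: "antitriangular n Y"
    unfolding Y_def by (rule antitriangular_mult_left[OF unipotent_inside[OF vi] W])
  have "P * Y = (P * v) * W"
    unfolding Y_def using Pc v(1) Wc by (intro assoc_mult_mat[symmetric]) auto
  then have PY: "P * Y = W" using v(2) Wc by simp
  have "det W = 1"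
    using det_unipotent[OF unipotent_below[OF hb]] det_unipotent[OF T(1)] X h(1) Tc
    by (simp add: W_def det_mult[of _ n])
  then have dY: "det Y = 1"
    using det_unipotent[OF unipotent_inside[OF vi]] v(1) Wc by (simp add: Y_def det_mult[of _ n])
  have "h * X * g = h * (X * T) * v"
    unfolding g_def using h(1) X(1) Tc v(1) by (simp add: assoc_mult_mat[of _ n n _ n _ n])
  then have "h * X * g = P * Y * v" by (simp add: PY W_def)
  then show ?thesis using that g hb h(2) P v Y dY by blast
qed

text \<open>The formulas of \<open>J_on_section\<close> are solved backwards. The antidiagonal
  targets fix the corner minors \<open>D\<close> and with them the antidiagonal entries
  \<open>w\<close> of \<open>Y\<close>; the targets below give \<open>Q = Y\<inverse>\<close> by
  \<open>shifted_minors_prescribed\<close>; the targets on or above the antidiagonal give entries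
  \<open>\<omega>\<close> of \<open>P * Y\<close>, and \<open>P\<close> is recovered as the block
  diagonal part of \<open>\<omega> * Q\<close>.\<close>

lemma J_surjective:
  fixes \<tau> :: "nat \<times> nat \<Rightarrow> 'a::field"
  assumes nz: "\<And>s. s \<in> S \<Longrightarrow> \<tau> s \<noteq> 0" and one: "\<tau> (1, n) = 1"
  obtains Z where "Z \<in> carrier_mat n n" "det Z = 1" "\<forall>i j. (i, j) \<in> S \<longrightarrow> J_val n i j Z = \<tau> (i, j)"
proof -
  define D where "D a = (if a = 0 then 1 else \<tau> (n + 1 - a, a))" for a
  have D: "D a \<noteq> 0" if "a \<le> n" for a
    using that nz lower_in_S(2)[of a 0] by (auto simp: D_def)
  have D0: "D 0 = 1" and Dn: "D n = 1" using one n by (simp_all add: D_def)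
  \<comment> \<open>Forced by \<open>corner_minor_antitriangular\<close>, which reads
    \<open>D a = (-1) ^ (a - 1) * w a * D (a - 1)\<close>.\<close>
  define w where "w a = (-1) ^ (a - 1) * D a / D (a - 1)" for a
  have w: "w a \<noteq> 0" if "1 \<le> a" "a \<le> n" for a
    using that D[of a] D[of "a - 1"] by (simp add: w_def)
  have \<mu>: "\<tau> (n + 1 - p, p + k) / D p \<noteq> 0" if "1 \<le> p" "1 \<le> k" "p + k \<le> n" for p k
    using that nz lower_in_S(1)[of p k] D[of p] by auto
  obtain q where q: "\<And>r c. r + c + 1 < n \<Longrightarrow> q r c = 0" "\<And>r c. r + c + 1 = n \<Longrightarrow> q r c = 1 / w (r + 1)"
    "\<And>p k. 1 \<le> p \<Longrightarrow> 1 \<le> k \<Longrightarrow> p + k \<le> n \<Longrightarrow> shifted_minor n p k q = \<tau> (n + 1 - p, p + k) / D p"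
    using shifted_minors_prescribed[where \<mu> = "\<lambda>p k. \<tau> (n + 1 - p, p + k) / D p"
        and \<alpha> = "\<lambda>r. 1 / w (r + 1)", OF \<mu>] by blast
  define Q where "Q = mat n n (\<lambda>(r, c). q r c)"
  \<comment> \<open>\<open>Q\<close> with its rows reversed is upper triangular; the inverse of this
    matrix, with its columns reversed, will be \<open>Y\<close>.\<close>
  define B' where "B' = mat n n (\<lambda>(t, j). q (n - 1 - t) j)"
  have c: "Q \<in> carrier_mat n n" "B' \<in> carrier_mat n n" by (simp_all add: Q_def B'_def)
  have B'diag: "B' $$ (t, t) = 1 / w (n - t)" if "t < n" for t
    using that q(2)[of "n - 1 - t" t] by (simp add: B'_def Suc_diff_Suc)
  have B'0: "B' $$ (t, j) = 0" if "t < n" "j < t" for t j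
    using that q(1)[of "n - 1 - t" j] by (simp add: B'_def)
  have B'nz: "B' $$ (t, t) \<noteq> 0" if "t < n" for t
    using B'diag[OF that] w[of "n - t"] that by simp
  have "det B' = prod_list (diag_mat B')"
    by (rule det_upper_triangular[of _ n]) (use c B'0 in auto)
  also have "\<dots> \<noteq> 0" using B'nz c by (auto simp: diag_mat_def prod_list_zero_iff)
  finally obtain B where B: "B \<in> carrier_mat n n" "B' * B = 1\<^sub>m n"
    using right_inverse_exists[OF c(2)] by blast
  have B'sup: "supported (\<le>) n B'"
    unfolding supported_def using c(2) B'0 by (meson not_less)
  have ord: "triangular_order (\<le>) n" by (auto simp: triangular_order_def)
  have Bsup: "supported (\<le>) n B" and Bdiag: "\<And>i. i < n \<Longrightarrow> B' $$ (i, i) * B $$ (i, i) = 1"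
    by (rule supported_inverse[OF B'sup B B'nz ord], assumption)+
  have BB': "B * B' = 1\<^sub>m n" by (rule mat_mult_left_right_inverse[OF c(2) B])
  define Y where "Y = mat n n (\<lambda>(i, s). B $$ (i, n - 1 - s))"
  have Yc: "Y \<in> carrier_mat n n" by (simp add: Y_def)
  have Y: "antitriangular n Y"
    unfolding antitriangular_def
  proof (intro conjI allI impI Yc)
    fix a b assume ab: "a < n" "b < n" "n \<le> a + b"
    have "B $$ (a, n - 1 - b) = 0"
    proof (rule ccontr)
      assume "B $$ (a, n - 1 - b) \<noteq> 0"
      then have "a \<le> n - 1 - b" using Bsup ab by (simp add: supported_def)
      then show False using ab by simp
    qed
    then show "Y $$ (a, b) = 0" using ab by (simp add: Y_def)
  qed
  have YQ: "Y * Q = 1\<^sub>m n"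
  proof (rule eq_matI)
    fix i j assume "i < dim_row (1\<^sub>m n :: 'a mat)" "j < dim_col (1\<^sub>m n :: 'a mat)"
    then have ij: "i < n" "j < n" by auto
    have "(Y * Q) $$ (i, j) = (\<Sum>s<n. B $$ (i, n - 1 - s) * q s j)"
      by (subst index_mult_sum[OF Yc c(1) ij]) (use ij in \<open>simp add: Y_def Q_def\<close>)
    also have "\<dots> = (\<Sum>t<n. B $$ (i, t) * q (n - 1 - t) j)"
      by (rule sum.reindex_bij_witness[of _ "\<lambda>t. n - 1 - t" "\<lambda>s. n - 1 - s"]) auto
    also have "\<dots> = (B * B') $$ (i, j)"
      by (subst index_mult_sum[OF B(1) c(2) ij]) (use ij in \<open>simp add: B'_def\<close>)
    finally show "(Y * Q) $$ (i, j) = 1\<^sub>m n $$ (i, j)" using BB' by simp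
  qed (use Yc c in auto)
  have QY: "Q * Y = 1\<^sub>m n" by (rule mat_mult_left_right_inverse[OF Yc c(1) YQ])
  have Yanti: "Y $$ (n - a, a - 1) = w a" if "1 \<le> a" "a \<le> n" for a
    using Bdiag[of "n - a"] B'diag[of "n - a"] w[OF that] that by (simp add: Y_def field_simps)
  have cm: "corner_minor n a Y = D a" if "a \<le> n" for a
    using that
  proof (induction a)
    case (Suc a)
    then have "corner_minor n (Suc a) Y = (-1) ^ a * w (Suc a) * D a"
      using corner_minor_antitriangular[OF Y, of "Suc a"] Yanti[of "Suc a"] by simp
    then show ?case using D[of a] Suc.prems by (simp add: w_def flip: power_mult_distrib)
  qed (simp add: corner_minor_0 D0)
  have dY: "det Y = 1" using cm[of n] Dn corner_minor_full[OF Yc] by simp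
  have adj: "adj_mat Y = Q" by (rule adj_mat_eq_inverse[OF Yc c(1) YQ dY])
  \<comment> \<open>The value that \<open>J_on_section\<close> requires for the entry
    \<open>(i, s)\<close> of \<open>P * Y\<close>; positions without a target get 0.\<close>
  define \<omega> where "\<omega> i s = (if i + s < n \<and> blk i = blk (n - 1 - s) then (-1) ^ s * \<tau> (i + 1, s + 1) / D s else 0)" for i s
  define P where "P = mat n n (\<lambda>(i, j). if blk i = blk j then \<Sum>s<n. \<omega> i s * q s j else 0)"
  have Pc: "P \<in> carrier_mat n n" by (simp add: P_def)
  \<comment> \<open>A nonzero term forces \<open>n - 1 - s\<close> to lie between \<open>i\<close>
    and \<open>j\<close>. Hence \<open>P\<close> is upper triangular, and only
    \<open>s = n - 1 - i\<close> contributes to its diagonal.\<close>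
  have tri: "n - 1 - s \<le> j \<and> i \<le> n - 1 - s" if "\<omega> i s * q s j \<noteq> 0" for i s j
  proof -
    have "\<not> s + j + 1 < n" using that q(1)[of s j] by auto
    moreover have "i + s < n" using that by (auto simp: \<omega>_def split: if_splits)
    ultimately show ?thesis by auto
  qed
  have P: "unipotent inside n P"
    unfolding unipotent_def supported_def
  proof (intro conjI allI impI Pc)
    fix i j assume ij: "i < n" "j < n" and "P $$ (i, j) \<noteq> 0"
    then have b: "blk i = blk j" and "(\<Sum>s<n. \<omega> i s * q s j) \<noteq> 0" by (auto simp: P_def split: if_splits)
    then obtain s where "\<omega> i s * q s j \<noteq> 0"
      by (elim sum.not_neutral_contains_not_neutral)
    from tri[OF this] have "i \<le> j" by simp
    then show "inside i j" using b by (simp add: inside_def)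
  next
    fix i assume i: "i < n"
    have "(\<Sum>s<n. \<omega> i s * q s i) = (\<Sum>s<n. if s = n - 1 - i then \<omega> i s * q s i else 0)"
    proof (rule sum.cong, simp)
      fix s assume "s \<in> {..<n}"
      then show "\<omega> i s * q s i = (if s = n - 1 - i then \<omega> i s * q s i else 0)"
        using tri[of i s i] i by (cases "\<omega> i s * q s i = 0") auto
    qed
    also have "\<dots> = \<omega> i (n - 1 - i) * q (n - 1 - i) i" using i by simp
    \<comment> \<open>The antidiagonal targets were already used for \<open>w\<close>; this
      consistency makes the diagonal of \<open>P\<close> equal to 1.\<close>
    also have "\<omega> i (n - 1 - i) = w (n - i)"
      using i by (simp add: \<omega>_def w_def D_def Suc_diff_Suc)
    also have "q (n - 1 - i) i = 1 / w (n - i)"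
      using i q(2)[of "n - 1 - i" i] by (simp add: Suc_diff_Suc)
    finally show "P $$ (i, i) = 1" using i w[of "n - i"] by (simp add: P_def)
  qed
  obtain v where v: "v \<in> carrier_mat n n" "P * v = 1\<^sub>m n"
    using right_inverse_exists[OF Pc] det_unipotent[OF unipotent_inside[OF P]] by auto
  \<comment> \<open>Cutting \<open>\<omega> * Q\<close> down to its diagonal blocks does no harm
    here: a contributing \<open>j\<close> lies between \<open>i\<close> and
    \<open>n - 1 - s\<close>, which are in the same block, so \<open>j\<close> is in it as well.
    Then \<open>Q * Y = 1\<close> gives back \<open>\<omega>\<close>.\<close>
  have PY: "(P * Y) $$ (i, s) = \<omega> i s" if "i < n" "s < n" and b: "i + s < n" "blk i = blk (n - 1 - s)" for i s
  proof -
    have "(P * Y) $$ (i, s) = (\<Sum>j<n. (\<Sum>t<n. \<omega> i t * q t j) * Y $$ (j, s))"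
      unfolding index_mult_sum[OF Pc Yc that(1,2)]
    proof (rule sum.cong, simp)
      fix j assume j: "j \<in> {..<n}"
      show "P $$ (i, j) * Y $$ (j, s) = (\<Sum>t<n. \<omega> i t * q t j) * Y $$ (j, s)"
      proof (cases "Y $$ (j, s) = 0 \<or> (\<Sum>t<n. \<omega> i t * q t j) = 0")
        case True
        then show ?thesis using j that by (auto simp: P_def)
      next
        case False
        then have "j + s < n" using antitriangular_zero[OF Y, of j s] j that by (meson lessThan_iff not_less)
        moreover obtain t where "\<omega> i t * q t j \<noteq> 0"
          using False by (auto elim: sum.not_neutral_contains_not_neutral)
        from tri[OF this] have "i \<le> j" by simp
        ultimately have "blk i = blk j"
          using mono[of i j] mono[of j "n - 1 - s"] j b that by simp
        then show ?thesis using j that by (simp add: P_def)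
      qed
    qed
    also have "\<dots> = (\<Sum>j<n. \<Sum>t<n. \<omega> i t * (q t j * Y $$ (j, s)))"
      by (simp add: sum_distrib_right mult.assoc)
    also have "\<dots> = (\<Sum>t<n. \<Sum>j<n. \<omega> i t * (q t j * Y $$ (j, s)))"
      by (rule sum.swap)
    also have "\<dots> = (\<Sum>t<n. \<omega> i t * (Q * Y) $$ (t, s))"
      by (rule sum.cong[OF refl], subst index_mult_sum[OF c(1) Yc])
        (use that in \<open>auto simp: Q_def sum_distrib_left\<close>)
    also have "\<dots> = (\<Sum>t<n. if t = s then \<omega> i s else 0)"
      unfolding QY by (rule sum.cong) (use that in auto)
    finally show ?thesis using that by simp
  qed
  note J = J_on_section[OF P v Y dY]
  let ?Z = "P * Y * v"
  have Zc: "?Z \<in> carrier_mat n n" using Pc Yc v by simp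
  show ?thesis
  proof (rule that[OF Zc])
    show "det ?Z = 1" using J(1)[of n] cm[of n] Dn corner_minor_full[OF Zc] by simp
    show "\<forall>i j. (i, j) \<in> S \<longrightarrow> J_val n i j ?Z = \<tau> (i, j)"
    proof (intro allI impI)
      fix i j assume "(i, j) \<in> S"
      then show "J_val n i j ?Z = \<tau> (i, j)"
      proof (cases rule: S_cases)
        case upper
        have "J_val n i j ?Z = (-1) ^ (j - 1) * \<omega> (i - 1) (j - 1) * D (j - 1)"
          using upper J(2)[of i j] PY[of "i - 1" "j - 1"] cm[of "j - 1"] by (simp add: J_val_eq_upper)
        also have "\<omega> (i - 1) (j - 1) = (-1) ^ (j - 1) * \<tau> (i, j) / D (j - 1)"
          using upper by (auto simp: \<omega>_def)
        finally show ?thesis using D[of "j - 1"] upper by (simp flip: power_mult_distrib)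
      next
        case (lower p k)
        have "J_val n i j ?Z = D p * shifted_minor n p k (\<lambda>r c. Q $$ (r, c))"
          unfolding lower(4,5) J_val_eq_lower[OF lower(1-3)]
          using J(3)[OF lower(3)] cm[of p] lower(3) by (simp add: adj)
        also have "shifted_minor n p k (\<lambda>r c. Q $$ (r, c)) = shifted_minor n p k q"
          by (rule shifted_minor_cong) (use lower in \<open>auto simp: Q_def\<close>)
        finally show ?thesis using lower q(3)[of p k] D[of p] by simp
      qed
    qed
  qed
qed

end

section \<open>Rationality of the section\<close>

lemma map_mat_adj_mat:
  assumes "comm_ring_hom h" and A: "A \<in> carrier_mat n n"
  shows "map_mat h (adj_mat A) = adj_mat (map_mat h A)"
proof -
  interpret comm_ring_hom h by fact
  have del: "map_mat h (mat_delete A i j) = mat_delete (map_mat h A) i j" for i j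
    by (rule eq_matI) (use A in \<open>auto simp: mat_delete_def\<close>)
  show ?thesis
    by (rule eq_matI)
      (auto simp: adj_mat_def cofactor_def hom_mult hom_power hom_uminus del simp flip: hom_det)
qed

lemma adj_mat_in_mvars:
  fixes A :: "('v, 'a::comm_ring_1) mvpoly mat"
  assumes A: "A \<in> carrier_mat n n" and "\<And>i j. i < n \<Longrightarrow> j < n \<Longrightarrow> A $$ (i, j) \<in> mvars_in V"
    and "i < n" "j < n"
  shows "adj_mat A $$ (i, j) \<in> mvars_in V"
proof -
  have "det (mat_delete A j i) \<in> mvars_in V"
    by (rule det_in_mvars) (use assms in \<open>auto simp: mat_delete_def\<close>)
  then show ?thesis
    using assms
    by (auto simp: adj_mat_def cofactor_def
        intro!: mvars_in_mult mvars_in_power mvars_in_uminus mvars_in_one)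
qed

context index_blocks
begin

section \<open>The polynomials as functions of a matrix\<close>

lemma J_poly_props:
  assumes "(i, j) \<in> S"
  shows "J_poly n i j \<in> (MP n :: 'a::field coord_poly set)"
    and "X \<in> carrier_mat n n \<Longrightarrow> mat_eval X (J_poly n i j) = J_val n i j (X :: 'a mat)"
proof -
  have g: "(generic_mat n :: 'a coord_poly mat) $$ (a, b) \<in> MP n" if "a < n" "b < n" for a b
    using that by (auto simp: generic_mat_def intro!: mvars_in_var)
  have adj: "adj_mat (generic_mat n :: 'a coord_poly mat) $$ (a, b) \<in> MP n" if "a < n" "b < n" for a b
    by (rule adj_mat_in_mvars[OF generic_mat_carrier g that])
  have "J_poly n i j \<in> (MP n :: 'a coord_poly set) \<and>
    (X \<in> carrier_mat n n \<longrightarrow> mat_eval X (J_poly n i j) = J_val n i j (X :: 'a mat))" for X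
    using assms
  proof (cases rule: S_cases)
    case upper
    have "J_upper n i j (generic_mat n) \<in> (MP n :: 'a coord_poly set)"
      unfolding J_upper_def by (rule det_in_mvars) (use upper in \<open>auto intro!: g[unfolded One_nat_def]\<close>)
    moreover have "mat_eval X (J_upper n i j (generic_mat n)) = J_upper n i j X" if X: "X \<in> carrier_mat n n"
    proof -
      have "mat_eval X (J_upper n i j (generic_mat n)) = J_upper n i j (map_mat (mat_eval X) (generic_mat n))"
        unfolding J_upper_def mat_eval.hom_det[symmetric]
        by (rule arg_cong[where f = det], rule eq_matI) (use upper in \<open>auto simp: generic_mat_def\<close>)
      then show ?thesis by (simp add: map_generic_mat[OF X])
    qed
    ultimately show ?thesis using upper by (simp add: J_poly_eq_J_val J_val_eq_upper)
  next
    case (lower p k)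
    have "J_lower n p k (generic_mat n) \<in> (MP n :: 'a coord_poly set)"
      unfolding J_lower_def
      by (rule det_in_mvars) (use lower in \<open>auto intro!: g[unfolded One_nat_def] adj[unfolded One_nat_def]\<close>)
    moreover have "mat_eval X (J_lower n p k (generic_mat n)) = J_lower n p k X" if X: "X \<in> carrier_mat n n"
    proof -
      have m: "mat_eval X (adj_mat (generic_mat n) $$ (a, b)) = adj_mat X $$ (a, b)" if "a < n" "b < n" for a b
      proof -
        have "mat_eval X (adj_mat (generic_mat n) $$ (a, b))
            = map_mat (mat_eval X) (adj_mat (generic_mat n)) $$ (a, b)"
          using that by (subst index_map_mat) (auto simp: adj_mat_def generic_mat_def)
        then show ?thesis
          using map_mat_adj_mat[OF mat_eval.comm_ring_hom_axioms generic_mat_carrier, of X n] map_generic_mat[OF X]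
          by simp
      qed
      have m': "mat_eval X (generic_mat n $$ (a, b)) = X $$ (a, b)" if "a < n" "b < n" for a b
        using that by (simp add: generic_mat_def mat_eval_var)
      show ?thesis
        unfolding J_lower_def mat_eval.hom_det[symmetric]
        by (rule arg_cong[where f = det], rule eq_matI) (use lower in \<open>auto simp: m m'\<close>)
    qed
    ultimately show ?thesis
      unfolding J_poly_eq_J_val lower(4,5) J_val_eq_lower[OF lower(1-3)] by blast
  qed
  then show "J_poly n i j \<in> (MP n :: 'a coord_poly set)"
    and "X \<in> carrier_mat n n \<Longrightarrow> mat_eval X (J_poly n i j) = J_val n i j (X :: 'a mat)" by auto
qed

section \<open>Functions that are rational in the minors\<close>

abbreviation S\<^sub>0 :: "(nat \<times> nat) set" where
  "S\<^sub>0 \<equiv> S - {(1, n)}"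

definition J_point :: "'a::comm_ring_1 mat \<Rightarrow> nat \<times> nat \<Rightarrow> 'a" where
  "J_point X = (\<lambda>(i, j). J_val n i j X)"

text \<open>Computing the section divides only by antidiagonal minors and by minors below the
  antidiagonal, so these are the factors; the minor at \<open>(1, n)\<close> is 1 on SL(n).\<close>

definition den :: "(nat \<times> nat, 'a::comm_ring_1) mvpoly" where
  "den = (\<Prod>s\<in>{s \<in> S\<^sub>0. fst s + snd s \<ge> n + 1}. mvar s)"

definition generic_locus :: "'a::field mat set" where
  "generic_locus = {X \<in> SL_mat n. mp_at (J_point X) den \<noteq> 0}"

text \<open>A condition on values, since \<open>f\<close> will be an entry of a matrix that is
  chosen point by point; \<open>P\<close> and \<open>e\<close> are the same for all points.\<close>

definition rational_in_J :: "('a::field mat \<Rightarrow> 'a) \<Rightarrow> bool" where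
  "rational_in_J f \<longleftrightarrow> (\<exists>P\<in>mvars_in S\<^sub>0. \<exists>e. \<forall>X\<in>generic_locus.
     f X * mp_at (J_point X) den ^ e = mp_at (J_point X) P)"

lemma finite_S: "finite S"
  by (rule finite_subset[of _ "{1..n} \<times> {1..n}"]) (auto simp: S_def)

lemma den_in: "den \<in> mvars_in S\<^sub>0"
  unfolding den_def by (rule mvars_in_prod) (auto intro: mvars_in_var)

lemma rational_const: "rational_in_J (\<lambda>X. c)"
  unfolding rational_in_J_def
  by (intro bexI[of _ "mconst c"] exI[of _ 0]) (auto simp: mp_at_simps mvars_in_const)

lemma rational_cong:
  assumes "rational_in_J f" "\<And>X. X \<in> generic_locus \<Longrightarrow> f X = g X"
  shows "rational_in_J g"
  using assms by (simp add: rational_in_J_def)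

lemma rational_add:
  assumes "rational_in_J f" "rational_in_J g"
  shows "rational_in_J (\<lambda>X. f X + g X)"
proof -
  obtain P e where P: "P \<in> mvars_in S\<^sub>0" "\<And>X. X \<in> generic_locus \<Longrightarrow>
      f X * mp_at (J_point X) den ^ e = mp_at (J_point X) P"
    using assms(1) unfolding rational_in_J_def by blast
  obtain Q d where Q: "Q \<in> mvars_in S\<^sub>0" "\<And>X. X \<in> generic_locus \<Longrightarrow>
      g X * mp_at (J_point X) den ^ d = mp_at (J_point X) Q"
    using assms(2) unfolding rational_in_J_def by blast
  show ?thesis unfolding rational_in_J_def
  proof (intro bexI[of _ "P * den ^ d + Q * den ^ e"] exI[of _ "e + d"] ballI)
    fix X :: "'a mat" assume X: "X \<in> generic_locus"
    show "(f X + g X) * mp_at (J_point X) den ^ (e + d) = mp_at (J_point X) (P * den ^ d + Q * den ^ e)"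
      by (simp add: mp_at_simps power_add algebra_simps flip: P(2)[OF X] Q(2)[OF X])
  qed (intro mvars_in_add mvars_in_mult mvars_in_power den_in P Q)
qed

lemma rational_mult:
  assumes "rational_in_J f" "rational_in_J g"
  shows "rational_in_J (\<lambda>X. f X * g X)"
proof -
  obtain P e where P: "P \<in> mvars_in S\<^sub>0" "\<And>X. X \<in> generic_locus \<Longrightarrow>
      f X * mp_at (J_point X) den ^ e = mp_at (J_point X) P"
    using assms(1) unfolding rational_in_J_def by blast
  obtain Q d where Q: "Q \<in> mvars_in S\<^sub>0" "\<And>X. X \<in> generic_locus \<Longrightarrow>
      g X * mp_at (J_point X) den ^ d = mp_at (J_point X) Q"
    using assms(2) unfolding rational_in_J_def by blast
  show ?thesis unfolding rational_in_J_def
  proof (intro bexI[of _ "P * Q"] exI[of _ "e + d"] ballI)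
    fix X :: "'a mat" assume X: "X \<in> generic_locus"
    show "f X * g X * mp_at (J_point X) den ^ (e + d) = mp_at (J_point X) (P * Q)"
      by (simp add: mp_at_simps power_add algebra_simps flip: P(2)[OF X] Q(2)[OF X])
  qed (intro mvars_in_mult P Q)
qed

lemma rational_uminus: "rational_in_J f \<Longrightarrow> rational_in_J (\<lambda>X. - f X)"
  using rational_mult[OF rational_const[of "- 1"], of f] by simp

lemma rational_diff: "rational_in_J f \<Longrightarrow> rational_in_J g \<Longrightarrow> rational_in_J (\<lambda>X. f X - g X)"
  using rational_add[OF _ rational_uminus, of f g] by simp

lemma rational_sum: "(\<And>i. i \<in> A \<Longrightarrow> rational_in_J (f i)) \<Longrightarrow> rational_in_J (\<lambda>X. \<Sum>i\<in>A. f i X)"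
  by (induction A rule: infinite_finite_induct) (simp_all add: rational_const rational_add)

lemma rational_prod: "(\<And>i. i \<in> A \<Longrightarrow> rational_in_J (f i)) \<Longrightarrow> rational_in_J (\<lambda>X. \<Prod>i\<in>A. f i X)"
  by (induction A rule: infinite_finite_induct) (simp_all add: rational_const rational_mult)

lemma rational_det:
  assumes "\<And>a b. a < m \<Longrightarrow> b < m \<Longrightarrow> rational_in_J (\<lambda>X. f X a b)"
  shows "rational_in_J (\<lambda>X. det (mat m m (\<lambda>(a, b). f X a b)))"
proof (rule rational_cong)
  show "rational_in_J (\<lambda>X. \<Sum>p\<in>{p. p permutes {0..<m}}. signof p * (\<Prod>i = 0..<m. f X i (p i)))"
    by (intro rational_sum rational_mult rational_const rational_prod assms)
      (auto dest: permutes_in_image)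
  fix X
  show "(\<Sum>p\<in>{p. p permutes {0..<m}}. signof p * (\<Prod>i = 0..<m. f X i (p i))) =
      det (mat m m (\<lambda>(a, b). f X a b))"
    unfolding det_def'[OF mat_carrier] by (intro sum.cong refl arg_cong2[where f = "(*)"] prod.cong) auto
qed

lemma rational_adj_mat:
  fixes F :: "'a::field mat \<Rightarrow> 'a mat"
  assumes c: "\<And>X. X \<in> generic_locus \<Longrightarrow> F X \<in> carrier_mat n n"
    and F: "\<And>a b. a < n \<Longrightarrow> b < n \<Longrightarrow> rational_in_J (\<lambda>X. F X $$ (a, b))" and ab: "a < n" "b < n"
  shows "rational_in_J (\<lambda>X. adj_mat (F X) $$ (a, b))"
proof (rule rational_cong)
  show "rational_in_J (\<lambda>X. (-1) ^ (b + a) * det (mat (n - 1) (n - 1)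
      (\<lambda>(i, j). F X $$ (if i < b then i else Suc i, if j < a then j else Suc j))))"
    by (intro rational_mult rational_const rational_det F) auto
  fix X :: "'a mat" assume "X \<in> generic_locus"
  then show "(-1) ^ (b + a) * det (mat (n - 1) (n - 1)
      (\<lambda>(i, j). F X $$ (if i < b then i else Suc i, if j < a then j else Suc j))) = adj_mat (F X) $$ (a, b)"
    using ab c[of X] by (auto simp: adj_mat_def cofactor_def mat_delete_def)
qed

lemma rational_mult_mat:
  fixes F H :: "'a::field mat \<Rightarrow> 'a mat"
  assumes c: "\<And>X. X \<in> generic_locus \<Longrightarrow> F X \<in> carrier_mat n n" "\<And>X. X \<in> generic_locus \<Longrightarrow> H X \<in> carrier_mat n n"
    and F: "\<And>a b. a < n \<Longrightarrow> b < n \<Longrightarrow> rational_in_J (\<lambda>X. F X $$ (a, b))"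
    and H: "\<And>a b. a < n \<Longrightarrow> b < n \<Longrightarrow> rational_in_J (\<lambda>X. H X $$ (a, b))" and ab: "a < n" "b < n"
  shows "rational_in_J (\<lambda>X. (F X * H X) $$ (a, b))"
proof (rule rational_cong)
  show "rational_in_J (\<lambda>X. \<Sum>t<n. F X $$ (a, t) * H X $$ (t, b))"
    by (intro rational_sum rational_mult F H ab) auto
  show "(\<Sum>t<n. F X $$ (a, t) * H X $$ (t, b)) = (F X * H X) $$ (a, b)" if "X \<in> generic_locus" for X
    using index_mult_sum[OF c(1)[OF that] c(2)[OF that] ab] by simp
qed

lemma J_val_1_n:
  assumes "X \<in> SL_mat n"
  shows "J_val n 1 n X = 1"
  using assms n corner_minor_full[of X n] corner_minor_eq_J_upper[of n n X]
  by (simp add: J_val_eq_upper SL_mat_def)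

lemma rational_J:
  assumes "(i, j) \<in> S"
  shows "rational_in_J (\<lambda>X. J_val n i j X)"
proof (cases "(i, j) = (1, n)")
  case True
  then show ?thesis
    by (intro rational_cong[OF rational_const[of 1]]) (auto simp: J_val_1_n generic_locus_def simp del: One_nat_def)
next
  case False
  then show ?thesis
    unfolding rational_in_J_def using assms
    by (intro bexI[of _ "mvar (i, j)"] exI[of _ 0]) (auto simp: mp_at_simps J_point_def intro!: mvars_in_var)
qed

text \<open>Away from \<open>(1, n)\<close>, where the minor is 1, removing the factor
  \<open>J_val n i j X\<close> from \<open>den\<close> leaves the product \<open>?R\<close> of the
  others, so the inverse is \<open>?R / den\<close>.\<close>

lemma rational_J_inverse:
  fixes X :: "'a::field mat"
  assumes "(i, j) \<in> S" "i + j \<ge> n + 1"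
  shows "rational_in_J (\<lambda>X :: 'a mat. 1 / J_val n i j X)" "X \<in> generic_locus \<Longrightarrow> J_val n i j X \<noteq> 0"
proof -
  have "rational_in_J (\<lambda>X :: 'a mat. 1 / J_val n i j X) \<and> (X \<in> generic_locus \<longrightarrow> J_val n i j X \<noteq> 0)"
  proof (cases "(i, j) = (1, n)")
    case True
    then show ?thesis
      by (intro conjI rational_cong[OF rational_const[of 1]])
        (auto simp: J_val_1_n generic_locus_def simp del: One_nat_def)
  next
    case False
    let ?A = "{s \<in> S\<^sub>0. fst s + snd s \<ge> n + 1}"
    have fin: "finite ?A" using finite_S by auto
    have mem: "(i, j) \<in> ?A" using assms False by simp
    let ?R = "\<Prod>s\<in>?A - {(i, j)}. mvar s :: (nat \<times> nat, 'a) mvpoly"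
    have eq: "mp_at (J_point X) den = J_val n i j X * mp_at (J_point X) ?R" for X :: "'a mat"
      unfolding den_def prod.remove[OF fin mem] by (simp add: mp_at_simps J_point_def)
    have nz: "J_val n i j X \<noteq> 0" if "X \<in> generic_locus" for X :: "'a mat"
      using that eq[of X] by (auto simp: generic_locus_def)
    have "rational_in_J (\<lambda>X :: 'a mat. 1 / J_val n i j X)"
      unfolding rational_in_J_def
      by (intro bexI[of _ ?R] exI[of _ 1] ballI, simp add: eq nz, rule mvars_in_prod, rule mvars_in_var) auto
    then show ?thesis using nz by blast
  qed
  then show "rational_in_J (\<lambda>X :: 'a mat. 1 / J_val n i j X)" "X \<in> generic_locus \<Longrightarrow> J_val n i j X \<noteq> 0" by auto
qed

lemma rational_corner:
  fixes X :: "'a::field mat"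
  assumes "a \<le> n"
  shows "rational_in_J (\<lambda>X :: 'a mat. corner_minor n a X)" "rational_in_J (\<lambda>X :: 'a mat. 1 / corner_minor n a X)"
    "X \<in> generic_locus \<Longrightarrow> corner_minor n a X \<noteq> 0"
proof -
  have "rational_in_J (\<lambda>X :: 'a mat. corner_minor n a X) \<and> rational_in_J (\<lambda>X :: 'a mat. 1 / corner_minor n a X) \<and>
    (X \<in> generic_locus \<longrightarrow> corner_minor n a X \<noteq> 0)"
  proof (cases "a = 0")
    case True
    then show ?thesis by (simp add: corner_minor_0 rational_const)
  next
    case False
    then have eq: "corner_minor n a X = J_val n (n + 1 - a) a X" for X :: "'a mat"
      using assms by (simp add: corner_minor_eq_J_upper J_val_eq_upper)
    have inS: "(n + 1 - a, a) \<in> S" using lower_in_S(2)[of a 0] assms False by simp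
    have le: "n + 1 \<le> n + 1 - a + a" by simp
    show ?thesis
      unfolding eq
      by (intro conjI impI rational_J[OF inS] rational_J_inverse[OF inS le])
  qed
  then show "rational_in_J (\<lambda>X :: 'a mat. corner_minor n a X)" "rational_in_J (\<lambda>X :: 'a mat. 1 / corner_minor n a X)"
    "X \<in> generic_locus \<Longrightarrow> corner_minor n a X \<noteq> 0" by auto
qed

lemma rational_mat_eval:
  fixes Z :: "'a::field mat \<Rightarrow> 'a mat"
  assumes Z: "\<And>a b. a < n \<Longrightarrow> b < n \<Longrightarrow> rational_in_J (\<lambda>X. Z X $$ (a, b))" and p: "p \<in> MP n"
  shows "rational_in_J (\<lambda>X. mat_eval (Z X) p)"
  using p
proof (induction rule: mvpoly_induct)
  case (var v)
  then show ?case using Z by (cases v) (auto simp: mat_eval_var)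
qed (simp_all add: mat_eval_simps rational_const rational_add rational_mult)

text \<open>The system of \<open>shifted_minors_prescribed\<close> read in the other direction: the
  entries of \<open>Q\<close> below the antidiagonal are computed from the minors in the
  lexicographic order of \<open>(k, p)\<close>. Each step divides only by a shifted minor, which is
  \<open>J_lower / corner_minor\<close> or an empty minor, so its inverse is rational as
  well.\<close>

lemma rational_inverse_entries:
  fixes Q :: "'a::field mat \<Rightarrow> 'a mat"
  assumes Q0: "\<And>X a b. X \<in> generic_locus \<Longrightarrow> a < n \<Longrightarrow> b < n \<Longrightarrow> a + b + 1 < n \<Longrightarrow> Q X $$ (a, b) = 0"
    and Qanti: "\<And>X a. X \<in> generic_locus \<Longrightarrow> 1 \<le> a \<Longrightarrow> a \<le> n \<Longrightarrow>
      Q X $$ (a - 1, n - a) = (-1) ^ (a - 1) * corner_minor n (a - 1) X * (1 / corner_minor n a X)"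
    and Qm: "\<And>X p k. X \<in> generic_locus \<Longrightarrow> 1 \<le> p \<Longrightarrow> 1 \<le> k \<Longrightarrow> p + k \<le> n \<Longrightarrow>
      J_lower n p k X = corner_minor n p X * shifted_minor n p k (\<lambda>r c. Q X $$ (r, c))"
    and ab: "a < n" "b < n"
  shows "rational_in_J (\<lambda>X. Q X $$ (a, b))"
proof -
  have anti: "rational_in_J (\<lambda>X. Q X $$ (a - 1, n - a))" if "1 \<le> a" "a \<le> n" for a
    by (rule rational_cong[OF _ Qanti[symmetric, OF _ that]])
      (use that in \<open>intro rational_mult rational_const rational_corner; simp\<close>)
  have zero: "rational_in_J (\<lambda>X. Q X $$ (a, b))" if "a < n" "b < n" "a + b + 1 < n" for a b
    by (rule rational_cong[OF rational_const[of 0]]) (use that Q0 in simp)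
  have Jl: "rational_in_J (\<lambda>X :: 'a mat. J_lower n p k X)" "rational_in_J (\<lambda>X :: 'a mat. 1 / J_lower n p k X)"
    "X \<in> generic_locus \<Longrightarrow> J_lower n p k X \<noteq> 0" if "1 \<le> p" "1 \<le> k" "p + k \<le> n" for p k and X :: "'a mat"
    using rational_J[OF lower_in_S(1)[OF that(1,3,2)]] rational_J_inverse[OF lower_in_S(1)[OF that(1,3,2)]] that
    by (simp_all add: J_val_eq_lower[OF that] del: One_nat_def add: J_val_eq_lower[OF that, unfolded One_nat_def])
  have m: "rational_in_J (\<lambda>X. shifted_minor n p k (\<lambda>r c. Q X $$ (r, c)))"
    "rational_in_J (\<lambda>X. 1 / shifted_minor n p k (\<lambda>r c. Q X $$ (r, c)))"
    "X \<in> generic_locus \<Longrightarrow> shifted_minor n p k (\<lambda>r c. Q X $$ (r, c)) \<noteq> 0"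
    if pk: "1 \<le> p" "p + k \<le> n" for p k and X :: "'a mat"
  proof -
    have "rational_in_J (\<lambda>X. shifted_minor n p k (\<lambda>r c. Q X $$ (r, c))) \<and>
      rational_in_J (\<lambda>X. 1 / shifted_minor n p k (\<lambda>r c. Q X $$ (r, c))) \<and>
      (X \<in> generic_locus \<longrightarrow> shifted_minor n p k (\<lambda>r c. Q X $$ (r, c)) \<noteq> 0)"
    proof (cases "k = 0")
      case True
      then show ?thesis by (simp add: shifted_minor_def rational_const)
    next
      case False
      then have k: "1 \<le> k" by simp
      have D: "corner_minor n p X \<noteq> 0" if "X \<in> generic_locus" for X :: "'a mat"
        by (rule rational_corner(3)[OF _ that]) (use pk in simp)
      have e: "shifted_minor n p k (\<lambda>r c. Q X $$ (r, c)) = J_lower n p k X * (1 / corner_minor n p X)"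
        if "X \<in> generic_locus" for X :: "'a mat"
        using Qm[OF that pk(1) k pk(2)] D[OF that] by simp
      have r: "rational_in_J (\<lambda>X :: 'a mat. J_lower n p k X * (1 / corner_minor n p X))"
        using pk k by (intro rational_mult Jl rational_corner) auto
      have "rational_in_J (\<lambda>X :: 'a mat. corner_minor n p X * (1 / J_lower n p k X))"
        using pk k by (intro rational_mult Jl rational_corner) auto
      then have "rational_in_J (\<lambda>X. 1 / shifted_minor n p k (\<lambda>r c. Q X $$ (r, c)))"
        by (rule rational_cong) (simp add: e D)
      moreover have "rational_in_J (\<lambda>X. shifted_minor n p k (\<lambda>r c. Q X $$ (r, c)))"
        by (rule rational_cong[OF r]) (simp add: e)
      ultimately show ?thesis
        using e D Jl(3)[OF pk(1) k pk(2)] by simp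
    qed
    then show "rational_in_J (\<lambda>X. shifted_minor n p k (\<lambda>r c. Q X $$ (r, c)))"
      "rational_in_J (\<lambda>X. 1 / shifted_minor n p k (\<lambda>r c. Q X $$ (r, c)))"
      "X \<in> generic_locus \<Longrightarrow> shifted_minor n p k (\<lambda>r c. Q X $$ (r, c)) \<noteq> 0" by auto
  qed
  \<comment> \<open>Outer induction on \<open>k\<close>, inner induction on \<open>p\<close>: the
    lexicographic order again.\<close>
  have key: "rational_in_J (\<lambda>X. Q X $$ (n - k, p + k - 1))" if "1 \<le> k" "1 \<le> p" "p + k \<le> n" for k p
    using that
  proof (induction k arbitrary: p rule: less_induct)
    case (less k)
    note outer = less.IH
    show ?case using less.prems
    proof (induction p rule: less_induct)
      case (less p)
      let ?N = "\<lambda>X. det (mat k k (\<lambda>(a, b). if a = 0 \<and> b = k - 1 then 0 else Q X $$ (n - k + a, p + b)))"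
      have N: "rational_in_J ?N"
      proof (rule rational_det)
        fix a b assume ab: "a < k" "b < k"
        \<comment> \<open>If the entry in row \<open>n - k + a\<close> and column
          \<open>p + b\<close> lies below the antidiagonal, its index is
          \<open>(t, p + b + 1 - t)\<close>. It precedes \<open>(k, p)\<close>: either
          \<open>t < k\<close>, or \<open>a = 0\<close> and \<open>b < k - 1\<close>.\<close>
        define t where "t = k - a"
        have r: "n - k + a = n - t" and t: "1 \<le> t" "t \<le> k" using ab less.prems by (auto simp: t_def)
        show "rational_in_J (\<lambda>X. if a = 0 \<and> b = k - 1 then 0 else Q X $$ (n - k + a, p + b))"
        proof (cases "a = 0 \<and> b = k - 1")
          case False
          have "rational_in_J (\<lambda>X. Q X $$ (n - t, p + b))"
          proof (cases "p + b + 1" t rule: linorder_cases)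
            case less
            then show ?thesis using t ab \<open>p + k \<le> n\<close> by (intro zero) auto
          next
            case equal
            then have "n - t = (n + 1 - t) - 1" "p + b = n - (n + 1 - t)" using t ab \<open>p + k \<le> n\<close> by auto
            then show ?thesis using anti[of "n + 1 - t"] t \<open>p + k \<le> n\<close> by simp
          next
            case greater
            define p' where "p' = p + b + 1 - t"
            have p': "1 \<le> p'" "p' + t \<le> n" "p + b = p' + t - 1"
              using greater ab less.prems by (auto simp: p'_def)
            show ?thesis
            proof (cases "t = k")
              case True
              then have "p' < p" using False ab t less.prems by (auto simp: p'_def t_def)
              then show ?thesis using less.IH[of p'] p' less.prems True by simp
            next
              case False
              then show ?thesis using outer[of t p'] t p' by simp
            qed
          qed
          then show ?thesis using False r by auto
        qed (simp add: rational_const)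
      qed
      have "rational_in_J (\<lambda>X. (-1) ^ (k - 1) * (shifted_minor n p k (\<lambda>r c. Q X $$ (r, c)) - ?N X) *
          (1 / shifted_minor n p (k - 1) (\<lambda>r c. Q X $$ (r, c))))"
        using less.prems by (intro rational_mult rational_diff rational_const N m) auto
      then show ?case
      proof (rule rational_cong)
        fix X :: "'a mat" assume X: "X \<in> generic_locus"
        have "shifted_minor n p (k - 1) (\<lambda>r c. Q X $$ (r, c)) \<noteq> 0"
          by (rule m(3)[OF _ _ X]) (use less.prems in auto)
        then show "(-1) ^ (k - 1) * (shifted_minor n p k (\<lambda>r c. Q X $$ (r, c)) - ?N X) *
          (1 / shifted_minor n p (k - 1) (\<lambda>r c. Q X $$ (r, c))) = Q X $$ (n - k, p + k - 1)"
          using shifted_minor_corner[of k n p "\<lambda>r c. Q X $$ (r, c)"] less.prems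
          by (simp add: flip: power_mult_distrib)
      qed
    qed
  qed
  show ?thesis
  proof (cases "a + b + 1" n rule: linorder_cases)
    case less
    then show ?thesis using zero ab by simp
  next
    case equal
    then have "b = n - (a + 1)" by simp
    then show ?thesis using anti[of "a + 1"] ab by simp
  next
    case greater
    then show ?thesis using key[of "n - a" "a + b + 1 - n"] ab by simp
  qed
qed

text \<open>Although the representative is picked by choice, the entries of its factors are given by
  the minors: \<open>Q = Y\<inverse>\<close> by \<open>rational_inverse_entries\<close>,
  \<open>Y\<close> as the adjugate of \<open>Q\<close>, \<open>P\<close> as \<open>P * Y * Q\<close>
  with the entries of \<open>P * Y\<close> read off from \<open>J_upper\<close>, and
  \<open>v\<close> as the adjugate of \<open>P\<close>.\<close>

lemma rational_section:
  obtains Z g h :: "'a::field mat \<Rightarrow> 'a mat"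
  where "\<forall>X\<in>generic_locus. unipotent below n (g X) \<and> unipotent below n (h X) \<and>
      g X * h X = 1\<^sub>m n \<and> Z X = h X * X * g X"
    "\<forall>a<n. \<forall>b<n. rational_in_J (\<lambda>X. Z X $$ (a, b))"
proof -
  have SL: "X \<in> carrier_mat n n" "det X = 1" if "X \<in> generic_locus" for X :: "'a mat"
    using that by (auto simp: generic_locus_def SL_mat_def)
  define is_sec where "is_sec X t \<longleftrightarrow> (case t of (g, h, P, Y, v) \<Rightarrow>
    unipotent below n g \<and> unipotent below n h \<and> g * h = 1\<^sub>m n \<and>
    unipotent inside n P \<and> v \<in> carrier_mat n n \<and> P * v = 1\<^sub>m n \<and>
    antitriangular n Y \<and> det Y = 1 \<and> h * X * g = P * Y * v)" for X :: "'a mat" and t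
  have "\<exists>t. is_sec X t" if X: "X \<in> generic_locus" for X :: "'a mat"
  proof -
    obtain g h P Y v where "unipotent below n g" "unipotent below n h" "g * h = 1\<^sub>m n"
      "unipotent inside n P" "v \<in> carrier_mat n n" "P * v = 1\<^sub>m n"
      "antitriangular n Y" "det Y = 1" "h * X * g = P * Y * v"
      using section_exists[OF SL[OF X] rational_corner(3)[OF _ X]] .
    then have "is_sec X (g, h, P, Y, v)" by (simp add: is_sec_def)
    then show ?thesis by blast
  qed
  then have sec: "is_sec X (SOME t. is_sec X t)" if "X \<in> generic_locus" for X :: "'a mat"
    using that by (blast intro: someI_ex)
  define g where "g X = fst (SOME t. is_sec X t)" for X
  define h where "h X = fst (snd (SOME t. is_sec X t))" for X
  define P where "P X = fst (snd (snd (SOME t. is_sec X t)))" for X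
  define Y where "Y X = fst (snd (snd (snd (SOME t. is_sec X t))))" for X
  define v where "v X = snd (snd (snd (snd (SOME t. is_sec X t))))" for X
  have g: "unipotent below n (g X)" and h: "unipotent below n (h X)" and gh: "g X * h X = 1\<^sub>m n"
    and P: "unipotent inside n (P X)" and v: "v X \<in> carrier_mat n n" and Pv: "P X * v X = 1\<^sub>m n"
    and Y: "antitriangular n (Y X)" and dY: "det (Y X) = 1" and Z: "h X * X * g X = P X * Y X * v X"
    if X: "X \<in> generic_locus" for X :: "'a mat"
    using sec[OF X] unfolding is_sec_def[of X "SOME t. is_sec X t"]
    by (simp_all add: g_def h_def P_def Y_def v_def case_prod_beta)
  define Q where "Q X = adj_mat (Y X)" for X
  note Yc = antitriangular_carrier[OF Y] and Pc = unipotent_carrier[OF P]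
  have Qc: "Q X \<in> carrier_mat n n" if "X \<in> generic_locus" for X :: "'a mat"
    unfolding Q_def by (rule adj_mat(1)[OF Yc[OF that]])
  have YQ: "Y X * Q X = 1\<^sub>m n" if "X \<in> generic_locus" for X :: "'a mat"
    using adj_mat(2)[OF Yc[OF that]] dY[OF that] by (auto simp: Q_def)
  have Jinv: "J_val n i j (P X * Y X * v X) = J_val n i j X" if "X \<in> generic_locus" "(i, j) \<in> S" for X i j
    using J_val_conj_invariant[OF SL[OF that(1)] g[OF that(1)] h[OF that(1)] gh[OF that(1)] that(2)] Z[OF that(1)]
    by simp
  have cY: "corner_minor n a (Y X) = corner_minor n a X" if X: "X \<in> generic_locus" and a: "a \<le> n" for X a
  proof (cases "a = 0")
    case False
    then have "(n + 1 - a, a) \<in> S" using lower_in_S(2)[of a 0] a by simp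
    then have "corner_minor n a (P X * Y X * v X) = corner_minor n a X"
      using Jinv[OF X, of "n + 1 - a" a] False a by (simp add: corner_minor_eq_J_upper J_val_eq_upper)
    then show ?thesis using J_on_section(1)[OF P[OF X] v[OF X] Pv[OF X] Y[OF X] dY[OF X] a] by simp
  qed (simp add: corner_minor_0)
  have Dnz: "corner_minor n a (Y X) \<noteq> 0" if "X \<in> generic_locus" "a \<le> n" for X a
    using cY[OF that] rational_corner(3)[OF that(2,1)] by simp
  have Qrat: "rational_in_J (\<lambda>X. Q X $$ (a, b))" if "a < n" "b < n" for a b
  proof (rule rational_inverse_entries[OF _ _ _ that])
    fix X :: "'a mat" assume X: "X \<in> generic_locus"
    note inv = inverse_antitriangular[OF Y[OF X] Qc[OF X] YQ[OF X] Dnz[OF X]]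
    show "Q X $$ (a, b) = 0" if "a < n" "b < n" "a + b + 1 < n" for a b
      by (rule inv(1)[OF _ that])
    show "Q X $$ (a - 1, n - a) = (-1) ^ (a - 1) * corner_minor n (a - 1) X * (1 / corner_minor n a X)"
      if a: "1 \<le> a" "a \<le> n" for a
    proof -
      have e: "Y X $$ (n - a, a - 1) * Q X $$ (a - 1, n - a) = 1"
        using inv(2)[of "n - a"] a by simp
      have "corner_minor n a X = (-1) ^ (a - 1) * Y X $$ (n - a, a - 1) * corner_minor n (a - 1) X"
        using corner_minor_antitriangular[OF Y[OF X] a] cY[OF X, of a] cY[OF X, of "a - 1"] a by simp
      then have "corner_minor n a X * Q X $$ (a - 1, n - a)
          = (-1) ^ (a - 1) * corner_minor n (a - 1) X * (Y X $$ (n - a, a - 1) * Q X $$ (a - 1, n - a))"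
        by simp
      then show ?thesis unfolding e using rational_corner(3)[OF a(2) X] by (simp add: field_simps)
    qed
    show "J_lower n p k X = corner_minor n p X * shifted_minor n p k (\<lambda>r c. Q X $$ (r, c))"
      if pk: "1 \<le> p" "1 \<le> k" "p + k \<le> n" for p k
      using Jinv[OF X lower_in_S(1)[OF pk(1,3,2)]]
        J_on_section(3)[OF P[OF X] v[OF X] Pv[OF X] Y[OF X] dY[OF X] pk(3)] cY[OF X, of p] pk
      unfolding J_val_eq_lower[OF pk] by (simp add: Q_def)
  qed
  have Yrat: "rational_in_J (\<lambda>X. Y X $$ (a, b))" if "a < n" "b < n" for a b
  proof (rule rational_cong)
    show "rational_in_J (\<lambda>X. adj_mat (Q X) $$ (a, b))"
      by (rule rational_adj_mat[OF Qc Qrat that])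
    fix X :: "'a mat" assume X: "X \<in> generic_locus"
    have "Q X * Y X = 1\<^sub>m n" by (rule mat_mult_left_right_inverse[OF Yc[OF X] Qc[OF X] YQ[OF X]])
    moreover have "det (Q X) = 1"
      using det_mult[OF Yc[OF X] Qc[OF X]] YQ[OF X] dY[OF X] by simp
    ultimately have "adj_mat (Q X) = Y X" by (intro adj_mat_eq_inverse[OF Qc[OF X] Yc[OF X]])
    then show "adj_mat (Q X) $$ (a, b) = Y X $$ (a, b)" by simp
  qed
  have Prat: "rational_in_J (\<lambda>X. P X $$ (i, j))" if ij: "i < n" "j < n" for i j
  proof (cases "blk i = blk j")
    case False
    have "P X $$ (i, j) = 0" if "X \<in> generic_locus" for X :: "'a mat"
    proof (rule ccontr)
      assume "P X $$ (i, j) \<noteq> 0"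
      then have "inside i j" using P[OF that] ij by (simp add: unipotent_def supported_def)
      then show False using False by (simp add: inside_def)
    qed
    then show ?thesis by (intro rational_cong[OF rational_const[of 0]]) simp
  next
    case True
    \<comment> \<open>The terms of \<open>P * Y * Q\<close>. The condition keeps those that can be
      nonzero, and for them \<open>(i + 1, s + 1)\<close> is in \<open>S\<close>, so that the entry
      of \<open>P * Y\<close> comes from one of the minors.\<close>
    let ?f = "\<lambda>X s. if i + s < n \<and> n - 1 - s \<le> j then
        (-1) ^ s * J_val n (i + 1) (s + 1) X * (1 / corner_minor n s X) * Q X $$ (s, j) else 0"
    have inS: "(i + 1, s + 1) \<in> S" if "i + s < n" "n - 1 - s \<le> j" for s
      using that ij mono[OF that(2) ij(2)] True by (auto simp: S_def)
    have "rational_in_J (\<lambda>X. \<Sum>s<n. ?f X s)"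
    proof (rule rational_sum)
      fix s assume s: "s \<in> {..<n}"
      show "rational_in_J (\<lambda>X. ?f X s)"
      proof (cases "i + s < n \<and> n - 1 - s \<le> j")
        case True
        then have "rational_in_J (\<lambda>X. (-1) ^ s * J_val n (i + 1) (s + 1) X * (1 / corner_minor n s X) * Q X $$ (s, j))"
          using s ij by (intro rational_mult rational_const rational_J inS rational_corner Qrat) auto
        then show ?thesis unfolding if_P[OF True] .
      next
        case False
        show ?thesis unfolding if_not_P[OF False] by (rule rational_const)
      qed
    qed
    then show ?thesis
    proof (rule rational_cong)
      fix X :: "'a mat" assume X: "X \<in> generic_locus"
      note inv = inverse_antitriangular(1)[OF Y[OF X] Qc[OF X] YQ[OF X] Dnz[OF X]]
      have PY: "antitriangular n (P X * Y X)"
        by (rule antitriangular_mult_left[OF unipotent_inside[OF P[OF X]] Y[OF X]])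
      have "P X = P X * (Y X * Q X)" using YQ[OF X] Pc[OF X] by simp
      also have "\<dots> = P X * Y X * Q X"
        using Pc[OF X] Yc[OF X] Qc[OF X] by (intro assoc_mult_mat[symmetric])
      finally have "P X $$ (i, j) = (\<Sum>s<n. (P X * Y X) $$ (i, s) * Q X $$ (s, j))"
        using index_mult_sum[OF antitriangular_carrier[OF PY] Qc[OF X] ij] by simp
      also have "\<dots> = (\<Sum>s<n. ?f X s)"
      proof (rule sum.cong, simp)
        fix s assume s: "s \<in> {..<n}"
        consider "n \<le> i + s" | "s + j + 1 < n" | "i + s < n" "n - 1 - s \<le> j" by linarith
        then show "(P X * Y X) $$ (i, s) * Q X $$ (s, j) = ?f X s"
        proof cases
          case 1
          then have "(P X * Y X) $$ (i, s) = 0" using antitriangular_zero[OF PY ij(1)] s by simp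
          then show ?thesis using 1 by simp
        next
          case 2
          then have "Q X $$ (s, j) = 0" using inv[of s j] s ij by simp
          then show ?thesis by simp
        next
          case 3
          have J: "J_val n (i + 1) (s + 1) X = J_upper n (i + 1) (s + 1) (P X * Y X * v X)"
            using Jinv[OF X inS[OF 3]] 3 by (simp add: J_val_eq_upper)
          have "J_upper n (i + 1) (s + 1) (P X * Y X * v X) = (-1) ^ s * (P X * Y X) $$ (i, s) * corner_minor n s X"
            using J_on_section(2)[OF P[OF X] v[OF X] Pv[OF X] Y[OF X] dY[OF X], of "i + 1" "s + 1"] 3 cY[OF X, of s]
            by simp
          then have "(-1) ^ s * J_val n (i + 1) (s + 1) X * (1 / corner_minor n s X) = (P X * Y X) $$ (i, s)"
            unfolding J using rational_corner(3)[OF _ X, of s] 3 by (simp flip: power_mult_distrib)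
          then show ?thesis using 3 by (simp only: if_True simp_thms)
        qed
      qed
      finally show "(\<Sum>s<n. ?f X s) = P X $$ (i, j)" by simp
    qed
  qed
  have vrat: "rational_in_J (\<lambda>X. v X $$ (a, b))" if "a < n" "b < n" for a b
  proof (rule rational_cong)
    show "rational_in_J (\<lambda>X. adj_mat (P X) $$ (a, b))"
      by (rule rational_adj_mat[OF Pc Prat that])
    fix X :: "'a mat" assume X: "X \<in> generic_locus"
    have "adj_mat (P X) = v X"
      by (rule adj_mat_eq_inverse[OF Pc[OF X] v[OF X] Pv[OF X] det_unipotent[OF unipotent_inside[OF P[OF X]]]])
    then show "adj_mat (P X) $$ (a, b) = v X $$ (a, b)" by simp
  qed
  have "rational_in_J (\<lambda>X. (h X * X * g X) $$ (a, b))" if ab: "a < n" "b < n" for a b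
  proof -
    have PYc: "P X * Y X \<in> carrier_mat n n" if "X \<in> generic_locus" for X :: "'a mat"
      using Pc[OF that] Yc[OF that] by simp
    have "rational_in_J (\<lambda>X. (P X * Y X * v X) $$ (a, b))"
      by (rule rational_mult_mat[OF PYc v rational_mult_mat[OF Pc Yc Prat Yrat] vrat ab])
    then show ?thesis
      by (rule rational_cong) (simp add: Z del: index_mult_mat)
  qed
  then show ?thesis
    using g h gh by (intro that[of g h "\<lambda>X. h X * X * g X"]) simp_all
qed

end

section \<open>The field of invariants\<close>

text \<open>The group enters through this description by supports, which
  \<open>corollary2p10\<close> establishes for a segment partition.\<close>

locale block_invariants = index_blocks n blk for n blk +
  fixes l :: nat and I :: "nat \<Rightarrow> nat set" and ty :: "'a::field_char_0 itself"
  assumes U: "(U_group n l I :: 'a mat set) = {g. unipotent below n g}"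
begin

abbreviation FU :: "'a sl_rat set" where
  "FU \<equiv> U_invariants n l I"

abbreviation generated :: "'a sl_rat set" where
  "generated \<equiv> generate_field (sl_field n) (range (sl_const n) \<union> J_rat n ` S\<^sub>0)"

interpretation F: field "sl_field n :: 'a sl_rat ring"
  by (rule field_sl_field[OF n])

lemma U_inverse:
  fixes g :: "'a mat"
  assumes "g \<in> U_group n l I"
  obtains h where "h \<in> U_group n l I" "invertible_mat_pair n g h" "invertible_mat_pair n h g"
proof -
  have g: "unipotent below n g" using assms U by simp
  note gc = unipotent_carrier[OF g]
  obtain h where h: "h \<in> carrier_mat n n" "g * h = 1\<^sub>m n"
    using right_inverse_exists[OF gc] det_unipotent[OF unipotent_below[OF g]] by auto
  have "unipotent below n h" by (rule unipotent_inverse[OF g h triangular_order_below])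
  moreover have "h * g = 1\<^sub>m n" by (rule mat_mult_left_right_inverse[OF gc h])
  ultimately show ?thesis using gc h n U by (intro that[of h]) (auto simp: invertible_mat_pair_def)
qed

text \<open>Invariance of \<open>p / q\<close> on points, cross multiplied so that it also makes
  sense where a denominator vanishes.\<close>

definition conj_fixed :: "'a coord_poly \<Rightarrow> 'a coord_poly \<Rightarrow> bool" where
  "conj_fixed p q \<longleftrightarrow> (\<forall>g h X. g \<in> U_group n l I \<longrightarrow> invertible_mat_pair n g h \<longrightarrow> X \<in> SL_mat n \<longrightarrow>
    mat_eval (h * X * g) p * mat_eval X q = mat_eval X p * mat_eval (h * X * g) q)"

lemma conj_fixedD:
  "conj_fixed p q \<Longrightarrow> g \<in> U_group n l I \<Longrightarrow> invertible_mat_pair n g h \<Longrightarrow> X \<in> SL_mat n \<Longrightarrow>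
    mat_eval (h * X * g) p * mat_eval X q = mat_eval X p * mat_eval (h * X * g) q"
  by (auto simp: conj_fixed_def)

lemma sl_frac_in_FU_iff:
  fixes p q :: "'a coord_poly"
  assumes p: "p \<in> MP n" and q: "q \<in> MP n" and nz: "SL_nonzero n q"
  shows "sl_frac n p q \<in> FU \<longleftrightarrow> conj_fixed p q"
proof -
  have eq: "conj_rat n g (sl_frac n p q) = sl_frac n p q \<longleftrightarrow>
      (\<forall>X\<in>SL_mat n. mat_eval (h * X * g) p * mat_eval X q = mat_eval X p * mat_eval (h * X * g) q)"
    if gh: "invertible_mat_pair n g h" for g h :: "'a mat"
  proof -
    interpret P: invertible_mat_pair n g h by fact
    show ?thesis
      unfolding conj_rat_sl_frac(1)[OF n gh p q nz]
      by (subst sl_frac_eq_iff[OF n])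
        (use p q nz conj_rat_sl_frac(2)[OF n gh p q nz] in
          \<open>auto simp: P.conj_poly_in_MP P.mat_eval_conj_poly SL_mat_def simp del: One_nat_def\<close>)
  qed
  have "sl_frac n p q \<in> FU \<longleftrightarrow> (\<forall>g\<in>U_group n l I. conj_rat n g (sl_frac n p q) = sl_frac n p q)"
    using sl_frac_carrier[OF n p q nz] by (simp add: U_invariants_def)
  also have "\<dots> \<longleftrightarrow> (\<forall>g h X. g \<in> U_group n l I \<longrightarrow> invertible_mat_pair n g h \<longrightarrow> X \<in> SL_mat n \<longrightarrow>
    mat_eval (h * X * g) p * mat_eval X q = mat_eval X p * mat_eval (h * X * g) q)"
    proof (intro iffI allI impI ballI)
    fix g h X :: "'a mat"
    assume "\<forall>g\<in>U_group n l I. conj_rat n g (sl_frac n p q) = sl_frac n p q"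
      "g \<in> U_group n l I" "invertible_mat_pair n g h" "X \<in> SL_mat n"
    then show "mat_eval (h * X * g) p * mat_eval X q = mat_eval X p * mat_eval (h * X * g) q"
      using eq[of g h] by simp
  next
    fix g :: "'a mat"
    assume inv: "\<forall>g h X. g \<in> U_group n l I \<longrightarrow> invertible_mat_pair n g h \<longrightarrow> X \<in> SL_mat n \<longrightarrow>
      mat_eval (h * X * g) p * mat_eval X q = mat_eval X p * mat_eval (h * X * g) q"
      and g: "g \<in> U_group n l I"
    obtain h where h: "invertible_mat_pair n g h" using g by (rule U_inverse)
    show "conj_rat n g (sl_frac n p q) = sl_frac n p q"
      unfolding eq[OF h] using inv g h by blast
  qed
  finally show ?thesis unfolding conj_fixed_def .
qed

lemma FU_cases:
  assumes "f \<in> FU"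
  obtains p q where "p \<in> MP n" "q \<in> MP n" "SL_nonzero n q" "f = sl_frac n p q" "conj_fixed p q"
proof -
  have "f \<in> carrier (sl_field n)" using assms by (simp add: U_invariants_def)
  then obtain p q where pq: "p \<in> MP n" "q \<in> MP n" "SL_nonzero n q" "f = sl_frac n p q"
    by (rule sl_frac_cases[OF n])
  then have "conj_fixed p q" using assms sl_frac_in_FU_iff[OF pq(1-3)] by simp
  then show ?thesis by (rule that[OF pq])
qed

lemma sl_const_in_FU: "sl_const n c \<in> FU"
  unfolding sl_const_def sl_restrict_eq[OF n]
  by (subst sl_frac_in_FU_iff)
    (auto simp: conj_fixed_def mvars_in_const mvars_in_one SL_nonzero_one[OF n] mat_eval_simps
      simp del: One_nat_def)

lemma J_rat_eq: "J_rat n (i, j) = (sl_frac n (J_poly n i j) 1 :: 'a sl_rat)"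
  by (simp add: J_rat_def sl_restrict_eq[OF n])

lemma J_rat_in_FU:
  assumes "s \<in> S"
  shows "J_rat n s \<in> FU"
proof -
  obtain i j where s: "s = (i, j)" by (cases s)
  have ij: "(i, j) \<in> S" using assms s by simp
  show ?thesis
    unfolding s J_rat_eq
  proof (subst sl_frac_in_FU_iff)
    show "conj_fixed (J_poly n i j) 1"
      unfolding conj_fixed_def
    proof (intro allI impI)
      fix g h X :: "'a mat"
      assume g: "g \<in> U_group n l I" and gh: "invertible_mat_pair n g h" and X: "X \<in> SL_mat n"
      interpret P: invertible_mat_pair n g h by fact
      have gu: "unipotent below n g" using g U by simp
      have hu: "unipotent below n h"
        by (rule unipotent_inverse[OF gu P.h P.gh triangular_order_below])
      have Xc: "X \<in> carrier_mat n n" "det X = 1" using X by (auto simp: SL_mat_def)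
      have "h * X * g \<in> carrier_mat n n" using P.h P.g Xc by simp
      then show "mat_eval (h * X * g) (J_poly n i j) * mat_eval X 1 = mat_eval X (J_poly n i j) * mat_eval (h * X * g) 1"
        using J_val_conj_invariant[OF Xc gu hu P.gh ij] Xc
        by (simp add: J_poly_props(2)[OF ij] mat_eval_simps)
    qed
  qed (use J_poly_props(1)[OF ij] in \<open>simp_all add: mvars_in_one SL_nonzero_one[OF n] del: One_nat_def\<close>)
qed

text \<open>\<open>FU\<close> contains the generators and is closed under the field operations,
  because cross multiplied invariance passes to negatives, inverses, sums and products of
  fractions.\<close>

lemma generate_field_subset_FU: "generated \<subseteq> FU"
proof
  fix x :: "'a sl_rat" assume "x \<in> generated"
  then show "x \<in> FU"
  proof (induction rule: generate_field.induct)
    case one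
    then show ?case using sl_const_in_FU[of 1]
      by (simp add: sl_const_def sl_restrict_eq[OF n] sl_frac_one[OF n] mconst_def)
  next
    case (incl f)
    then show ?case using sl_const_in_FU J_rat_in_FU by auto
  next
    case (a_inv f)
    obtain p q where pq: "p \<in> MP n" "q \<in> MP n" "SL_nonzero n q" "f = sl_frac n p q" "conj_fixed p q"
      by (rule FU_cases[OF a_inv.IH])
    show ?case
      unfolding pq(4) sl_frac_uminus[OF n pq(1-3)]
      by (subst sl_frac_in_FU_iff)
        (use pq in \<open>simp_all add: conj_fixed_def mvars_in_uminus mat_eval_simps del: One_nat_def\<close>)
  next
    case (m_inv f)
    obtain p q where pq: "p \<in> MP n" "q \<in> MP n" "SL_nonzero n q" "f = sl_frac n p q" "conj_fixed p q"
      by (rule FU_cases[OF m_inv.IH])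
    have p: "SL_nonzero n p" using m_inv.hyps pq sl_frac_eq_zero_iff[OF n pq(1-3)] by simp
    show ?case
      unfolding pq(4) sl_frac_inv[OF n pq(1,2) p pq(3)]
      by (subst sl_frac_in_FU_iff[OF pq(2,1) p]) (use pq(5) in \<open>simp add: conj_fixed_def mult.commute\<close>)
  next
    case (eng_add f f')
    obtain p q where pq: "p \<in> MP n" "q \<in> MP n" "SL_nonzero n q" "f = sl_frac n p q" "conj_fixed p q"
      by (rule FU_cases[OF eng_add.IH(1)])
    obtain p' q' where pq': "p' \<in> MP n" "q' \<in> MP n" "SL_nonzero n q'" "f' = sl_frac n p' q'" "conj_fixed p' q'"
      by (rule FU_cases[OF eng_add.IH(2)])
    have alg: "(a * b' + a' * b) * (d * d') = (c * d' + c' * d) * (b * b')"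
      if "a * d = c * b" "a' * d' = c' * b'" for a b c d a' b' c' d' :: 'a
    proof -
      have "(a * b' + a' * b) * (d * d') = (a * d) * (b' * d') + (a' * d') * (b * d)"
        by (simp add: algebra_simps)
      also have "\<dots> = (c * d' + c' * d) * (b * b')" unfolding that by (simp add: algebra_simps)
      finally show ?thesis .
    qed
    show ?case
      unfolding pq(4) pq'(4) sl_frac_add[OF n pq(1,2) pq'(1,2) pq(3) pq'(3)]
    proof (subst sl_frac_in_FU_iff)
      show "SL_nonzero n (q * q')" by (rule SL_nonzero_mult[OF n pq(2) pq'(2) pq(3) pq'(3)])
      show "conj_fixed (p * q' + p' * q) (q * q')"
        unfolding conj_fixed_def mat_eval_simps
        by (intro allI impI alg conj_fixedD[OF pq(5)] conj_fixedD[OF pq'(5)])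
    qed (intro mvars_in_add mvars_in_mult pq(1,2) pq'(1,2))+
  next
    case (eng_mult f f')
    obtain p q where pq: "p \<in> MP n" "q \<in> MP n" "SL_nonzero n q" "f = sl_frac n p q" "conj_fixed p q"
      by (rule FU_cases[OF eng_mult.IH(1)])
    obtain p' q' where pq': "p' \<in> MP n" "q' \<in> MP n" "SL_nonzero n q'" "f' = sl_frac n p' q'" "conj_fixed p' q'"
      by (rule FU_cases[OF eng_mult.IH(2)])
    have alg: "(a * a') * (d * d') = (c * c') * (b * b')"
      if "a * d = c * b" "a' * d' = c' * b'" for a b c d a' b' c' d' :: 'a
    proof -
      have "(a * a') * (d * d') = (a * d) * (a' * d')" by (simp add: algebra_simps)
      also have "\<dots> = (c * c') * (b * b')" unfolding that by (simp add: algebra_simps)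
      finally show ?thesis .
    qed
    show ?case
      unfolding pq(4) pq'(4) sl_frac_mult[OF n pq(1,2) pq'(1,2) pq(3) pq'(3)]
    proof (subst sl_frac_in_FU_iff)
      show "SL_nonzero n (q * q')" by (rule SL_nonzero_mult[OF n pq(2) pq'(2) pq(3) pq'(3)])
      show "conj_fixed (p * p') (q * q')"
        unfolding conj_fixed_def mat_eval_simps
        by (intro allI impI alg conj_fixedD[OF pq(5)] conj_fixedD[OF pq'(5)])
    qed (intro mvars_in_mult pq(1,2) pq'(1,2))+
  qed
qed

section \<open>Generation by the minors and their independence\<close>

definition J_subst :: "(nat \<times> nat, 'a) mvpoly \<Rightarrow> 'a coord_poly" where
  "J_subst = mp_eval mconst (\<lambda>(i, j). J_poly n i j)"

lemma J_subst_in_MP: "P \<in> mvars_in S\<^sub>0 \<Longrightarrow> J_subst P \<in> MP n"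
  unfolding J_subst_def by (rule mp_eval_in_mvars) (auto intro!: J_poly_props(1)[unfolded One_nat_def])

lemma mat_eval_J_subst:
  assumes "P \<in> mvars_in S\<^sub>0" "X \<in> carrier_mat n n"
  shows "mat_eval X (J_subst P) = mp_at (J_point X) P"
proof -
  have "mat_eval X (J_subst P) = mp_at (\<lambda>v. mat_eval X (case v of (i, j) \<Rightarrow> J_poly n i j)) P"
    by (simp add: J_subst_def mat_eval_def mp_at_mp_eval)
  also have "\<dots> = mp_at (J_point X) P"
    by (rule mp_eval_cong[OF assms(1)])
      (use assms(2) in \<open>auto simp: J_point_def J_poly_props(2)\<close>)
  finally show ?thesis .
qed

lemma sl_restrict_J_subst:
  assumes "P \<in> mvars_in S\<^sub>0"
  shows "sl_restrict n (J_subst P) \<in> generated"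
proof -
  interpret r: ring_hom_cring "mat_poly_ring n" "sl_field n" "sl_restrict n :: _ \<Rightarrow> 'a sl_rat"
    by (rule ring_hom_sl_restrict[OF n])
  interpret mc: comm_ring_hom "mconst :: 'a \<Rightarrow> 'a coord_poly" by (rule comm_ring_hom_mconst)
  note simps = J_subst_def mc.mp_eval_const mc.mp_eval_var mc.mp_eval_add mc.mp_eval_mult
  from assms show ?thesis
  proof (induction rule: mvpoly_induct)
    case (const c)
    have "sl_restrict n (J_subst (mconst c)) = sl_const n c" by (simp add: simps sl_const_def)
    then show ?case by (auto intro: generate_field.incl)
  next
    case (var v)
    have "sl_restrict n (J_subst (mvar v)) = J_rat n v" by (cases v) (simp add: simps J_rat_def)
    then show ?case using var by (auto intro: generate_field.incl)
  next
    case (add P Q)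
    have "sl_restrict n (J_subst (P + Q)) = sl_restrict n (J_subst P) \<oplus>\<^bsub>sl_field n\<^esub> sl_restrict n (J_subst Q)"
      using r.hom_add[of "J_subst P" "J_subst Q"] J_subst_in_MP[OF add.hyps(1)] J_subst_in_MP[OF add.hyps(2)]
      by (simp add: simps)
    then show ?case using add.IH by (auto intro: generate_field.eng_add)
  next
    case (mult P Q)
    have "sl_restrict n (J_subst (P * Q)) = sl_restrict n (J_subst P) \<otimes>\<^bsub>sl_field n\<^esub> sl_restrict n (J_subst Q)"
      using r.hom_mult[of "J_subst P" "J_subst Q"] J_subst_in_MP[OF mult.hyps(1)] J_subst_in_MP[OF mult.hyps(2)]
      by (simp add: simps)
    then show ?case using mult.IH by (auto intro: generate_field.eng_mult)
  qed
qed

text \<open>By \<open>J_surjective\<close> there is a point of SL(n) where all the minors are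
  1.\<close>

lemma den_nonzero: "SL_nonzero n (J_subst den)"
proof -
  obtain Z :: "'a mat" where Z: "Z \<in> carrier_mat n n" "det Z = 1" "\<forall>i j. (i, j) \<in> S \<longrightarrow> J_val n i j Z = 1"
    by (rule J_surjective[of "\<lambda>_. 1 :: 'a"]) simp_all
  have "mp_at (J_point Z) den = (1 :: 'a)"
    unfolding den_def by (auto simp: mp_at_simps J_point_def Z(3) intro!: prod.neutral)
  then show ?thesis
    using Z mat_eval_J_subst[OF den_in Z(1)] by (auto simp: SL_nonzero_def SL_mat_def intro!: bexI[of _ Z])
qed

text \<open>
  The denominator of an invariant may vanish on the whole section; translating numerator and
  denominator by a suitable element of \<open>U\<close> avoids this.
\<close>

lemma FU_subset_generate_field: "FU \<subseteq> generated"
proof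
  fix f assume f: "f \<in> FU"
  obtain p q where pq: "p \<in> MP n" "q \<in> MP n" "SL_nonzero n q" "f = sl_frac n p q"
    by (rule FU_cases[OF f])
  obtain Z g h :: "'a mat \<Rightarrow> 'a mat"
    where sec0: "\<forall>X\<in>generic_locus. unipotent below n (g X) \<and> unipotent below n (h X) \<and>
      g X * h X = 1\<^sub>m n \<and> Z X = h X * X * g X"
    and rat: "\<forall>a<n. \<forall>b<n. rational_in_J (\<lambda>X. Z X $$ (a, b))"
    by (rule rational_section)
  have sec: "unipotent below n (g X)" "unipotent below n (h X)" "g X * h X = 1\<^sub>m n" "Z X = h X * X * g X"
    if "X \<in> generic_locus" for X
    using sec0 that by simp_all
  have SLc: "X \<in> carrier_mat n n" if "X \<in> SL_mat n" for X :: "'a mat" using that by (simp add: SL_mat_def)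
  have pair: "invertible_mat_pair n (g X) (h X)" "invertible_mat_pair n (h X) (g X)"
    "g X \<in> U_group n l I" "h X \<in> U_group n l I" if "X \<in> generic_locus" for X
  proof -
    note c = unipotent_carrier[OF sec(1)[OF that]] unipotent_carrier[OF sec(2)[OF that]]
    show "invertible_mat_pair n (g X) (h X)" "invertible_mat_pair n (h X) (g X)"
      using c sec(3)[OF that] mat_mult_left_right_inverse[OF c sec(3)[OF that]] n
      by (simp_all add: invertible_mat_pair_def)
    show "g X \<in> U_group n l I" "h X \<in> U_group n l I" using sec(1,2)[OF that] U by auto
  qed
  note den_MP = J_subst_in_MP[OF den_in]
  \<comment> \<open>The section is available at \<open>X0\<close>, but \<open>q\<close> may still
    vanish at the representative \<open>Z X0\<close>.\<close>
  obtain X0 where X0: "X0 \<in> SL_mat n" "mat_eval X0 q \<noteq> 0" "mat_eval X0 (J_subst den) \<noteq> 0"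
    using pq(3) den_nonzero SL_mat_common_nonzero[OF pq(2) den_MP n] unfolding SL_nonzero_def by metis
  have G0: "X0 \<in> generic_locus"
    using X0 mat_eval_J_subst[OF den_in SLc[OF X0(1)]] by (simp add: generic_locus_def)
  let ?g = "g X0" and ?h = "h X0"
  interpret P: invertible_mat_pair n ?h ?g by (rule pair(2)[OF G0])
  \<comment> \<open>Translation by the element that carries \<open>X0\<close> to
    \<open>Z X0\<close>: \<open>q1\<close> takes at \<open>Z X0\<close> the value of
    \<open>q\<close> at \<open>X0\<close>.\<close>
  define p1 where "p1 = conj_poly n ?h p"
  define q1 where "q1 = conj_poly n ?h q"
  have pq1: "p1 \<in> MP n" "q1 \<in> MP n" unfolding p1_def q1_def using P.conj_poly_in_MP pq by auto
  have nz1: "SL_nonzero n q1" unfolding q1_def by (rule conj_rat_sl_frac(2)[OF n pair(2)[OF G0] pq(1-3)])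
  have f1: "f = sl_frac n p1 q1"
    using f pair(4)[OF G0] conj_rat_sl_frac(1)[OF n pair(2)[OF G0] pq(1-3)]
    by (simp add: U_invariants_def pq(4) p1_def q1_def)
  have inv1: "mat_eval (h' * X * g') p1 * mat_eval X q1 = mat_eval X p1 * mat_eval (h' * X * g') q1"
    if "g' \<in> U_group n l I" "invertible_mat_pair n g' h'" "X \<in> SL_mat n" for g' h' X
    by (rule conj_fixedD[OF _ that]) (use f sl_frac_in_FU_iff[OF pq1 nz1] f1 in simp)
  have q1Z: "mat_eval (Z X0) q1 \<noteq> 0"
  proof -
    have ZSL: "Z X0 \<in> SL_mat n"
      unfolding sec(4)[OF G0] by (rule invertible_mat_pair.conj_in_SL_mat[OF pair(1)[OF G0] X0(1)])
    have "mat_eval (Z X0) q1 = mat_eval (?g * Z X0 * ?h) q"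
      unfolding q1_def by (rule P.mat_eval_conj_poly[OF pq(2) SLc[OF ZSL]])
    also have "?g * Z X0 * ?h = X0"
      unfolding sec(4)[OF G0] by (rule P.conj_conj[OF SLc[OF X0(1)]])
    finally show ?thesis using X0(2) by simp
  qed
  have "rational_in_J (\<lambda>X. mat_eval (Z X) p1)" "rational_in_J (\<lambda>X. mat_eval (Z X) q1)"
    by (rule rational_mat_eval; use rat pq1 in simp)+
  then obtain A d B e where A: "A \<in> mvars_in S\<^sub>0" "\<And>X. X \<in> generic_locus \<Longrightarrow>
      mat_eval (Z X) p1 * mp_at (J_point X) den ^ d = mp_at (J_point X) A"
    and B: "B \<in> mvars_in S\<^sub>0" "\<And>X. X \<in> generic_locus \<Longrightarrow>
      mat_eval (Z X) q1 * mp_at (J_point X) den ^ e = mp_at (J_point X) B"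
    unfolding rational_in_J_def by blast
  \<comment> \<open>Powers of \<open>den\<close> clear the denominators of the two values; the extra
    factor \<open>den\<close> makes the identity below trivial where \<open>den\<close>
    vanishes.\<close>
  define A' where "A' = A * den ^ e * den"
  define B' where "B' = B * den ^ d * den"
  have AB: "A' \<in> mvars_in S\<^sub>0" "B' \<in> mvars_in S\<^sub>0"
    unfolding A'_def B'_def by (intro mvars_in_mult mvars_in_power den_in A B)+
  have B'nz: "SL_nonzero n (J_subst B')"
  proof -
    have "mp_at (J_point X0) den \<noteq> 0" using G0 by (simp add: generic_locus_def)
    then have "mp_at (J_point X0) B' \<noteq> 0"
      using B(2)[OF G0] q1Z unfolding B'_def by (simp add: mp_at_simps flip: B(2)[OF G0])
    then show ?thesis
      using mat_eval_J_subst[OF AB(2) SLc[OF X0(1)]] X0(1)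
      unfolding SL_nonzero_def by (intro bexI[of _ X0]) simp_all
  qed
  have "f = sl_frac n (J_subst A') (J_subst B')"
    unfolding f1
  proof (subst sl_frac_eq_iff[OF n pq1 J_subst_in_MP[OF AB(1)] J_subst_in_MP[OF AB(2)] nz1 B'nz], intro ballI)
    fix X :: "'a mat" assume X: "X \<in> SL_mat n"
    let ?D = "mp_at (J_point X) den"
    show "mat_eval X p1 * mat_eval X (J_subst B') = mat_eval X (J_subst A') * mat_eval X q1"
      unfolding mat_eval_J_subst[OF AB(1) SLc[OF X]] mat_eval_J_subst[OF AB(2) SLc[OF X]]
    proof (cases "?D = 0")
      case True
      then show "mat_eval X p1 * mp_at (J_point X) B' = mp_at (J_point X) A' * mat_eval X q1"
        by (simp add: A'_def B'_def mp_at_simps)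
    next
      case False
      then have G: "X \<in> generic_locus" using X by (simp add: generic_locus_def)
      have "mat_eval X p1 * mp_at (J_point X) B' = (mat_eval X p1 * mat_eval (Z X) q1) * (?D ^ e * ?D ^ d * ?D)"
        by (simp add: B'_def mp_at_simps flip: B(2)[OF G])
      \<comment> \<open>Invariance of \<open>f\<close> compares the values at \<open>X\<close> with
        those at its section representative.\<close>
      also have "mat_eval X p1 * mat_eval (Z X) q1 = mat_eval (Z X) p1 * mat_eval X q1"
        using inv1[OF pair(3)[OF G] pair(1)[OF G] X] sec(4)[OF G] by simp
      also have "\<dots> * (?D ^ e * ?D ^ d * ?D) = mp_at (J_point X) A' * mat_eval X q1"
        by (simp add: A'_def mp_at_simps flip: A(2)[OF G])
      finally show "mat_eval X p1 * mp_at (J_point X) B' = mp_at (J_point X) A' * mat_eval X q1" .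
    qed
  qed
  also have "\<dots> = sl_restrict n (J_subst A') \<otimes>\<^bsub>sl_field n\<^esub> inv\<^bsub>sl_field n\<^esub> sl_restrict n (J_subst B')"
    unfolding sl_restrict_eq[OF n]
    using J_subst_in_MP[OF AB(1)] J_subst_in_MP[OF AB(2)] B'nz SL_nonzero_one[OF n, where ?'a = 'a]
    by (simp add: sl_frac_inv[OF n] sl_frac_mult[OF n] mvars_in_one del: One_nat_def)
  also have "\<dots> \<in> generated"
  proof (intro generate_field.eng_mult generate_field.m_inv sl_restrict_J_subst AB)
    show "sl_restrict n (J_subst B') \<noteq> \<zero>\<^bsub>sl_field n\<^esub>"
      unfolding sl_restrict_eq[OF n]
      by (subst sl_frac_eq_zero_iff[OF n J_subst_in_MP[OF AB(2)]])
        (simp_all add: mvars_in_one SL_nonzero_one[OF n] B'nz del: One_nat_def)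
  qed
  finally show "f \<in> generated" .
qed

text \<open>A relation \<open>P\<close> vanishes at \<open>J_point X\<close> for all
  \<open>X\<close> in SL(n). By \<open>J_surjective\<close> every assignment of nonzero values to
  the index set is realized by such a point, so \<open>mvpoly_eq_zeroI_torus\<close>
  applies.\<close>

lemma alg_independent_J: "alg_independent (sl_field n :: 'a sl_rat ring) (sl_const n) (J_rat n) S\<^sub>0"
  unfolding alg_independent_def
proof (intro ballI impI)
  fix P :: "(nat \<times> nat, 'a) mvpoly"
  assume P: "P \<in> mvars_in S\<^sub>0" and z: "meval (sl_field n) (sl_const n) (J_rat n) P = \<zero>\<^bsub>sl_field n\<^esub>"
  have J: "J_rat n = (\<lambda>v. sl_restrict n (case v of (i, j) \<Rightarrow> J_poly n i j) :: 'a sl_rat)"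
    by (auto simp: J_rat_def)
  have "meval (sl_field n) (sl_const n) (J_rat n) P = sl_restrict n (J_subst P)"
    unfolding J J_subst_def
    by (rule meval_sl_field[OF n P]) (auto intro!: J_poly_props(1)[unfolded One_nat_def])
  then have "sl_frac n (J_subst P) 1 = \<zero>\<^bsub>sl_field n\<^esub>" using z by (simp add: sl_restrict_eq[OF n])
  then have "\<not> SL_nonzero n (J_subst P)"
    by (subst (asm) sl_frac_eq_zero_iff[OF n J_subst_in_MP[OF P]])
      (simp_all add: mvars_in_one SL_nonzero_one[OF n] del: One_nat_def)
  then have van: "mp_at (J_point X) P = 0" if "X \<in> SL_mat n" for X
    using that mat_eval_J_subst[OF P] by (auto simp: SL_nonzero_def SL_mat_def)
  show "P = 0"
  proof (rule mvpoly_eq_zeroI_torus[OF P])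
    show "finite S\<^sub>0" using finite_S by simp
    fix x :: "nat \<times> nat \<Rightarrow> 'a" assume x: "\<And>v. v \<in> S\<^sub>0 \<Longrightarrow> x v \<noteq> 0"
    \<comment> \<open>The coordinate \<open>(1, n)\<close> is not a variable of \<open>P\<close>; it
      receives the value of the determinant.\<close>
    define \<tau> where "\<tau> = x((1, n) := 1)"
    have nz: "\<tau> s \<noteq> 0" if "s \<in> S" for s
      using x[of s] that by (cases "s = (1, n)") (simp_all add: \<tau>_def)
    have one: "\<tau> (1, n) = 1" by (simp add: \<tau>_def)
    obtain Z where Z: "Z \<in> carrier_mat n n" "det Z = 1" "\<forall>i j. (i, j) \<in> S \<longrightarrow> J_val n i j Z = \<tau> (i, j)"
      by (rule J_surjective[of \<tau>, OF nz one])
    have "x v = J_point Z v" if "v \<in> S\<^sub>0" for v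
      using that Z(3) by (cases v) (auto simp: J_point_def \<tau>_def)
    then have "mp_at x P = mp_at (J_point Z) P" by (rule mp_eval_cong[OF P])
    then show "mp_at x P = 0" using van[of Z] Z by (simp add: SL_mat_def)
  qed
qed

end

section \<open>From segments to block numbers\<close>

lemma segment_partition_blocks:
  assumes "segment_partition n l I" "1 \<le> n"
  obtains blk where "index_blocks n blk"
    "\<And>i k. i \<in> {1..n} \<Longrightarrow> k \<in> {1..l} \<Longrightarrow> i \<in> I k \<longleftrightarrow> k = blk (i - 1)"
    "\<And>i. i \<in> {1..n} \<Longrightarrow> blk (i - 1) \<in> {1..l}"
    "\<And>i k. k \<in> {1..l} \<Longrightarrow> i \<in> I k \<Longrightarrow> i \<in> {1..n}"
proof -
  have cover: "(\<Union>k\<in>{1..l}. I k) = {1..n}"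
    and less: "\<And>k m i j. k \<in> {1..l} \<Longrightarrow> m \<in> {1..l} \<Longrightarrow> k < m \<Longrightarrow> i \<in> I k \<Longrightarrow> j \<in> I m \<Longrightarrow> i < j"
    using assms(1) unfolding segment_partition_def by blast+
  \<comment> \<open>The segments consist of numbers from 1 on, while the argument of
    \<open>blk\<close> counts from 0; hence \<open>Suc i\<close>.\<close>
  define blk where "blk i = (SOME k. k \<in> {1..l} \<and> Suc i \<in> I k)" for i
  have blk: "blk (i - 1) \<in> {1..l}" "i \<in> I (blk (i - 1))" if "i \<in> {1..n}" for i
  proof -
    have "\<exists>k. k \<in> {1..l} \<and> i \<in> I k" using that cover by blast
    moreover have "Suc (i - 1) = i" using that by simp
    ultimately have "blk (i - 1) \<in> {1..l} \<and> i \<in> I (blk (i - 1))"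
      unfolding blk_def by (simp only:) (rule someI_ex)
    then show "blk (i - 1) \<in> {1..l}" "i \<in> I (blk (i - 1))" by blast+
  qed
  show ?thesis
  proof (rule that[of blk])
    show "index_blocks n blk"
    proof
      fix i j assume ij: "i \<le> j" "j < n"
      show "blk i \<le> blk j"
      proof (rule ccontr)
        assume "\<not> ?thesis"
        then have "j + 1 < i + 1"
          using less[of "blk j" "blk i" "j + 1" "i + 1"] blk[of "i + 1"] blk[of "j + 1"] ij by simp
        then show False using ij by simp
      qed
    qed (use assms in simp)
    show "i \<in> I k \<longleftrightarrow> k = blk (i - 1)" if "i \<in> {1..n}" "k \<in> {1..l}" for i k
      using blk[OF that(1)] less[of k "blk (i - 1)" i i] less[of "blk (i - 1)" k i i] that(2)
      by (cases k "blk (i - 1)" rule: linorder_cases) auto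
    show "i \<in> {1..n}" if "k \<in> {1..l}" "i \<in> I k" for i k
      using that cover by blast
  qed (rule blk(1))
qed

theorem corollary2p10:
  fixes n l :: nat and I :: "nat \<Rightarrow> nat set"
  assumes "n \<ge> 1"
    and "segment_partition n l I"
  shows
    "let F = (sl_field n :: 'a::field_char_0 sl_rat ring);
         FU = U_invariants n l I;
         S = index_set n l I - {(1, n)}
     in J_rat n ` S \<subseteq> FU \<and>
        alg_independent F (sl_const n) (J_rat n) S \<and>
        generate_field F (range (sl_const n) \<union> J_rat n ` S) = FU"
proof -
  obtain blk where ib: "index_blocks n blk"
    and mem: "\<And>i k. i \<in> {1..n} \<Longrightarrow> k \<in> {1..l} \<Longrightarrow> i \<in> I k \<longleftrightarrow> k = blk (i - 1)"
    and blk: "\<And>i. i \<in> {1..n} \<Longrightarrow> blk (i - 1) \<in> {1..l}"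
    and sub: "\<And>i k. k \<in> {1..l} \<Longrightarrow> i \<in> I k \<Longrightarrow> i \<in> {1..n}"
    using segment_partition_blocks[OF assms(2,1)] by blast
  interpret index_blocks n blk by (rule ib)
  have rel: "(\<exists>k\<in>{1..l}. \<exists>m\<in>{1..l}. k < m \<and> i \<in> I k \<and> j \<in> I m) \<longleftrightarrow> blk (i - 1) < blk (j - 1)"
    if "i \<in> {1..n}" "j \<in> {1..n}" for i j
  proof
    assume "\<exists>k\<in>{1..l}. \<exists>m\<in>{1..l}. k < m \<and> i \<in> I k \<and> j \<in> I m"
    then obtain k m where "k \<in> {1..l}" "m \<in> {1..l}" "k < m" "i \<in> I k" "j \<in> I m" by blast
    then show "blk (i - 1) < blk (j - 1)" using mem that by simp
  next
    assume "blk (i - 1) < blk (j - 1)"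
    then show "\<exists>k\<in>{1..l}. \<exists>m\<in>{1..l}. k < m \<and> i \<in> I k \<and> j \<in> I m"
      using mem[OF that(1) blk[OF that(1)]] mem[OF that(2) blk[OF that(2)]] blk[OF that(1)] blk[OF that(2)]
      by blast
  qed
  have U: "(U_group n l I :: 'a mat set) = {g. unipotent below n g}"
  proof (intro equalityI subsetI CollectI)
    fix g :: "'a mat" assume "g \<in> U_group n l I"
    then obtain A where A: "g = 1\<^sub>m n + A" "A \<in> carrier_mat n n"
      and supp0: "\<forall>i\<in>{1..n}. \<forall>j\<in>{1..n}. A $$ (i - 1, j - 1) \<noteq> 0 \<longrightarrow>
        (\<exists>k\<in>{1..l}. \<exists>m\<in>{1..l}. k < m \<and> i \<in> I k \<and> j \<in> I m)"
      unfolding U_group_def by blast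
    have supp: "blk (i - 1) < blk (j - 1)"
      if ij: "i \<in> {1..n}" "j \<in> {1..n}" and "A $$ (i - 1, j - 1) \<noteq> 0" for i j
      using supp0[rule_format, OF that] rel[OF ij] by simp
    have supp': "A $$ (i, j) = 0" if "i < n" "j < n" "\<not> blk i < blk j" for i j
      using supp[of "i + 1" "j + 1"] that by auto
    show "unipotent below n g"
      unfolding unipotent_def supported_def
    proof (intro conjI allI impI)
      fix i j assume ij: "i < n" "j < n" and nz: "g $$ (i, j) \<noteq> 0"
      show "below i j"
      proof (rule ccontr)
        assume *: "\<not> below i j"
        then have "A $$ (i, j) = 0" using supp'[OF ij] by (simp add: below_def)
        moreover have "i \<noteq> j" using * by (simp add: below_def)
        ultimately show False using nz A ij by simp
      qed
    qed (use A supp' in simp_all)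
  next
    fix g :: "'a mat" assume "g \<in> {g. unipotent below n g}"
    then have g: "unipotent below n g" by simp
    note gc = unipotent_carrier[OF g]
    let ?A = "mat n n (\<lambda>(i, j). if i = j then 0 else g $$ (i, j))"
    have geq: "g = 1\<^sub>m n + ?A"
      by (rule eq_matI) (use gc unipotent_diag[OF g] in auto)
    have step: "blk (i - 1) < blk (j - 1)"
      if ij: "i \<in> {1..n}" "j \<in> {1..n}" and nz: "?A $$ (i - 1, j - 1) \<noteq> 0" for i j
    proof -
      have lt: "i - 1 < n" "j - 1 < n" using ij by auto
      then have "g $$ (i - 1, j - 1) \<noteq> 0" "i - 1 \<noteq> j - 1" using nz by (auto split: if_splits)
      moreover from this have "below (i - 1) (j - 1)" using g lt by (simp add: unipotent_def supported_def)
      ultimately show ?thesis by (simp add: below_def)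
    qed
    have "\<forall>i\<in>{1..n}. \<forall>j\<in>{1..n}. ?A $$ (i - 1, j - 1) \<noteq> 0 \<longrightarrow>
        (\<exists>k\<in>{1..l}. \<exists>m\<in>{1..l}. k < m \<and> i \<in> I k \<and> j \<in> I m)"
    proof (intro ballI impI)
      fix i j assume ij: "i \<in> {1..n}" "j \<in> {1..n}" and nz: "?A $$ (i - 1, j - 1) \<noteq> 0"
      show "\<exists>k\<in>{1..l}. \<exists>m\<in>{1..l}. k < m \<and> i \<in> I k \<and> j \<in> I m"
        unfolding rel[OF ij] by (rule step[OF ij nz])
    qed
    moreover have "?A \<in> carrier_mat n n" by simp
    ultimately show "g \<in> U_group n l I"
      unfolding U_group_def using geq by blast
  qed
  have S_eq: "index_set n l I = S"
  proof (intro equalityI subsetI)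
    fix s assume "s \<in> index_set n l I"
    then obtain i j k m where s: "s = (i, j)" "i \<in> {1..n}" "j \<in> {1..n}" "k \<in> {1..l}" "m \<in> {1..l}"
      "i \<in> I k" "j \<in> mirror n ` I m" "m \<le> k"
      unfolding index_set_def by blast
    then obtain t where t: "t \<in> I m" "j = n + 1 - t" by (auto simp: mirror_def)
    have "t \<in> {1..n}" using sub s(5) t(1) by blast
    then have "blk (n - j) = m" "blk (i - 1) = k"
      using mem[of t m] mem[of i k] s t by auto
    then show "s \<in> S" using s by (auto simp: S_def)
  next
    fix s assume "s \<in> S"
    then obtain i j where s: "s = (i, j)" "i \<in> {1..n}" "j \<in> {1..n}" "blk (n - j) \<le> blk (i - 1)"
      by (auto simp: S_def)
    have t: "n + 1 - j \<in> {1..n}" using s by auto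
    have "n + 1 - j - 1 = n - j" by simp
    then have bj: "blk (n - j) \<in> {1..l}" "n + 1 - j \<in> I (blk (n - j))"
      using blk[OF t] mem[OF t blk[OF t]] by auto
    have bi: "blk (i - 1) \<in> {1..l}" "i \<in> I (blk (i - 1))"
      using blk[OF s(2)] mem[OF s(2) blk[OF s(2)]] by auto
    have "j \<in> mirror n ` I (blk (n - j))"
      using bj(2) s(3) by (intro image_eqI[of _ _ "n + 1 - j"]) (auto simp: mirror_def)
    then show "s \<in> index_set n l I"
      unfolding index_set_def using s bi bj by blast
  qed
  interpret block_invariants n blk l I "TYPE('a)"
    by unfold_locales (rule U)
  show ?thesis
    unfolding Let_def S_eq
    using J_rat_in_FU alg_independent_J generate_field_subset_FU FU_subset_generate_field by blast
qed

end
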